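(* Let $M$ be the moduli space of a complete holomorphic family of rational curves $X_x\cong\mathbb{P}^1$ ($x\in M$), which are sections of a complex manifold $Z\to\mathbb{P}^1$, with normal bundles $N_x\to\mathbb{P}^1$. Then $M$ is equipped with a preferred family of one-forms, called the frame: for each $x\in M$ there is a frame section $v(x)=H^{-1}dw|\in \check H^0\left(X_x, N_x\otimes\Lambda^1_x(M)\right)$, and the frame consists of the one-forms on $M$ which are the coefficients of $v$ as polynomials in the coordinate of $\mathbb{P}^1$. The frame is defined uniquely up to an element of $\check H^0(X_x, N_x\otimes N_x^* )$ for each curve $X_x$, i.e. up to multiplication of $v(x)$ by an (invertible) element of $\check H^0(X_x,N_x\otimes N_x^* )$ which may vary arbitrarily with $x$.
   Context: A holomorphic family of compact complex submanifolds of $Z$ with moduli space $M$ is a submanifold $F\subset Z\times M$ such that the projection $\nu:F\to M$ is a proper regular map; the submanifolds are $X_x=\mu(\nu^{-1}(x))$, where $\mu:F\to Z$ is the other projection. It is complete if the natural (Kodaira) map gives an isomorphism $T_xM\cong\check H^0(X_x,N_x)$, where $N_x=TZ|_{X_x}/TX_x$. Cover $\mathbb{P}^1$ by two patches $U,\hat U$ with coordinates $\lambda,\hat\lambda$, $\hat\lambda=\lambda^{-1}$ on $U\cap\hat U$. Let $\dim Z=k+1$, let $w^\mu$, $\hat w^\mu$ ($\mu=1,\dots,k$) be fibre coordinates of $Z\to\mathbb{P}^1$ over $U$, $\hat U$, and let $\hat w^\mu=\hat w^\mu(w^\nu,\lambda)$ be the patching of $Z$. The curve $X_x$ is given over $U$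 by $w^\mu=w^\mu|(x,\lambda)$ and over $\hat U$ by $\hat w^\mu=\hat w^\mu|(x,\hat\lambda)$ (a vertical slash denotes restriction to $X_x$). The patching of $N_x$ is $\mathcal F^\mu_{\ \nu}(x,\lambda)=\frac{\partial\hat w^\mu}{\partial w^\nu}(w^\alpha|,\lambda)$, so that $d\hat w^\mu|=\mathcal F^\mu_{\ \nu}\,dw^\nu|$, where $d$ is the exterior derivative on $M$ at fixed $\lambda$. By the Birkhoff-Grothendieck theorem $\mathcal F=\hat H\,\mathrm{diag}(\lambda^{-n_1},\dots,\lambda^{-n_k})H^{-1}$, where $H$, $\hat H$ are holomorphic maps to $\mathrm{GL}(k,\mathbb{C})$ from $U$, $\hat U$ respectively (for each $x$) and $N_x\cong\bigoplus_i\mathcal O(n_i)$. The frame section is $v(x)=H^{-1}dw|$ over $U$ (equivalently $\hat H^{-1}d\hat w|$ over $\hat U$). *)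

theory Defs
  imports "HOL-Analysis.Analysis" "HOL-Computational_Algebra.Polynomial"
begin

section \<open>Complex manifolds\<close>

definition holo_on :: "(complex^'n \<Rightarrow> complex^'m) \<Rightarrow> (complex^'n) set \<Rightarrow> bool" where
  "holo_on f S \<longleftrightarrow> (\<forall>a\<in>S. \<exists>A :: complex^'n^'m. (f has_derivative (\<lambda>h. A *v h)) (at a))"

type_synonym ('a, 'n) chart = "'a set \<times> ('a \<Rightarrow> complex^'n)"

record ('a, 'n::finite) cmfd =
  mtop :: "'a topology"
  matlas :: "('a set \<times> ('a \<Rightarrow> complex^'n)) set"

definition chart_inv :: "('a, 'n::finite) chart \<Rightarrow> complex^'n \<Rightarrow> 'a" where
  "chart_inv c = inv_into (fst c) (snd c)"

definition is_chart :: "'a topology \<Rightarrow> ('a, 'n::finite) chart \<Rightarrow> bool" where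
  "is_chart T c \<longleftrightarrow> openin T (fst c) \<and> open (snd c ` fst c) \<and>
     homeomorphic_map (subtopology T (fst c)) (top_of_set (snd c ` fst c)) (snd c)"

definition compatible :: "('a, 'n::finite) chart \<Rightarrow> ('a, 'n) chart \<Rightarrow> bool" where
  "compatible c d \<longleftrightarrow>
     holo_on (snd d \<circ> chart_inv c) (snd c ` (fst c \<inter> fst d)) \<and>
     holo_on (snd c \<circ> chart_inv d) (snd d ` (fst c \<inter> fst d))"

text \<open>The maximal atlas.\<close>

definition charts :: "('a, 'n::finite) cmfd \<Rightarrow> ('a, 'n) chart set" where
  "charts X = {c. is_chart (mtop X) c \<and> (\<forall>d\<in>matlas X. compatible c d)}"

definition charts_at :: "('a, 'n::finite) cmfd \<Rightarrow> 'a \<Rightarrow> ('a, 'n) chart set" where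
  "charts_at X p = {c \<in> charts X. p \<in> fst c}"

definition complex_manifold :: "('a, 'n::finite) cmfd \<Rightarrow> bool" where
  "complex_manifold X \<longleftrightarrow> Hausdorff_space (mtop X) \<and> second_countable (mtop X) \<and>
     matlas X \<subseteq> charts X \<and> (\<Union>c\<in>matlas X. fst c) = topspace (mtop X)"

text \<open>Holomorphic vector-valued functions on an open subset, and holomorphic maps.\<close>

definition holomorphic_fun ::
    "('a, 'n::finite) cmfd \<Rightarrow> 'a set \<Rightarrow> ('a \<Rightarrow> complex^'m) \<Rightarrow> bool" where
  "holomorphic_fun X S f \<longleftrightarrow> (\<forall>c\<in>charts X. holo_on (f \<circ> chart_inv c) (snd c ` (fst c \<inter> S)))"

definition holomorphic_map ::
    "('a, 'n::finite) cmfd \<Rightarrow> ('b, 'm::finite) cmfd \<Rightarrow> ('a \<Rightarrow> 'b) \<Rightarrow> bool" where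
  "holomorphic_map X Y f \<longleftrightarrow> continuous_map (mtop X) (mtop Y) f \<and>
     (\<forall>d\<in>charts Y. holomorphic_fun X {p \<in> topspace (mtop X). f p \<in> fst d} (snd d \<circ> f))"

text \<open>A tangent vector at \<open>p\<close> is the family of its components in all the charts at \<open>p\<close>
  (zero elsewhere), transforming by the Jacobians of the coordinate changes.\<close>

type_synonym ('a, 'n) tangent = "('a set \<times> ('a \<Rightarrow> complex^'n)) \<Rightarrow> complex^'n"

definition tangent_space :: "('a, 'n::finite) cmfd \<Rightarrow> 'a \<Rightarrow> ('a, 'n) tangent set" where
  "tangent_space X p = {v.
     (\<forall>c\<in>charts_at X p. \<forall>d\<in>charts_at X p.
        v d = jacobian (snd d \<circ> chart_inv c) (at (snd c p)) *v v c) \<and>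
     (\<forall>c. c \<notin> charts_at X p \<longrightarrow> v c = 0)}"

definition lincomb :: "complex \<Rightarrow> ('a, 'n::finite) tangent \<Rightarrow> complex \<Rightarrow> ('a, 'n) tangent
    \<Rightarrow> ('a, 'n) tangent" where
  "lincomb a u b v = (\<lambda>c. a *s u c + b *s v c)"

text \<open>The derivative of a vector-valued function along a tangent vector; the value does not
  depend on the chart that is used.\<close>

definition mderiv :: "('a, 'n::finite) cmfd \<Rightarrow> ('a \<Rightarrow> complex^'m) \<Rightarrow> 'a \<Rightarrow> ('a, 'n) tangent
    \<Rightarrow> complex^'m" where
  "mderiv X f p v = (let c = (SOME c. c \<in> charts_at X p) in
     jacobian (f \<circ> chart_inv c) (at (snd c p)) *v v c)"

definition differential :: "('a, 'n::finite) cmfd \<Rightarrow> ('b, 'm::finite) cmfd \<Rightarrow> ('a \<Rightarrow> 'b) \<Rightarrow> 'a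
    \<Rightarrow> ('a, 'n) tangent \<Rightarrow> ('b, 'm) tangent" where
  "differential X Y f p v =
     (\<lambda>d. if d \<in> charts_at Y (f p) then mderiv X (snd d \<circ> f) p v else 0)"

definition one_form :: "('a, 'n::finite) cmfd \<Rightarrow> ('a \<Rightarrow> ('a, 'n) tangent \<Rightarrow> complex) \<Rightarrow> bool" where
  "one_form X \<alpha> \<longleftrightarrow> (\<forall>p\<in>topspace (mtop X). \<forall>u\<in>tangent_space X p. \<forall>v\<in>tangent_space X p. \<forall>a b.
     \<alpha> p (lincomb a u b v) = a * \<alpha> p u + b * \<alpha> p v)"

definition slice_chart :: "('a, 'n::finite) cmfd \<Rightarrow> 'a set \<Rightarrow> 'a \<Rightarrow> ('a, 'n) chart \<Rightarrow> 'n set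
    \<Rightarrow> bool" where
  "slice_chart X S p c J \<longleftrightarrow> c \<in> charts_at X p \<and>
     snd c ` (fst c \<inter> S) = {u \<in> snd c ` fst c. \<forall>j\<in>J. u $ j = 0}"

definition complex_submanifold :: "('a, 'n::finite) cmfd \<Rightarrow> 'a set \<Rightarrow> bool" where
  "complex_submanifold X S \<longleftrightarrow>
     S \<subseteq> topspace (mtop X) \<and> (\<forall>p\<in>S. \<exists>c J. slice_chart X S p c J)"

text \<open>For a submanifold \<open>S\<close>, testing one slice chart or all of them gives the same subspace.\<close>

definition sub_tangent_space :: "('a, 'n::finite) cmfd \<Rightarrow> 'a set \<Rightarrow> 'a \<Rightarrow> ('a, 'n) tangent set" where
  "sub_tangent_space X S p =
     {v \<in> tangent_space X p. \<forall>c J. slice_chart X S p c J \<longrightarrow> (\<forall>j\<in>J. v c $ j = 0)}"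

definition prod_mfd :: "('a, 'n::finite) cmfd \<Rightarrow> ('b, 'm::finite) cmfd
    \<Rightarrow> ('a \<times> 'b, 'n + 'm) cmfd" where
  "prod_mfd X Y = \<lparr> mtop = prod_topology (mtop X) (mtop Y),
     matlas = {(fst c \<times> fst d,
                \<lambda>q. \<chi> i. case i of Inl a \<Rightarrow> snd c (fst q) $ a | Inr b \<Rightarrow> snd d (snd q) $ b) |c d.
               c \<in> matlas X \<and> d \<in> matlas Y} \<rparr>"


section \<open>The projective line\<close>

text \<open>\<open>Some z\<close> is the point with coordinate \<open>\<lambda> = z\<close>, and \<open>None\<close> is \<open>\<lambda> = \<infinity>\<close>.\<close>

definition lam :: "complex option \<Rightarrow> complex" where
  "lam q = (case q of None \<Rightarrow> 0 | Some z \<Rightarrow> z)"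

definition lamhat :: "complex option \<Rightarrow> complex" where
  "lamhat q = (case q of None \<Rightarrow> 0 | Some z \<Rightarrow> inverse z)"

definition patchU :: "complex option set" where "patchU = UNIV - {None}"

definition patchUhat :: "complex option set" where "patchUhat = UNIV - {Some 0}"

text \<open>The point with coordinate \<open>\<lambda>\<close> in the second patch.\<close>

definition hatpt :: "complex \<Rightarrow> complex option" where
  "hatpt z = (if z = 0 then None else Some (inverse z))"

definition P1 :: "(complex option, 1) cmfd" where
  "P1 = \<lparr> mtop = Alexandroff_compactification euclidean,
          matlas = {(patchU, \<lambda>q. vec (lam q)), (patchUhat, \<lambda>q. vec (lamhat q))} \<rparr>"


section \<open>Normal bundles\<close>

definition normal_coset :: "('a, 'n::finite) cmfd \<Rightarrow> 'a set \<Rightarrow> 'a \<Rightarrow> ('a, 'n) tangent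
    \<Rightarrow> ('a, 'n) tangent set" where
  "normal_coset X S p u =
     {u' \<in> tangent_space X p. lincomb 1 u' (-1) u \<in> sub_tangent_space X S p}"

definition normal_space :: "('a, 'n::finite) cmfd \<Rightarrow> 'a set \<Rightarrow> 'a \<Rightarrow> ('a, 'n) tangent set set" where
  "normal_space X S p = normal_coset X S p ` tangent_space X p"

definition holomorphic_field :: "('a, 'n::finite) cmfd \<Rightarrow> 'a set \<Rightarrow> ('a \<Rightarrow> ('a, 'n) tangent)
    \<Rightarrow> bool" where
  "holomorphic_field X D V \<longleftrightarrow> (\<forall>q\<in>D. V q \<in> tangent_space X q) \<and>
     (\<forall>c\<in>charts X. holomorphic_fun X (D \<inter> fst c) (\<lambda>q. V q c))"

text \<open>Global holomorphic sections of the quotient bundle \<open>TX|\<^bsub>S\<^esub> / TS\<close>: locally they are represented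
  by the restriction to \<open>S\<close> of a holomorphic vector field of the ambient manifold.\<close>

definition H0_normal :: "('a, 'n::finite) cmfd \<Rightarrow> 'a set \<Rightarrow> ('a \<Rightarrow> ('a, 'n) tangent set) set" where
  "H0_normal X S = {\<sigma>. (\<forall>p\<in>S. \<sigma> p \<in> normal_space X S p) \<and> (\<forall>p. p \<notin> S \<longrightarrow> \<sigma> p = {}) \<and>
     (\<forall>p\<in>S. \<exists>D V. openin (mtop X) D \<and> p \<in> D \<and> holomorphic_field X D V \<and>
        (\<forall>q\<in>D \<inter> S. V q \<in> \<sigma> q))}"

text \<open>Sections of \<open>N \<otimes> T\<^sub>x\<^sup>*M\<close>, as linear maps from \<open>T\<^sub>xM\<close> to the sections of \<open>N\<close>.\<close>

definition H0_normal_form :: "('a, 'n::finite) cmfd \<Rightarrow> 'a set \<Rightarrow> ('x, 'm::finite) cmfd \<Rightarrow> 'x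
    \<Rightarrow> (('x, 'm) tangent \<Rightarrow> 'a \<Rightarrow> ('a, 'n) tangent set) set" where
  "H0_normal_form X S M x = {\<Sigma>. (\<forall>\<theta>\<in>tangent_space M x. \<Sigma> \<theta> \<in> H0_normal X S) \<and>
     (\<forall>\<theta>\<in>tangent_space M x. \<forall>\<eta>\<in>tangent_space M x. \<forall>a b. \<forall>p\<in>S. \<forall>u\<in>\<Sigma> \<theta> p. \<forall>u'\<in>\<Sigma> \<eta> p.
        lincomb a u b u' \<in> \<Sigma> (lincomb a \<theta> b \<eta>) p)}"


section \<open>Holomorphic families of submanifolds\<close>

definition submfd_at :: "('z \<times> 'x) set \<Rightarrow> 'x \<Rightarrow> 'z set" where
  "submfd_at F x = {z. (z, x) \<in> F}"

definition holomorphic_family :: "('z, 'n::finite) cmfd \<Rightarrow> ('x, 'm::finite) cmfd \<Rightarrow> ('z \<times> 'x) set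
    \<Rightarrow> bool" where
  "holomorphic_family Z M F \<longleftrightarrow> complex_submanifold (prod_mfd Z M) F \<and>
     proper_map (subtopology (mtop (prod_mfd Z M)) F) (mtop M) snd \<and>
     (\<forall>q\<in>F. differential (prod_mfd Z M) M snd q ` sub_tangent_space (prod_mfd Z M) F q
        = tangent_space M (snd q))"

text \<open>The Kodaira map lifts \<open>\<theta>\<close> to \<open>TF\<close> along the submanifold and projects to \<open>TZ\<close>; all the lifts
  at a point give the same class modulo the tangent space of the submanifold.\<close>

definition kodaira :: "('z, 'n::finite) cmfd \<Rightarrow> ('x, 'm::finite) cmfd \<Rightarrow> ('z \<times> 'x) set \<Rightarrow> 'x
    \<Rightarrow> ('x, 'm) tangent \<Rightarrow> 'z \<Rightarrow> ('z, 'n) tangent set" where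
  "kodaira Z M F x \<theta> p = (if p \<in> submfd_at F x then
     (\<Union>\<xi> \<in> {\<xi> \<in> sub_tangent_space (prod_mfd Z M) F (p, x).
              differential (prod_mfd Z M) M snd (p, x) \<xi> = \<theta>}.
        normal_coset Z (submfd_at F x) p (differential (prod_mfd Z M) Z fst (p, x) \<xi>)) else {})"

definition complete_family :: "('z, 'n::finite) cmfd \<Rightarrow> ('x, 'm::finite) cmfd \<Rightarrow> ('z \<times> 'x) set
    \<Rightarrow> bool" where
  "complete_family Z M F \<longleftrightarrow> (\<forall>x\<in>topspace (mtop M).
     bij_betw (kodaira Z M F x) (tangent_space M x) (H0_normal Z (submfd_at F x)))"

definition is_section :: "('z, 'n::finite) cmfd \<Rightarrow> ('z \<Rightarrow> complex option) \<Rightarrow> 'z set \<Rightarrow> bool" where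
  "is_section Z \<pi> S \<longleftrightarrow> (\<exists>s. holomorphic_map P1 Z s \<and> (\<forall>q. \<pi> (s q) = q) \<and> S = range s)"


section \<open>Fibre coordinates and patching\<close>

text \<open>\<open>Z\<close> has charts in \<open>complex^('k option)\<close>: the coordinate \<open>None\<close> is the one of the base.\<close>

definition fibre_map :: "(complex option \<Rightarrow> complex) \<Rightarrow> ('z \<Rightarrow> complex option) \<Rightarrow> ('z \<Rightarrow> complex^'k)
    \<Rightarrow> 'z \<Rightarrow> complex^('k option)" where
  "fibre_map l \<pi> w p = (\<chi> i. case i of None \<Rightarrow> l (\<pi> p) | Some \<mu> \<Rightarrow> w p $ \<mu>)"

definition fibre_coordinates :: "('z, 'k::finite option) cmfd \<Rightarrow> ('z \<Rightarrow> complex option)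
    \<Rightarrow> complex option set \<Rightarrow> (complex option \<Rightarrow> complex) \<Rightarrow> 'z set \<Rightarrow> ('z \<Rightarrow> complex^'k) \<Rightarrow> bool" where
  "fibre_coordinates Z \<pi> B l W w \<longleftrightarrow> \<pi> ` W \<subseteq> B \<and> (W, fibre_map l \<pi> w) \<in> charts Z"

text \<open>The patching function \<open>(w, \<lambda>) \<mapsto> what(w, \<lambda>)\<close>.\<close>

definition patching :: "('z \<Rightarrow> complex option) \<Rightarrow> 'z set \<Rightarrow> ('z \<Rightarrow> complex^'k::finite)
    \<Rightarrow> ('z \<Rightarrow> complex^'k) \<Rightarrow> complex^'k \<Rightarrow> complex \<Rightarrow> complex^'k" where
  "patching \<pi> W w what u z =
     what (chart_inv (W, fibre_map lam \<pi> w) (\<chi> i. case i of None \<Rightarrow> z | Some \<mu> \<Rightarrow> u $ \<mu>))"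

text \<open>\<open>w|\<close>, at the point of the curve over \<open>q\<close>, and \<open>dw|\<close>, its derivative on \<open>M\<close> at fixed \<open>q\<close>.\<close>

definition restr :: "('z \<Rightarrow> complex option) \<Rightarrow> ('z \<times> 'x) set \<Rightarrow> ('z \<Rightarrow> complex^'k) \<Rightarrow> complex option
    \<Rightarrow> 'x \<Rightarrow> complex^'k" where
  "restr \<pi> F w q x = w (THE p. p \<in> submfd_at F x \<and> \<pi> p = q)"

definition d_restr :: "('x, 'm::finite) cmfd \<Rightarrow> ('z \<Rightarrow> complex option) \<Rightarrow> ('z \<times> 'x) set
    \<Rightarrow> ('z \<Rightarrow> complex^'k) \<Rightarrow> complex option \<Rightarrow> 'x \<Rightarrow> ('x, 'm) tangent \<Rightarrow> complex^'k" where
  "d_restr M \<pi> F w q x \<theta> = mderiv M (restr \<pi> F w q) x \<theta>"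

definition normal_patching :: "('z \<Rightarrow> complex option) \<Rightarrow> ('z \<times> 'x) set \<Rightarrow> 'z set
    \<Rightarrow> ('z \<Rightarrow> complex^'k::finite) \<Rightarrow> ('z \<Rightarrow> complex^'k) \<Rightarrow> 'x \<Rightarrow> complex \<Rightarrow> complex^'k^'k" where
  "normal_patching \<pi> F W w what x z =
     jacobian (\<lambda>u. patching \<pi> W w what u z) (at (restr \<pi> F w (Some z) x))"

text \<open>The class in \<open>N\<close> with components \<open>s\<close> in the coordinates \<open>w\<close>, i.e.\ the class of the vertical
  vector \<open>s\<^sup>\<mu> \<partial>/\<partial>w\<^sup>\<mu>\<close>.\<close>

definition normal_of_components :: "('z, 'n::finite) cmfd \<Rightarrow> ('z \<Rightarrow> complex option) \<Rightarrow> 'z set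
    \<Rightarrow> ('z \<Rightarrow> complex^'k) \<Rightarrow> 'z \<Rightarrow> complex^'k \<Rightarrow> ('z, 'n) tangent set" where
  "normal_of_components Z \<pi> S w p s =
     (\<Union>t \<in> {t \<in> tangent_space Z p. differential Z P1 \<pi> p t = (\<lambda>_. 0) \<and> mderiv Z w p t = s}.
        normal_coset Z S p t)"


section \<open>Splitting and frame sections\<close>

definition holo_matrix :: "(complex \<Rightarrow> complex^'k^'k) \<Rightarrow> bool" where
  "holo_matrix A \<longleftrightarrow> (\<forall>i j. (\<lambda>z. A z $ i $ j) holomorphic_on UNIV)"

definition split_patching :: "('k::finite \<Rightarrow> int) \<Rightarrow> complex \<Rightarrow> complex^'k^'k" where
  "split_patching n z = (\<chi> i j. if i = j then z powi (- n i) else 0)"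

text \<open>\<open>P\<close> is a patching matrix on the overlap, in terms of \<open>\<lambda>\<close>; \<open>H\<close> is a function of \<open>\<lambda>\<close> and \<open>Hhat\<close>
  one of the other coordinate \<open>\<lambda>\<^sup>-\<^sup>1\<close>.\<close>

definition birkhoff :: "(complex \<Rightarrow> complex^'k^'k) \<Rightarrow> ('k::finite \<Rightarrow> int)
    \<Rightarrow> (complex \<Rightarrow> complex^'k^'k) \<Rightarrow> (complex \<Rightarrow> complex^'k^'k) \<Rightarrow> bool" where
  "birkhoff P n H Hhat \<longleftrightarrow> holo_matrix H \<and> holo_matrix Hhat \<and>
     (\<forall>z. invertible (H z)) \<and> (\<forall>z. invertible (Hhat z)) \<and>
     (\<forall>z. z \<noteq> 0 \<longrightarrow> P z = Hhat (inverse z) ** split_patching n z ** matrix_inv (H z))"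

text \<open>Cech 0-cocycles, for the two patches, of the bundle with patching matrix \<open>P\<close>.\<close>

definition cech_H0 :: "(complex \<Rightarrow> complex^'k^'k::finite)
    \<Rightarrow> ((complex \<Rightarrow> complex^'k) \<times> (complex \<Rightarrow> complex^'k)) set" where
  "cech_H0 P = {(s, shat).
     (\<forall>i. (\<lambda>z. s z $ i) holomorphic_on UNIV) \<and> (\<forall>i. (\<lambda>z. shat z $ i) holomorphic_on UNIV) \<and>
     (\<forall>z. z \<noteq> 0 \<longrightarrow> shat (inverse z) = P z *v s z)}"

text \<open>Invertible cocycles of \<open>N \<otimes> N\<^sup>*\<close>, the endomorphisms of the bundle with patching matrix \<open>P\<close>.\<close>

definition cech_H0_End_inv :: "(complex \<Rightarrow> complex^'k^'k::finite)
    \<Rightarrow> ((complex \<Rightarrow> complex^'k^'k) \<times> (complex \<Rightarrow> complex^'k^'k)) set" where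
  "cech_H0_End_inv P = {(g, ghat). holo_matrix g \<and> holo_matrix ghat \<and>
     (\<forall>z. invertible (g z)) \<and> (\<forall>z. invertible (ghat z)) \<and>
     (\<forall>z. z \<noteq> 0 \<longrightarrow> ghat (inverse z) = P z ** g z ** matrix_inv (P z))}"

text \<open>A choice of splitting for every curve, with no regularity in \<open>x\<close> required.\<close>

definition splitting :: "('x, 'm::finite) cmfd \<Rightarrow> ('z \<Rightarrow> complex option) \<Rightarrow> ('z \<times> 'x) set \<Rightarrow> 'z set
    \<Rightarrow> ('z \<Rightarrow> complex^'k::finite) \<Rightarrow> ('z \<Rightarrow> complex^'k) \<Rightarrow> ('x \<Rightarrow> 'k \<Rightarrow> int)
    \<Rightarrow> ('x \<Rightarrow> complex \<Rightarrow> complex^'k^'k) \<Rightarrow> ('x \<Rightarrow> complex \<Rightarrow> complex^'k^'k) \<Rightarrow> bool" where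
  "splitting M \<pi> F W w what n H Hhat \<longleftrightarrow> (\<forall>x\<in>topspace (mtop M).
     birkhoff (normal_patching \<pi> F W w what x) (n x) (H x) (Hhat x))"

text \<open>\<open>v = H\<^sup>-\<^sup>1 dw|\<close> and its counterpart \<open>vhat = Hhat\<^sup>-\<^sup>1 dwhat|\<close> over the other patch.\<close>

definition frame_sec :: "('x, 'm::finite) cmfd \<Rightarrow> ('z \<Rightarrow> complex option) \<Rightarrow> ('z \<times> 'x) set
    \<Rightarrow> ('z \<Rightarrow> complex^'k::finite) \<Rightarrow> ('x \<Rightarrow> complex \<Rightarrow> complex^'k^'k) \<Rightarrow> 'x \<Rightarrow> ('x, 'm) tangent
    \<Rightarrow> complex \<Rightarrow> complex^'k" where
  "frame_sec M \<pi> F w H x \<theta> z = matrix_inv (H x z) *v d_restr M \<pi> F w (Some z) x \<theta>"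

definition frame_sec_hat :: "('x, 'm::finite) cmfd \<Rightarrow> ('z \<Rightarrow> complex option) \<Rightarrow> ('z \<times> 'x) set
    \<Rightarrow> ('z \<Rightarrow> complex^'k::finite) \<Rightarrow> ('x \<Rightarrow> complex \<Rightarrow> complex^'k^'k) \<Rightarrow> 'x \<Rightarrow> ('x, 'm) tangent
    \<Rightarrow> complex \<Rightarrow> complex^'k" where
  "frame_sec_hat M \<pi> F what Hhat x \<theta> z =
     matrix_inv (Hhat x z) *v d_restr M \<pi> F what (hatpt z) x \<theta>"

text \<open>The frame: the one-forms that are the coefficients of the polynomials \<open>v\<^sub>i\<close>.\<close>

definition frame_form :: "('x, 'm::finite) cmfd \<Rightarrow> ('z \<Rightarrow> complex option) \<Rightarrow> ('z \<times> 'x) set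
    \<Rightarrow> ('z \<Rightarrow> complex^'k::finite) \<Rightarrow> ('x \<Rightarrow> complex \<Rightarrow> complex^'k^'k) \<Rightarrow> 'k \<Rightarrow> nat \<Rightarrow> 'x
    \<Rightarrow> ('x, 'm) tangent \<Rightarrow> complex" where
  "frame_form M \<pi> F w H i r x \<theta> =
     coeff (THE p. \<forall>z. poly p z = frame_sec M \<pi> F w H x \<theta> z $ i) r"

end

theory Submission
  imports Defs "HOL-Complex_Analysis.Complex_Analysis"
begin

text \<open>Along a curve \<open>X\<^sub>x\<close> the vertical vectors \<open>dw\<bar>(\<theta>)\<close> represent the image of \<open>\<theta>\<close> under the Kodaira
  map: a lift of \<open>\<theta>\<close> to the tangent space of \<open>F\<close> is the derivative of the point with parameters
  \<open>(\<lambda>, x)\<close>, and its \<open>\<lambda>\<close>-part is tangent to the curve. Completeness makes this a holomorphic section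
  of the normal bundle, so \<open>dw\<bar>\<close> and \<open>dwhat\<bar>\<close> are entire and form a cocycle for the patching \<open>\<F>\<close>.
  Multiplication by \<open>H\<inverse>\<close> turns it into a cocycle of the split bundle, whose components are
  polynomials of degree at most \<open>n\<^sub>i\<close>. Two splittings of \<open>\<F>\<close> differ by an isomorphism of split bundles,
  which is an automorphism up to a permutation of the summands, and every automorphism gives a new
  splitting.

  The splitting exists by the Birkhoff-Grothendieck theorem. Truncating a Laurent series reduces \<open>\<F>\<close>
  to a matrix close to the identity, for which a Toeplitz equation is solved by a contraction; this
  gives a frame over \<open>U\<close> with finitely many degeneracies and a pole at infinity, and column
  operations remove these one after the other.\<close>

text \<open>The obstacle in the geometric half is the notion of holomorphy: \<open>holo_on\<close>
  asks for a complex matrix as derivative at every point and includes no continuity of the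
  derivative. This matters where \<open>F\<close> is parametrised by \<lambda> and \<open>x\<close>,
  and where the entries of the normal patching, which are derivatives themselves, must be shown to
  be holomorphic in \<lambda>. In the analytic half all estimates are made on the annulus between
  radii 1/2 and 4, so that Laurent coefficients decay like \<open>(1/2) ^ nat \<bar>n\<bar>\<close>
  in both directions. The solution of the Toeplitz equation then converges for
  \<open>norm z < 1\<close> and its partner at infinity for \<open>norm z > 1/2\<close>, and the
  annulus between is where the frame is glued. Zeros of the determinant in the plane and its
  degeneracy at infinity are both cured through a kernel vector; at infinity the columns have
  different orders, and the choice of the column to be replaced becomes essential. A splitting
  carries no order of its exponents and no regularity in \<open>x\<close>. Hence the frame is
  studied on one curve at a time, and a permutation of the summands enters the comparison of two
  splittings.\<close>

no_notation fps_nth (infixl "$" 75)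

section \<open>Laurent decomposition on an annulus\<close>

lemma holomorphic_divide_root:
  assumes "f holomorphic_on UNIV" "f a = 0"
  obtains g where "g holomorphic_on UNIV" "\<And>z. f z = (z - a) * g z"
proof
  show "(\<lambda>z. if z = a then deriv f a else (f z - f a) / (z - a)) holomorphic_on UNIV"
    using assms(1) by (rule pole_lemma) simp
  show "f z = (z - a) * (if z = a then deriv f a else (f z - f a) / (z - a))" for z
    using assms(2) by auto
qed

lemma holomorphic_entire_glue:
  fixes f g :: "complex \<Rightarrow> complex"
  assumes "f holomorphic_on S" "g holomorphic_on T" "open S" "open T" "S \<union> T = UNIV"
    and eq: "\<And>z. z \<in> S \<Longrightarrow> z \<in> T \<Longrightarrow> f z = g z"
  shows "(\<lambda>z. if z \<in> S then f z else g z) holomorphic_on UNIV"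
proof -
  have "(\<lambda>z. if z \<in> S then f z else g z) holomorphic_on S"
    using assms(1) by (rule holomorphic_transform) simp
  moreover have "(\<lambda>z. if z \<in> S then f z else g z) holomorphic_on T"
    using assms(2) by (rule holomorphic_transform) (simp add: eq)
  ultimately show ?thesis
    using holomorphic_on_Un[of _ S T] assms(3-5) by simp
qed

text \<open>One formula for both sides of the circle. For \<open>f\<close> holomorphic off 0, the
  points inside see the part of the Laurent series that is holomorphic at zero, and the points
  outside, up to sign, the part that vanishes at infinity.\<close>

definition cauchy_transform :: "real \<Rightarrow> (complex \<Rightarrow> complex) \<Rightarrow> complex \<Rightarrow> complex" where
  "cauchy_transform R f z = contour_integral (circlepath 0 R) (\<lambda>u. f u / (u - z)) / (2 * pi * \<i>)"

lemma cauchy_transform_differentiable: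
  assumes "continuous_on (sphere 0 R) f" "R > 0" "norm z \<noteq> R"
  shows "cauchy_transform R f field_differentiable at z"
proof -
  let ?C = "circlepath 0 R" and ?U = "- sphere (0::complex) R"
  have pim: "path_image ?C = sphere 0 R" using assms(2) by simp
  have int: "((\<lambda>u. f u / (u - w) ^ 1) has_contour_integral
      contour_integral ?C (\<lambda>u. f u / (u - w))) ?C" if "w \<in> ?U" for w
  proof -
    have "(\<lambda>u. f u / (u - w)) contour_integrable_on ?C"
      using that assms by (intro contour_integrable_continuous_circlepath continuous_intros) auto
    then show ?thesis by (simp add: has_contour_integral_integral)
  qed
  have "((\<lambda>w. contour_integral ?C (\<lambda>u. f u / (u - w))) has_field_derivative
      (of_nat 1 * contour_integral ?C (\<lambda>u. f u / (u - z)^(Suc 1)))) (at z)"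
  proof (rule Cauchy_next_derivative(2)[where B = "2 * pi * \<bar>R\<bar>" and S = ?U])
    show "continuous_on (path_image ?C) f" using assms pim by simp
    show "((\<lambda>u. f u / (u - w) ^ 1) has_contour_integral
      contour_integral ?C (\<lambda>u. f u / (u - w))) ?C" if "w \<in> ?U - path_image ?C" for w
      using int[of w] that by blast
    show "open ?U" by (intro open_Compl closed_sphere)
  qed (use assms pim in \<open>auto simp: vector_derivative_circlepath norm_mult\<close>)
  then have "(\<lambda>w. contour_integral ?C (\<lambda>u. f u / (u - w))) field_differentiable at z"
    unfolding field_differentiable_def by blast
  then have "(\<lambda>w. contour_integral ?C (\<lambda>u. f u / (u - w)) / (2 * pi * \<i>)) field_differentiable at z"
    by (intro field_differentiable_divide) auto
  then show ?thesis unfolding cauchy_transform_def .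
qed

lemma cauchy_transform_bound:
  assumes "continuous_on (sphere 0 R) f" "R > 0" "norm z \<noteq> R" "\<And>u. norm u = R \<Longrightarrow> norm (f u) \<le> B"
  shows "norm (cauchy_transform R f z) \<le> B * R / \<bar>R - norm z\<bar>"
proof -
  let ?C = "circlepath 0 R"
  have "B \<ge> 0" using order_trans[OF norm_ge_zero assms(4)[of "of_real R"]] assms(2) by simp
  have pos: "\<bar>R - norm z\<bar> > 0" using assms(3) by simp
  have "((\<lambda>u. f u / (u - z)) has_contour_integral contour_integral ?C (\<lambda>u. f u / (u - z))) ?C"
    using assms by (intro has_contour_integral_integral contour_integrable_continuous_circlepath
        continuous_intros) auto
  then have "norm (contour_integral ?C (\<lambda>u. f u / (u - z))) \<le> (B / \<bar>R - norm z\<bar>) * (2 * pi * R)"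
  proof (rule has_contour_integral_bound_circlepath)
    fix x :: complex assume x: "norm (x - 0) = R"
    have "\<bar>R - norm z\<bar> \<le> norm (x - z)" using x norm_triangle_ineq3[of x z] by simp
    then show "norm (f x / (x - z)) \<le> B / \<bar>R - norm z\<bar>"
      using assms(4)[of x] x pos \<open>B \<ge> 0\<close> by (auto simp: norm_divide intro!: frac_le)
  qed (use \<open>B \<ge> 0\<close> assms(2) in auto)
  then show ?thesis
    unfolding cauchy_transform_def by (simp add: norm_divide norm_mult field_simps)
qed

text \<open>The difference quotient of \<open>f\<close> at \<open>z\<close> has a removable
  singularity, so its integrals over the two circles agree. Splitting the quotient leaves the
  integral of \<open>1 / (u - z)\<close>, which is \<open>2 * pi * \<i>\<close> over the outer
  circle and 0 over the inner one, because \<open>z\<close> lies between them.\<close>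

lemma cauchy_transform_annulus:
  assumes f: "f holomorphic_on - {0}" and "0 < r" "r < norm z" "norm z < R"
  shows "f z = cauchy_transform R f z - cauchy_transform r f z"
proof -
  have z0: "z \<noteq> 0" using assms by auto
  define F where "F = (\<lambda>u. if u = z then deriv f z else (f u - f z) / (u - z))"
  have F: "F holomorphic_on UNIV - {0}"
    unfolding F_def using f z0 by (intro pole_lemma) (auto simp: Compl_eq_Diff_UNIV interior_open open_Diff)
  have eq: "contour_integral (circlepath 0 R) F = contour_integral (circlepath 0 r) F"
    using assms by (intro contour_integral_circlepath_eq(3)[OF open_UNIV F]) auto
  have part: "contour_integral (circlepath 0 s) F =
      contour_integral (circlepath 0 s) (\<lambda>u. f u / (u - z))
      - f z * contour_integral (circlepath 0 s) (\<lambda>u. 1 / (u - z))" if "s > 0" "norm z \<noteq> s" for s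
  proof -
    have cf: "continuous_on (sphere 0 s) f"
      using that by (intro holomorphic_on_imp_continuous_on[THEN continuous_on_subset, OF f]) auto
    have i1: "(\<lambda>u. f u / (u - z)) contour_integrable_on circlepath 0 s"
      using that cf by (intro contour_integrable_continuous_circlepath continuous_intros) auto
    have i2: "(\<lambda>u. 1 / (u - z)) contour_integrable_on circlepath 0 s"
      using that by (intro contour_integrable_continuous_circlepath continuous_intros) auto
    have "contour_integral (circlepath 0 s) F =
        contour_integral (circlepath 0 s) (\<lambda>u. f u / (u - z) - f z * (1 / (u - z)))"
      using that by (intro contour_integral_cong) (auto simp: F_def diff_divide_distrib)
    also have "\<dots> = contour_integral (circlepath 0 s) (\<lambda>u. f u / (u - z))
       - contour_integral (circlepath 0 s) (\<lambda>u. f z * (1 / (u - z)))"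
      by (rule contour_integral_diff[OF i1 contour_integrable_lmul[OF i2]])
    also have "contour_integral (circlepath 0 s) (\<lambda>u. f z * (1 / (u - z)))
        = f z * contour_integral (circlepath 0 s) (\<lambda>u. 1 / (u - z))"
      by (rule contour_integral_lmul[OF i2])
    finally show ?thesis .
  qed
  have "((\<lambda>u. 1 / (u - z)) has_contour_integral 2 * of_real pi * \<i> * 1) (circlepath 0 R)"
    using assms Cauchy_integral_circlepath_simple[of "\<lambda>_. 1" 0 R z] by auto
  then have iR: "contour_integral (circlepath 0 R) (\<lambda>u. 1 / (u - z)) = 2 * pi * \<i>"
    by (simp add: contour_integral_unique)
  have "((\<lambda>u. 1 / (u - z)) has_contour_integral 0) (circlepath 0 r)"
    using assms
    by (intro Cauchy_theorem_disc_simple[where a = 0 and e = "norm z"] holomorphic_intros) auto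
  then have ir: "contour_integral (circlepath 0 r) (\<lambda>u. 1 / (u - z)) = 0"
    by (simp add: contour_integral_unique)
  show ?thesis
    using eq part[of R] part[of r] iR ir assms
    unfolding cauchy_transform_def by (simp add: field_simps)
qed

text \<open>The contours have radii 4 and 1/4. On \<open>norm z \<le> 2\<close> the outer transform
  is at most \<open>B * 4 / (4 - 2)\<close>, whence \<open>2 * B\<close>; on
  \<open>norm u = 2\<close>, that is \<open>norm z = 1/2\<close>, the principal part is the
  difference of \<open>f\<close> and \<open>g\<close>, whence \<open>B + 2 * B\<close>. The
  normalisation \<open>h 0 = 0\<close> puts the constant term into \<open>g\<close>.\<close>

lemma laurent_decomposition:
  assumes f: "f holomorphic_on - {0}"
    and B: "\<And>z. 1/2 \<le> norm z \<Longrightarrow> norm z \<le> 4 \<Longrightarrow> norm (f z) \<le> B"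
  obtains g h where "g holomorphic_on UNIV" "h holomorphic_on UNIV"
    "\<And>z. z \<noteq> 0 \<Longrightarrow> f z = g z + h (inverse z)"
    "\<And>z. norm z \<le> 2 \<Longrightarrow> norm (g z) \<le> 2 * B" "\<And>u. norm u = 2 \<Longrightarrow> norm (h u) \<le> 3 * B"
    "h 0 = 0"
proof -
  have cf: "continuous_on (sphere 0 s) f" if "s > 0" for s
    using that by (intro holomorphic_on_imp_continuous_on[THEN continuous_on_subset, OF f]) auto
  define a where "a = cauchy_transform 4 f"
  define b where "b = (\<lambda>z. - cauchy_transform (1/4) f z)"
  have ab: "f z = a z + b z" if "1/4 < norm z" "norm z < 4" for z
    using cauchy_transform_annulus[OF f _ that] unfolding a_def b_def by simp
  have ha: "a holomorphic_on ball 0 4"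
    unfolding a_def holomorphic_on_def
    by (auto intro!: field_differentiable_at_within[OF cauchy_transform_differentiable[OF cf]])
  have hb: "b holomorphic_on - cball 0 (1/4)"
    unfolding b_def holomorphic_on_def
    by (auto intro!: field_differentiable_at_within[OF field_differentiable_minus[OF cauchy_transform_differentiable[OF cf]]])
  define g where "g = (\<lambda>z. if z \<in> ball 0 4 then a z else f z - b z)"
  have hg: "g holomorphic_on UNIV"
    unfolding g_def
  proof (rule holomorphic_entire_glue[where T = "- cball 0 (1/4)"])
    show "(\<lambda>z. f z - b z) holomorphic_on - cball 0 (1/4)"
      using f hb by (intro holomorphic_intros) (auto intro: holomorphic_on_subset)
  qed (use ha ab in auto)
  define k where "k = (\<lambda>u. f (inverse u) - g (inverse u))"
  have hk: "k holomorphic_on - {0}"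
  proof -
    have "(f \<circ> inverse) holomorphic_on - {0}" "(g \<circ> inverse) holomorphic_on - {0}"
      by (intro holomorphic_on_compose_gen[OF _ f] holomorphic_on_compose_gen[OF _ hg]
          holomorphic_intros; auto)+
    then show ?thesis unfolding k_def comp_def by (intro holomorphic_intros) auto
  qed
  \<comment> \<open>\<open>B\<close> says nothing about the circle of radius 1/4. Any finite
    \<open>D\<close> will do: it serves to show that the principal part \<open>k\<close>, in the
    coordinate \<open>inverse z\<close>, tends to 0 at 0.\<close>
  obtain D where D: "\<And>u. norm u = 1/4 \<Longrightarrow> norm (f u) \<le> D"
  proof -
    have "bounded (f ` sphere 0 (1/4))"
      by (intro compact_imp_bounded compact_continuous_image cf) auto
    then obtain D where "\<forall>x\<in>sphere 0 (1/4). norm (f x) \<le> D" unfolding bounded_iff by auto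
    then show ?thesis by (intro that[of D]) simp
  qed
  have kb: "norm (k u) \<le> D * (1/4) / (norm (inverse u) - 1/4)" if "u \<noteq> 0" "norm u < 4" for u
  proof -
    have n: "norm (inverse u) > 1/4" using that by (simp add: norm_divide norm_inverse field_simps)
    have "k u = b (inverse u)"
    proof (cases "norm (inverse u) < 4")
      case True
      then show ?thesis using ab[OF n True] by (simp add: k_def g_def)
    next
      case False
      then show ?thesis by (simp add: k_def g_def)
    qed
    moreover have "norm (cauchy_transform (1/4) f (inverse u)) \<le> D * (1/4) / \<bar>1/4 - norm (inverse u)\<bar>"
      by (rule cauchy_transform_bound[OF cf]) (use D n in auto)
    ultimately show ?thesis using n by (simp add: b_def abs_minus_commute)
  qed
  have k0: "k \<midarrow>0\<rightarrow> 0"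
  proof (rule Lim_null_comparison)
    show "eventually (\<lambda>u. norm (k u) \<le> D * (1/4) / (inverse (norm u) - 1/4)) (at 0)"
      unfolding eventually_at by (rule exI[of _ 4]) (use kb in \<open>simp add: norm_inverse\<close>)
    have "((\<lambda>u::complex. D * (1/4) * norm u / (1 - norm u / 4)) \<longlongrightarrow> D * (1/4) * 0 / (1 - 0 / 4)) (at 0)"
      by (intro tendsto_intros tendsto_norm_zero) auto
    then have "((\<lambda>u::complex. D * (1/4) * norm u / (1 - norm u / 4)) \<longlongrightarrow> 0) (at 0)"
      by simp
    then show "((\<lambda>u::complex. D * (1/4) / (inverse (norm u) - 1/4)) \<longlongrightarrow> 0) (at 0)"
      by (rule Lim_transform_eventually) (auto simp: eventually_at_filter field_simps)
  qed
  define h where "h = (\<lambda>u. if u = 0 then 0 else k u)"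
  have hh: "h holomorphic_on UNIV"
  proof (rule no_isolated_singularity'[where K = "{0}"])
    show "h holomorphic_on UNIV - {0}"
      using hk by (rule holomorphic_transform[OF holomorphic_on_subset]) (auto simp: h_def)
    have "h \<midarrow>0\<rightarrow> 0" by (rule Lim_transform_eventually[OF k0]) (auto simp: h_def eventually_at_filter)
    then show "\<And>z. z \<in> {0} \<Longrightarrow> h \<midarrow>z\<rightarrow> h z" by (auto simp: h_def)
  qed auto
  have dec: "f z = g z + h (inverse z)" if "z \<noteq> 0" for z
    using that by (simp add: h_def k_def)
  have "B \<ge> 0" using order_trans[OF norm_ge_zero B[of 1]] by simp
  have gB: "norm (g z) \<le> 2 * B" if "norm z \<le> 2" for z
  proof -
    have "norm (g z) \<le> B * 4 / \<bar>4 - norm z\<bar>"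
    proof -
      have "norm (cauchy_transform 4 f z) \<le> B * 4 / \<bar>4 - norm z\<bar>"
        by (rule cauchy_transform_bound[OF cf]) (use that in \<open>auto intro!: B\<close>)
      then show ?thesis using that by (simp add: g_def a_def)
    qed
    also have "\<dots> \<le> B * 4 / 2" using that \<open>B \<ge> 0\<close> by (intro frac_le) auto
    finally show ?thesis by simp
  qed
  have hB: "norm (h u) \<le> 3 * B" if "norm u = 2" for u
  proof -
    have n: "norm (inverse u) = 1/2" "u \<noteq> 0" using that by (auto simp: norm_inverse)
    have "h u = f (inverse u) - g (inverse u)" using dec[of "inverse u"] n by simp
    then have "norm (h u) \<le> norm (f (inverse u)) + norm (g (inverse u))"
      by (simp add: norm_triangle_ineq4)
    then show ?thesis using B[of "inverse u"] gB[of "inverse u"] n by simp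
  qed
  show ?thesis by (rule that[OF hg hh dec gB hB]) (simp_all add: h_def)
qed

lemma entire_coeff_summable:
  fixes g :: "complex \<Rightarrow> complex"
  assumes "g holomorphic_on UNIV"
  shows "summable (\<lambda>n. norm ((deriv ^^ n) g 0 / fact n * z ^ n))"
    and "(\<lambda>n. (deriv ^^ n) g 0 / fact n * z ^ n) sums g z"
proof -
  have s: "(\<lambda>n. (deriv ^^ n) g 0 / fact n * w ^ n) sums g w" for w
  proof -
    have "g holomorphic_on ball 0 (norm w + 1)" using assms holomorphic_on_subset by blast
    from holomorphic_power_series[OF this, of w] show ?thesis by simp
  qed
  show "(\<lambda>n. (deriv ^^ n) g 0 / fact n * z ^ n) sums g z" by (rule s)
  show "summable (\<lambda>n. norm ((deriv ^^ n) g 0 / fact n * z ^ n))"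
    by (rule powser_insidea[of _ "of_real (norm z + 1)"])
      (use sums_summable[OF s] in \<open>auto simp del: of_real_add\<close>)
qed

lemma entire_coeff_bound:
  assumes "g holomorphic_on UNIV" "\<And>z. norm z = 2 \<Longrightarrow> norm (g z) \<le> B"
  shows "norm ((deriv ^^ n) g 0 / fact n) \<le> B / 2 ^ n"
proof -
  have "norm ((deriv ^^ n) g 0) \<le> fact n * B / 2 ^ n"
  proof (rule Cauchy_inequality)
    show "g holomorphic_on ball 0 2" using assms(1) holomorphic_on_subset by blast
    show "continuous_on (cball 0 2) g"
      using assms(1) holomorphic_on_imp_continuous_on continuous_on_subset by blast
  qed (use assms(2) in auto)
  then show ?thesis by (simp add: norm_divide field_simps)
qed

text \<open>Cauchy's inequality at radius 2, for \<open>g\<close> in \<open>z\<close> and for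
  \<open>h\<close> in \<open>inverse z\<close>, yields geometric decay in both directions. This
  decay later makes the rows of a Toeplitz operator absolutely summable. The sum over all integers
  is a \<open>has_sum\<close>, so it can be rearranged freely.\<close>

lemma laurent_coefficients:
  assumes f: "f holomorphic_on - {0}"
    and B: "\<And>z. 1/2 \<le> norm z \<Longrightarrow> norm z \<le> 4 \<Longrightarrow> norm (f z) \<le> B"
  obtains a :: "int \<Rightarrow> complex" where
    "\<And>z. z \<noteq> 0 \<Longrightarrow> ((\<lambda>n. a n * z powi n) has_sum f z) UNIV"
    "\<And>n. norm (a n) \<le> 3 * B * (1/2) ^ nat \<bar>n\<bar>"
proof -
  obtain g h where gh: "g holomorphic_on UNIV" "h holomorphic_on UNIV"
    "\<And>z. z \<noteq> 0 \<Longrightarrow> f z = g z + h (inverse z)"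
    "\<And>z. norm z \<le> 2 \<Longrightarrow> norm (g z) \<le> 2 * B" "\<And>u. norm u = 2 \<Longrightarrow> norm (h u) \<le> 3 * B"
    "h 0 = 0"
    using laurent_decomposition[OF f B] by metis
  define c where "c = (\<lambda>n. (deriv ^^ n) g 0 / fact n)"
  define d where "d = (\<lambda>n. (deriv ^^ n) h 0 / fact n)"
  \<comment> \<open>The index 0 belongs to \<open>c\<close>; since \<open>d 0 = 0\<close>, the two
    halves fit together without counting a constant twice.\<close>
  define a where "a = (\<lambda>n::int. if 0 \<le> n then c (nat n) else d (nat (- n)))"
  have "B \<ge> 0" using order_trans[OF norm_ge_zero B[of 1]] by simp
  have d0: "d 0 = 0" using gh(6) by (simp add: d_def)
  have 1: "((\<lambda>n. c n * z ^ n) has_sum g z) UNIV" for z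
    using entire_coeff_summable[OF gh(1), of z] unfolding c_def by (intro norm_summable_imp_has_sum)
  have 2: "((\<lambda>n. d n * z ^ n) has_sum h z) UNIV" for z
    using entire_coeff_summable[OF gh(2), of z] unfolding d_def by (intro norm_summable_imp_has_sum)
  have "((\<lambda>n. a n * z powi n) has_sum f z) UNIV" if "z \<noteq> 0" for z
  proof -
    have p: "((\<lambda>n. a n * z powi n) has_sum g z) {0..}"
      using 1[of z] by (subst has_sum_reindex_bij_witness[of "{0..}" int nat UNIV, where h = "\<lambda>n. c n * z ^ n"])
        (auto simp: a_def power_int_def)
    have "((\<lambda>n. d n * inverse z ^ n) has_sum h (inverse z)) (UNIV - {0})"
      using 2[of "inverse z"] d0 by (subst has_sum_cong_neutral[where T = UNIV and g = "\<lambda>n. d n * inverse z ^ n"]) auto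
    then have q: "((\<lambda>n. a n * z powi n) has_sum h (inverse z)) {..<0}"
      by (subst has_sum_reindex_bij_witness[of "{..<0}" "\<lambda>n. - int n" "\<lambda>n. nat (- n)" "UNIV - {0}", where h = "\<lambda>n. d n * inverse z ^ n"])
        (auto simp: a_def power_int_def)
    have "((\<lambda>n. a n * z powi n) has_sum (g z + h (inverse z))) ({0..} \<union> {..<0})"
      by (rule has_sum_Un_disjoint[OF p q]) auto
    moreover have "{0..} \<union> {..<0::int} = UNIV" by auto
    ultimately show ?thesis using gh(3)[OF that] by simp
  qed
  moreover have "norm (a n) \<le> 3 * B * (1/2) ^ nat \<bar>n\<bar>" for n
  proof (cases "0 \<le> n")
    case True
    have "norm (c (nat n)) \<le> (2 * B) / 2 ^ nat n"
      unfolding c_def by (rule entire_coeff_bound[OF gh(1)]) (use gh(4) in auto)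
    also have "\<dots> \<le> (3 * B) / 2 ^ nat n" using \<open>B \<ge> 0\<close> by (intro divide_right_mono) auto
    finally show ?thesis using True by (simp add: a_def power_divide)
  next
    case False
    have "norm (d (nat (-n))) \<le> (3 * B) / 2 ^ nat (-n)"
      unfolding d_def by (rule entire_coeff_bound[OF gh(2) gh(5)])
    then show ?thesis using False by (simp add: a_def power_divide)
  qed
  ultimately show ?thesis by (rule that)
qed

text \<open>Only the principal part is cut off; the regular part is kept whole, so \<open>p\<close>
  is entire rather than a polynomial. A larger \<open>N\<close> merely multiplies \<open>p\<close>
  by a power of \<open>z\<close>, and this freedom allows one exponent for all entries of a
  matrix.\<close>

lemma laurent_truncation:
  assumes f: "f holomorphic_on - {0}" and "\<epsilon> > 0"
  shows "\<exists>N0. \<forall>N\<ge>N0. \<exists>p. p holomorphic_on UNIV \<and>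
    (\<forall>z. 1/2 \<le> norm z \<longrightarrow> norm z \<le> 4 \<longrightarrow> norm (f z - p z / z ^ N) \<le> \<epsilon>)"
proof -
  have "continuous_on {z. 1/2 \<le> norm z \<and> norm z \<le> 4} f"
    by (rule holomorphic_on_imp_continuous_on[THEN continuous_on_subset, OF f]) auto
  moreover have "compact {z::complex. 1/2 \<le> norm z \<and> norm z \<le> 4}"
  proof -
    have "{z::complex. 1/2 \<le> norm z \<and> norm z \<le> 4} = cball 0 4 - ball 0 (1/2)" by auto
    then show ?thesis by (simp add: compact_diff)
  qed
  ultimately have "bounded (f ` {z. 1/2 \<le> norm z \<and> norm z \<le> 4})"
    by (intro compact_imp_bounded compact_continuous_image)
  then obtain B where B: "\<And>z. 1/2 \<le> norm z \<Longrightarrow> norm z \<le> 4 \<Longrightarrow> norm (f z) \<le> B"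
    unfolding bounded_iff by auto
  obtain g h where gh: "g holomorphic_on UNIV" "h holomorphic_on UNIV"
    "\<And>z. z \<noteq> 0 \<Longrightarrow> f z = g z + h (inverse z)"
    using laurent_decomposition[OF f B] by metis
  define d where "d = (\<lambda>n. (deriv ^^ n) h 0 / fact n)"
  have "summable (\<lambda>n. norm (d n * 2 ^ n))"
    using entire_coeff_summable(1)[OF gh(2), of 2] by (simp add: d_def)
  then have "uniform_limit (cball 0 2) (\<lambda>n x. \<Sum>i<n. d i * x ^ i) (\<lambda>x. suminf (\<lambda>i. d i * x ^ i)) sequentially"
    by (intro Weierstrass_m_test) (auto simp: norm_mult norm_power intro!: mult_left_mono power_mono)
  moreover have "(\<lambda>x. suminf (\<lambda>i. d i * x ^ i)) = h"
    using entire_coeff_summable(2)[OF gh(2)] by (auto simp: d_def sums_iff)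
  ultimately have "\<forall>\<^sub>F n in sequentially. \<forall>x\<in>cball 0 2. dist (\<Sum>i<n. d i * x ^ i) (h x) < \<epsilon>"
    using \<open>\<epsilon> > 0\<close> by (auto simp: uniform_limit_iff)
  then obtain N0 where N0: "\<And>x. norm x \<le> 2 \<Longrightarrow> dist (\<Sum>i<N0. d i * x ^ i) (h x) < \<epsilon>"
    unfolding eventually_sequentially by force
  show ?thesis
  proof (intro exI[of _ N0] allI impI)
    fix N assume N: "N \<ge> N0"
    define p where "p = (\<lambda>z. z ^ N * g z + (\<Sum>i<N0. d i * z ^ (N - i)))"
    have "norm (f z - p z / z ^ N) \<le> \<epsilon>" if z: "1/2 \<le> norm z" for z
    proof -
      have z0: "z \<noteq> 0" using z by auto
      have "(\<Sum>i<N0. d i * z ^ (N - i)) / z ^ N = (\<Sum>i<N0. d i * inverse z ^ i)"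
        unfolding sum_divide_distrib using N z0
        by (intro sum.cong) (auto simp: power_diff field_simps)
      then have "f z - p z / z ^ N = h (inverse z) - (\<Sum>i<N0. d i * inverse z ^ i)"
        using gh(3)[OF z0] z0 by (simp add: p_def add_divide_distrib)
      moreover have "norm (inverse z) \<le> 2" using z z0 by (simp add: norm_inverse norm_divide field_simps)
      ultimately show ?thesis using N0[of "inverse z"] by (simp add: dist_norm norm_minus_commute)
    qed
    moreover have "p holomorphic_on UNIV"
      unfolding p_def by (intro holomorphic_intros gh)
    ultimately show "\<exists>p. p holomorphic_on UNIV \<and>
      (\<forall>z. 1/2 \<le> norm z \<longrightarrow> norm z \<le> 4 \<longrightarrow> norm (f z - p z / z ^ N) \<le> \<epsilon>)" by blast
  qed
qed

text \<open>The double series converges absolutely, so it may be summed along the diagonals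
  \<open>n = j + int m\<close>. The inner sum runs over natural numbers \<open>m\<close>: it is a
  row of the Toeplitz operator with symbol \<open>a\<close>, applied to the sequence
  \<open>b\<close>.\<close>

lemma laurent_times_power_series:
  fixes a :: "int \<Rightarrow> complex"
  assumes f: "((\<lambda>n. a n * z powi n) has_sum f) UNIV"
    and g: "((\<lambda>m. b m * z ^ m) has_sum g) UNIV" and z: "z \<noteq> 0"
  shows "((\<lambda>n. (\<Sum>\<^sub>\<infinity>m. a (n - int m) * b m) * z powi n) has_sum f * g) UNIV"
proof -
  define F where "F = (\<lambda>j m. (a j * z powi j) * (b m * z ^ m))"
  have row: "((\<lambda>m. F j m) has_sum (a j * z powi j) * g) UNIV" for j
    unfolding F_def by (intro has_sum_cmult_right g)
  have col: "((\<lambda>j. (a j * z powi j) * g) has_sum f * g) UNIV"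
    by (intro has_sum_cmult_left f)
  have "(\<lambda>x. norm (case_prod F x)) summable_on UNIV \<times> UNIV"
  proof (subst Infinite_Sum.abs_summable_on_Sigma_iff, intro conjI ballI)
    show "(\<lambda>y. norm (case_prod F (x, y))) summable_on UNIV" for x
    proof -
      have "F x summable_on UNIV" using row[of x] summable_on_def by blast
      then show ?thesis by (simp add: summable_on_iff_abs_summable_on_complex)
    qed
    have "(\<lambda>x. norm (a x * z powi x) * (\<Sum>\<^sub>\<infinity>m. norm (b m * z ^ m))) summable_on UNIV"
      using f by (intro summable_on_cmult_left)
        (auto simp: summable_on_iff_abs_summable_on_complex[symmetric] summable_on_def)
    moreover have "norm (a x * z powi x) * (\<Sum>\<^sub>\<infinity>m. norm (b m * z ^ m)) \<ge> 0" for x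
      by (intro mult_nonneg_nonneg infsum_nonneg) auto
    ultimately show "(\<lambda>x. norm (\<Sum>\<^sub>\<infinity>y. norm (case_prod F (x, y)))) summable_on UNIV"
      by (simp add: F_def norm_mult infsum_cmult_right')
  qed
  then have sF: "case_prod F summable_on UNIV \<times> UNIV" by (rule abs_summable_summable)
  have "(case_prod F has_sum f * g) (UNIV \<times> UNIV)"
    by (rule has_sum_SigmaI[OF _ col sF]) (use row in auto)
  then have hs: "((\<lambda>(n, m). F (n - int m) m) has_sum f * g) (UNIV \<times> UNIV)"
    by (subst has_sum_reindex_bij_witness[of _ "\<lambda>(j, m). (j + int m, m)" "\<lambda>(n, m). (n - int m, m)" "UNIV \<times> UNIV" "case_prod F"]) auto
  have eq: "F (n - int m) m = a (n - int m) * b m * z powi n" for n m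
    using z by (simp add: F_def power_int_diff)
  show ?thesis
  proof (rule has_sum_SigmaD[OF hs])
    fix n :: int
    have "(\<lambda>m. F (n - int m) m) summable_on UNIV"
      using summable_on_SigmaD1[of "\<lambda>n m. F (n - int m) m" UNIV "\<lambda>_. UNIV" n] hs
      by (auto simp: summable_on_def)
    then have "((\<lambda>m. F (n - int m) m) has_sum (\<Sum>\<^sub>\<infinity>m. F (n - int m) m)) UNIV"
      by (rule has_sum_infsum)
    then show "((\<lambda>m. case (n, m) of (n, m) \<Rightarrow> F (n - int m) m) has_sum
        (\<Sum>\<^sub>\<infinity>m. a (n - int m) * b m) * z powi n) UNIV"
      by (simp add: eq infsum_cmult_left')
  qed
qed

section \<open>Toeplitz equations near the identity\<close>

text \<open>The sum over all integers is \<open>2 + 1\<close>, and the indices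
  \<open>n - int m\<close> run injectively through a subset of them.\<close>

lemma two_sided_geometric:
  shows "(\<lambda>m::nat. (1/2::real) ^ nat \<bar>n - int m\<bar>) summable_on UNIV"
    and "(\<Sum>\<^sub>\<infinity>m. (1/2::real) ^ nat \<bar>n - int m\<bar>) \<le> 3"
proof -
  let ?w = "\<lambda>k::int. (1/2::real) ^ nat \<bar>k\<bar>"
  have g: "((\<lambda>m. (1/2::real) ^ m) has_sum 2) UNIV"
    using geometric_sums[of "1/2::real"] by (intro norm_summable_imp_has_sum) auto
  have p: "(?w has_sum 2) {0..}"
    using g by (subst has_sum_reindex_bij_witness[of "{0..}" int nat UNIV, where h = "\<lambda>m. (1/2) ^ m"]) auto
  have "((\<lambda>m. (1/2) * (1/2::real) ^ m) has_sum (1/2) * 2) UNIV"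
    by (intro has_sum_cmult_right g)
  then have q: "(?w has_sum 1) {..<0}"
    by (subst has_sum_reindex_bij_witness[of "{..<0}" "\<lambda>m. - int m - 1" "\<lambda>k. nat (- k - 1)" UNIV, where h = "\<lambda>m. (1/2) * (1/2) ^ m"])
      (auto simp flip: power_Suc simp: Suc_nat_eq_nat_zadd1)
  have "(?w has_sum 2 + 1) ({0..} \<union> {..<0})" by (rule has_sum_Un_disjoint[OF p q]) auto
  moreover have "{0..} \<union> {..<0::int} = UNIV" by auto
  ultimately have t: "(?w has_sum 3) UNIV" by simp
  have inj: "inj (\<lambda>m. n - int m)" by (auto simp: inj_on_def)
  have sub: "?w summable_on range (\<lambda>m. n - int m)"
    using t summable_on_subset_banach[of ?w UNIV] summable_on_def by blast
  then show "(\<lambda>m::nat. (1/2::real) ^ nat \<bar>n - int m\<bar>) summable_on UNIV"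
    by (simp add: summable_on_reindex[OF inj] comp_def)
  have "(\<Sum>\<^sub>\<infinity>m. ?w (n - int m)) = infsum ?w (range (\<lambda>m. n - int m))"
    by (simp add: infsum_reindex[OF inj] comp_def)
  also have "\<dots> \<le> infsum ?w UNIV"
    using t sub by (intro infsum_mono2) (auto simp: summable_on_def)
  also have "\<dots> = 3" using t by (rule infsumI)
  finally show "(\<Sum>\<^sub>\<infinity>m. (1/2::real) ^ nat \<bar>n - int m\<bar>) \<le> 3" .
qed

lemma norm_vec_le_sum: "norm (x :: complex^'k) \<le> (\<Sum>i\<in>UNIV. norm (x $ i))"
  unfolding norm_vec_def by (rule L2_set_le_sum) simp

text \<open>In the supremum norm a Toeplitz operator is bounded by the sum of the norms of its
  coefficients, here at most \<open>3 * \<eta>\<close>.\<close>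

lemma geometric_convolution_bound:
  fixes a :: "int \<Rightarrow> complex" and b :: "nat \<Rightarrow> complex"
  assumes "\<And>n. norm (a n) \<le> \<eta> * (1/2) ^ nat \<bar>n\<bar>" "\<And>m. norm (b m) \<le> M"
  shows "(\<lambda>m. a (n - int m) * b m) summable_on UNIV"
    and "norm (\<Sum>\<^sub>\<infinity>m. a (n - int m) * b m) \<le> 3 * \<eta> * M"
proof -
  have M: "M \<ge> 0" using order_trans[OF norm_ge_zero assms(2)] .
  have \<eta>: "\<eta> \<ge> 0" using order_trans[OF norm_ge_zero assms(1)[of 0]] by simp
  have le: "norm (a (n - int m) * b m) \<le> (\<eta> * M) * (1/2) ^ nat \<bar>n - int m\<bar>" for m
  proof -
    have "norm (a (n - int m)) * norm (b m) \<le> (\<eta> * (1/2) ^ nat \<bar>n - int m\<bar>) * M"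
      by (intro mult_mono assms) (use \<eta> in auto)
    then show ?thesis by (simp add: norm_mult mult_ac)
  qed
  have s: "(\<lambda>m. (\<eta> * M) * (1/2) ^ nat \<bar>n - int m\<bar>) summable_on UNIV"
    by (intro summable_on_cmult_right two_sided_geometric)
  have abs: "(\<lambda>m. norm (a (n - int m) * b m)) summable_on UNIV"
    by (rule Infinite_Sum.abs_summable_on_comparison_test'[OF s le])
  then show "(\<lambda>m. a (n - int m) * b m) summable_on UNIV" by (rule Infinite_Sum.abs_summable_summable)
  have "norm (\<Sum>\<^sub>\<infinity>m. a (n - int m) * b m) \<le> (\<Sum>\<^sub>\<infinity>m. norm (a (n - int m) * b m))"
    by (rule norm_infsum_bound[OF abs])
  also have "\<dots> \<le> (\<Sum>\<^sub>\<infinity>m. (\<eta> * M) * (1/2) ^ nat \<bar>n - int m\<bar>)"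
    by (intro infsum_mono abs s le)
  also have "\<dots> = (\<eta> * M) * (\<Sum>\<^sub>\<infinity>m. (1/2) ^ nat \<bar>n - int m\<bar>)"
    by (rule infsum_cmult_right')
  also have "\<dots> \<le> (\<eta> * M) * 3"
    using two_sided_geometric(2)[of n] M \<eta> by (intro mult_left_mono) auto
  finally show "norm (\<Sum>\<^sub>\<infinity>m. a (n - int m) * b m) \<le> 3 * \<eta> * M" by (simp add: mult_ac)
qed

text \<open>If \<open>\<xi>\<close> and \<open>a\<close> are read as the coefficients of a power
  series \<open>x\<close> and of a Laurent matrix \<open>E\<close>, the equations say that
  \<open>x + E x\<close> has no terms of positive index; index 0 is exempt and carries the free
  value \<open>c\<close>. The right-hand side halves the supremum norm: every matrix entry
  contributes \<open>3 * \<eta>\<close>, and the square of \<open>CARD('k)\<close> counts the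
  entries, since a vector norm is estimated by the sum over its components. The iteration from 0
  therefore contracts and stays within norm 2.\<close>

lemma toeplitz_fixed_point:
  fixes a :: "'k::finite \<Rightarrow> 'k \<Rightarrow> int \<Rightarrow> complex" and c :: "complex^'k"
  assumes a: "\<And>i j n. norm (a i j n) \<le> \<eta> * (1/2) ^ nat \<bar>n\<bar>"
    and small: "real CARD('k) ^ 2 * (3 * \<eta>) \<le> 1/2" and c: "norm c \<le> 1"
  obtains \<xi> :: "nat \<Rightarrow> complex^'k" where "\<xi> 0 = c" "\<And>m. norm (\<xi> m) \<le> 2"
    "\<And>n i. n > 0 \<Longrightarrow> \<xi> n $ i = - (\<Sum>j\<in>UNIV. \<Sum>\<^sub>\<infinity>m. a i j (int n - int m) * \<xi> m $ j)"
proof -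
  define L where "L = (\<lambda>(\<xi> :: nat \<Rightarrow> complex^'k) n. \<chi> i. (\<Sum>j\<in>UNIV. \<Sum>\<^sub>\<infinity>m. a i j (int n - int m) * \<xi> m $ j))"
  have Lb: "norm (L \<xi> n) \<le> M / 2" if "\<And>m. norm (\<xi> m) \<le> M" for \<xi> n M
  proof -
    have M: "M \<ge> 0" using order_trans[OF norm_ge_zero that] .
    have "norm (\<Sum>\<^sub>\<infinity>m. a i j (int n - int m) * \<xi> m $ j) \<le> 3 * \<eta> * M" for i j
      by (rule geometric_convolution_bound(2)[OF a]) (use that order_trans[OF component_le_norm_cart] Finite_Cartesian_Product.norm_nth_le order_trans in blast)
    then have "norm (L \<xi> n $ i) \<le> (\<Sum>j\<in>(UNIV::'k set). 3 * \<eta> * M)" for i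
      unfolding L_def vec_lambda_beta by (rule sum_norm_le)
    then have "norm (L \<xi> n) \<le> (\<Sum>i\<in>(UNIV::'k set). \<Sum>j\<in>(UNIV::'k set). 3 * \<eta> * M)"
      by (intro order_trans[OF norm_vec_le_sum] sum_mono)
    also have "\<dots> = real CARD('k) ^ 2 * (3 * \<eta>) * M" by (simp add: power2_eq_square)
    also have "\<dots> \<le> 1/2 * M" by (intro mult_right_mono small M)
    finally show ?thesis by simp
  qed
  have Ld: "L \<xi> n - L \<zeta> n = L (\<lambda>m. \<xi> m - \<zeta> m) n"
    if "\<And>m. norm (\<xi> m) \<le> M" "\<And>m. norm (\<zeta> m) \<le> M" for \<xi> \<zeta> n M
  proof -
    have "(\<Sum>\<^sub>\<infinity>m. a i j (int n - int m) * (\<xi> m - \<zeta> m) $ j) =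
       (\<Sum>\<^sub>\<infinity>m. a i j (int n - int m) * \<xi> m $ j) - (\<Sum>\<^sub>\<infinity>m. a i j (int n - int m) * \<zeta> m $ j)" for i j
    proof -
      have s1: "(\<lambda>m. a i j (int n - int m) * \<xi> m $ j) summable_on UNIV"
        and s2: "(\<lambda>m. a i j (int n - int m) * \<zeta> m $ j) summable_on UNIV"
        by (rule geometric_convolution_bound(1)[OF a, where M = M];
            use that Finite_Cartesian_Product.norm_nth_le order_trans in blast)+
      show ?thesis
        by (rule infsumI) (use has_sum_add[OF has_sum_infsum[OF s1] has_sum_uminusI[OF has_sum_infsum[OF s2]]]
          in \<open>simp add: algebra_simps\<close>)
    qed
    then show ?thesis unfolding L_def vec_eq_iff by (simp add: sum_subtractf)
  qed
  define T where "T = (\<lambda>\<xi> n. if n = 0 then c else - L \<xi> n)"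
  have Td: "norm (T \<xi> n - T \<zeta> n) \<le> D / 2"
    if "\<And>m. norm (\<xi> m) \<le> 2" "\<And>m. norm (\<zeta> m) \<le> 2" "\<And>m. norm (\<xi> m - \<zeta> m) \<le> D" for \<xi> \<zeta> n D
  proof (cases "n = 0")
    case True
    then show ?thesis using order_trans[OF norm_ge_zero that(3)] by (simp add: T_def)
  next
    case False
    then have "T \<xi> n - T \<zeta> n = - (L \<xi> n - L \<zeta> n)" by (simp add: T_def)
    then show ?thesis using Lb[of "\<lambda>m. \<xi> m - \<zeta> m" D n, OF that(3)] Ld[of \<xi> 2 \<zeta> n, OF that(1,2)]
      by (simp add: norm_minus_commute)
  qed
  have Tb: "norm (T \<xi> n) \<le> 2" if "\<And>m. norm (\<xi> m) \<le> 2" for \<xi> n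
    using Lb[of \<xi> 2 n, OF that] c by (cases "n = 0") (auto simp: T_def)
  define s where "s = (\<lambda>k. (T ^^ k) (\<lambda>_. 0))"
  have s0: "s 0 = (\<lambda>_. 0)" and sS: "s (Suc k) = T (s k)" for k by (simp_all add: s_def)
  have sb: "norm (s k n) \<le> 2" for k n
    by (induction k arbitrary: n) (auto simp: s0 sS intro: Tb)
  have sd: "norm (s (Suc k) n - s k n) \<le> 2 * (1/2) ^ k" for k n
  proof (induction k arbitrary: n)
    case 0 then show ?case using sb[of 1 n] by (simp add: s0)
  next
    case (Suc k)
    show ?case using Td[of "s (Suc k)" "s k" "2 * (1/2) ^ k" n, OF sb sb Suc.IH] by (simp add: sS)
  qed
  have sdl: "norm (s (k + l) n - s k n) \<le> 4 * (1/2) ^ k - 4 * (1/2) ^ (k + l)" for k l n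
  proof (induction l)
    case (Suc l)
    have "s (k + Suc l) n - s k n = (s (Suc (k + l)) n - s (k + l) n) + (s (k + l) n - s k n)" by simp
    then have "norm (s (k + Suc l) n - s k n) \<le> norm (s (Suc (k + l)) n - s (k + l) n) + norm (s (k + l) n - s k n)"
      by (metis norm_triangle_ineq)
    then show ?case using Suc.IH sd[of "k + l" n] by (simp add: power_add)
  qed simp
  have sdl': "norm (s (k + l) n - s k n) \<le> 4 * (1/2) ^ k" for k l n
    using sdl[of k l n] zero_le_power[of "1/2::real" "k + l"] by linarith
  have p0: "(\<lambda>k. 4 * (1/2::real) ^ k) \<longlonglongrightarrow> 0"
    by (intro tendsto_mult_right_zero LIMSEQ_power_zero) auto
  have "Cauchy (\<lambda>k. s k n)" for n
  proof (rule CauchyI')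
    fix e :: real assume "e > 0"
    then obtain M where M: "4 * (1/2::real) ^ M < e"
      using order_tendstoD(2)[OF p0] unfolding eventually_sequentially by blast
    have "dist (s m n) (s l n) < e" if "m \<ge> M" "l > m" for m l
    proof -
      have "norm (s (m + (l - m)) n - s m n) \<le> 4 * (1/2) ^ m" by (rule sdl')
      also have "\<dots> \<le> 4 * (1/2::real) ^ M" using that by (intro mult_left_mono power_decreasing) auto
      also have "\<dots> < e" by (rule M)
      finally show ?thesis using that by (simp add: dist_norm norm_minus_commute)
    qed
    then show "\<exists>M. \<forall>m\<ge>M. \<forall>l>m. dist (s m n) (s l n) < e" by blast
  qed
  then have "\<exists>l. (\<lambda>k. s k n) \<longlonglongrightarrow> l" for n
    using Cauchy_convergent convergent_def by blast
  then obtain \<xi> where \<xi>: "\<And>n. (\<lambda>k. s k n) \<longlonglongrightarrow> \<xi> n" by metis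
  have \<xi>b: "norm (\<xi> n) \<le> 2" for n
    by (rule Lim_norm_ubound[OF _ \<xi>]) (auto simp: sb)
  \<comment> \<open>\<open>T\<close> couples all indices, so convergence at each single index would
    not allow passing to the limit in \<open>T\<close>. The rate has to be uniform in
    \<open>n\<close>.\<close>
  have \<xi>d: "norm (s k n - \<xi> n) \<le> 4 * (1/2) ^ k" for k n
  proof (rule Lim_norm_ubound[OF sequentially_bot])
    show "(\<lambda>l. s k n - s (l + k) n) \<longlonglongrightarrow> s k n - \<xi> n"
      by (intro tendsto_intros LIMSEQ_ignore_initial_segment \<xi>)
    show "\<forall>\<^sub>F l in sequentially. norm (s k n - s (l + k) n) \<le> 4 * (1/2) ^ k"
      using sdl'[of k _ n] by (simp add: norm_minus_commute add.commute)
  qed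
  have "\<xi> n = T \<xi> n" for n
  proof (rule LIMSEQ_unique)
    show "(\<lambda>k. s (Suc k) n) \<longlonglongrightarrow> \<xi> n" by (rule LIMSEQ_Suc[OF \<xi>])
    have "(\<lambda>k. s (Suc k) n - T \<xi> n) \<longlonglongrightarrow> 0"
    proof (rule Lim_null_comparison[OF _ p0])
      show "\<forall>\<^sub>F k in sequentially. norm (s (Suc k) n - T \<xi> n) \<le> 4 * (1/2) ^ k"
      proof (intro always_eventually allI)
        fix k
        have "norm (s (Suc k) n - T \<xi> n) \<le> (4 * (1/2) ^ k) / 2"
          unfolding sS by (rule Td[OF sb \<xi>b \<xi>d])
        then show "norm (s (Suc k) n - T \<xi> n) \<le> 4 * (1/2) ^ k"
          by (rule order_trans) simp
      qed
    qed
    then show "(\<lambda>k. s (Suc k) n) \<longlonglongrightarrow> T \<xi> n" by (simp add: LIM_zero_iff)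
  qed
  then have e: "\<xi> n = (if n = 0 then c else - L \<xi> n)" for n unfolding T_def by metis
  show ?thesis
  proof (rule that[of \<xi>])
    show "\<xi> 0 = c" using e[of 0] by simp
    show "\<xi> n $ i = - (\<Sum>j\<in>UNIV. \<Sum>\<^sub>\<infinity>m. a i j (int n - int m) * \<xi> m $ j)" if "n > 0" for n i
      using e[of n] that unfolding L_def by (metis (no_types, lifting) not_gr_zero vec_lambda_beta vector_uminus_component)
  qed (rule \<xi>b)
qed

lemma has_sum_finite_sum:
  fixes f :: "'j \<Rightarrow> 'a \<Rightarrow> complex" and S :: "'j \<Rightarrow> complex"
  assumes "finite J" "\<And>j. j \<in> J \<Longrightarrow> (f j has_sum S j) A"
  shows "((\<lambda>x. \<Sum>j\<in>J. f j x) has_sum (\<Sum>j\<in>J. S j)) A"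
  using assms
proof (induction J rule: finite_induct)
  case (insert j J)
  then have "((\<lambda>x. f j x + (\<Sum>j\<in>J. f j x)) has_sum S j + (\<Sum>j\<in>J. S j)) A"
    by (intro has_sum_add) auto
  then show ?case using insert.hyps by simp
qed simp

lemma power_series_ball_holomorphic:
  fixes b :: "nat \<Rightarrow> complex"
  assumes "\<And>n. norm (b n) \<le> C * t ^ n" "t > 0"
  shows "norm z < 1 / t \<Longrightarrow> ((\<lambda>n. b n * z ^ n) has_sum (\<Sum>n. b n * z ^ n)) UNIV"
    and "(\<lambda>z. \<Sum>n. b n * z ^ n) holomorphic_on ball 0 (1 / t)"
    and "norm z < 1 / t \<Longrightarrow> norm (\<Sum>n. b n * z ^ n) \<le> C / (1 - t * norm z)"
proof -
  have le: "norm (b n * z ^ n) \<le> C * (t * norm z) ^ n" for z n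
    using assms(1)[of n] by (auto simp: norm_mult norm_power power_mult_distrib mult_ac
        dest: mult_right_mono[of _ _ "norm z ^ n"])
  have g: "summable (\<lambda>n. C * (t * norm z) ^ n)" if "norm z < 1 / t" for z :: complex
    using that assms(2) by (intro summable_mult summable_geometric) (auto simp: field_simps abs_mult)
  have s: "summable (\<lambda>n. norm (b n * z ^ n))" if "norm z < 1 / t" for z
    by (rule summable_comparison_test'[OF g[OF that], of 0]) (use le in auto)
  show hs: "((\<lambda>n. b n * z ^ n) has_sum (\<Sum>n. b n * z ^ n)) UNIV" if "norm z < 1 / t" for z
    by (rule norm_summable_imp_has_sum[OF s[OF that] summable_sums[OF summable_norm_cancel[OF s[OF that]]]])
  show "(\<lambda>z. \<Sum>n. b n * z ^ n) holomorphic_on ball 0 (1 / t)"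
  proof (rule power_series_holomorphic)
    show "(\<lambda>n. b n * (w - 0) ^ n) sums (\<Sum>n. b n * w ^ n)" if "w \<in> ball 0 (1 / t)" for w
      using summable_sums[OF summable_norm_cancel[OF s[of w]]] that by simp
  qed
  show "norm (\<Sum>n. b n * z ^ n) \<le> C / (1 - t * norm z)" if "norm z < 1 / t"
  proof -
    have "norm (\<Sum>n. b n * z ^ n) \<le> (\<Sum>n. norm (b n * z ^ n))" by (rule summable_norm[OF s[OF that]])
    also have "\<dots> \<le> (\<Sum>n. C * (t * norm z) ^ n)" by (intro suminf_le le s g that)
    also have "\<dots> = C * (\<Sum>n. (t * norm z) ^ n)"
      using that assms(2) by (intro suminf_mult summable_geometric) (auto simp: field_simps abs_mult)
    also have "(\<Sum>n. (t * norm z) ^ n) = 1 / (1 - t * norm z)"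
      using that assms(2) by (intro suminf_geometric) (auto simp: field_simps abs_mult)
    finally show ?thesis by simp
  qed
qed

text \<open>Let \<open>q\<close> be the Laurent coefficients of \<open>E x\<close>. By the Toeplitz
  equations those of positive index cancel the terms of \<open>x\<close> beyond \<open>c\<close>;
  the remaining ones, constant term included, form \<open>v (inverse z)\<close>. Boundedness of
  \<open>\<xi>\<close> gives convergence of \<open>x\<close> in the unit disc, and the decay of
  \<open>q\<close> gives that of \<open>v\<close> in radius 2, so the equation makes sense for
  \<open>1/2 < norm z < 1\<close>. The factor 9 is 3 from \<open>laurent_coefficients\<close> times
  3 from the row sums.\<close>

lemma near_identity_column:
  fixes E :: "complex \<Rightarrow> complex^'k^'k" and c :: "complex^'k"
  assumes E: "\<And>i j. (\<lambda>z. E z $ i $ j) holomorphic_on - {0}"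
    and B: "\<And>i j z. 1/2 \<le> norm z \<Longrightarrow> norm z \<le> 4 \<Longrightarrow> norm (E z $ i $ j) \<le> B"
    and small: "real CARD('k) ^ 2 * (9 * B) \<le> 1/2" and c: "norm c \<le> 1"
  obtains x v :: "complex \<Rightarrow> complex^'k" where
    "\<And>i. (\<lambda>z. x z $ i) holomorphic_on ball 0 1"
    "\<And>i. (\<lambda>u. v u $ i) holomorphic_on ball 0 2"
    "\<And>z. 1/2 < norm z \<Longrightarrow> norm z < 1 \<Longrightarrow> x z + E z *v x z = c + v (inverse z)"
    "\<And>u i. norm u \<le> 4/3 \<Longrightarrow> norm (v u $ i) \<le> 36 * real CARD('k) * B"
proof -
  have "B \<ge> 0" using order_trans[OF norm_ge_zero B[of 1]] by simp
  have "\<exists>a. (\<forall>z. z \<noteq> 0 \<longrightarrow> ((\<lambda>n. a n * z powi n) has_sum E z $ i $ j) UNIV) \<and>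
      (\<forall>n. norm (a n) \<le> 3 * B * (1/2) ^ nat \<bar>n\<bar>)" for i j
    using laurent_coefficients[OF E B] by metis
  then obtain a where a: "\<And>i j z. z \<noteq> 0 \<Longrightarrow> ((\<lambda>n. a i j n * z powi n) has_sum E z $ i $ j) UNIV"
      "\<And>i j n. norm (a i j n) \<le> 3 * B * (1/2) ^ nat \<bar>n\<bar>"
    by metis
  obtain \<xi> :: "nat \<Rightarrow> complex^'k" where \<xi>: "\<xi> 0 = c" "\<And>m. norm (\<xi> m) \<le> 2"
    "\<And>n i. n > 0 \<Longrightarrow> \<xi> n $ i = - (\<Sum>j\<in>UNIV. \<Sum>\<^sub>\<infinity>m. a i j (int n - int m) * \<xi> m $ j)"
  proof (rule toeplitz_fixed_point[of a "3 * B" c, OF a(2) _ c])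
    show "real CARD('k) ^ 2 * (3 * (3 * B)) \<le> 1/2" using small by simp
  qed blast
  define q where "q = (\<lambda>i (n::int). \<Sum>j\<in>UNIV. \<Sum>\<^sub>\<infinity>m. a i j (n - int m) * \<xi> m $ j)"
  have \<xi>b: "norm (\<xi> m $ i) \<le> 2 * 1 ^ m" for m i
    using \<xi>(2)[of m] Finite_Cartesian_Product.norm_nth_le[of "\<xi> m" i] by simp
  \<comment> \<open>12 is the product of 3 (coefficients of \<open>E\<close>), 2 (bound on
    \<open>\<xi>\<close>) and 2 (geometric series in \<open>m\<close>).\<close>
  have qb: "norm (q i (- int n)) \<le> (12 * real CARD('k) * B) * (1/2) ^ n" for i n
  proof -
    have "norm (\<Sum>\<^sub>\<infinity>m. a i j (- int n - int m) * \<xi> m $ j) \<le> 12 * B * (1/2) ^ n" for j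
    proof -
      have g: "((\<lambda>m. (1/2::real) ^ m) has_sum 2) UNIV"
        using geometric_sums[of "1/2::real"] by (intro norm_summable_imp_has_sum) auto
      have h: "((\<lambda>m. (6 * B * (1/2) ^ n) * (1/2::real) ^ m) has_sum (6 * B * (1/2) ^ n) * 2) UNIV"
        by (intro has_sum_cmult_right g)
      have le: "norm (a i j (- int n - int m) * \<xi> m $ j) \<le> (6 * B * (1/2) ^ n) * (1/2) ^ m" for m
      proof -
        have n: "nat \<bar>- int n - int m\<bar> = n + m" by simp
        have "norm (a i j (- int n - int m)) * norm (\<xi> m $ j) \<le> (3 * B * (1/2) ^ (n + m)) * 2"
          using a(2)[of i j "- int n - int m"] \<xi>b[of m j] \<open>B \<ge> 0\<close> unfolding n
          by (intro mult_mono) auto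
        then show ?thesis by (simp add: norm_mult power_add mult_ac)
      qed
      have s: "(\<lambda>m. norm (a i j (- int n - int m) * \<xi> m $ j)) summable_on UNIV"
        by (rule Infinite_Sum.abs_summable_on_comparison_test'[OF _ le]) (use h summable_on_def in blast)
      have "norm (\<Sum>\<^sub>\<infinity>m. a i j (- int n - int m) * \<xi> m $ j)
          \<le> (\<Sum>\<^sub>\<infinity>m. norm (a i j (- int n - int m) * \<xi> m $ j))"
        by (rule norm_infsum_bound[OF s])
      also have "\<dots> \<le> (6 * B * (1/2) ^ n) * 2"
        by (rule has_sum_mono[OF has_sum_infsum[OF s] h le])
      finally show ?thesis by simp
    qed
    then have "norm (q i (- int n)) \<le> (\<Sum>j\<in>(UNIV::'k set). 12 * B * (1/2) ^ n)"
      unfolding q_def by (rule sum_norm_le)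
    then show ?thesis by (simp add: mult_ac)
  qed
  define x where "x = (\<lambda>z. \<chi> i. \<Sum>n. \<xi> n $ i * z ^ n)"
  define v where "v = (\<lambda>u. \<chi> i. \<Sum>n. q i (- int n) * u ^ n)"
  have x: "((\<lambda>n. \<xi> n $ i * z ^ n) has_sum x z $ i) UNIV" if "norm z < 1" for i z
    using power_series_ball_holomorphic(1)[where b = "\<lambda>m. \<xi> m $ i" and z = z, OF \<xi>b] that by (simp add: x_def)
  have v: "((\<lambda>n. q i (- int n) * u ^ n) has_sum v u $ i) UNIV" if "norm u < 2" for i u
    using power_series_ball_holomorphic(1)[where b = "\<lambda>n. q i (- int n)" and z = u, OF qb] that by (simp add: v_def)
  have eq: "x z + E z *v x z = c + v (inverse z)" if z: "1/2 < norm z" "norm z < 1" for z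
  proof (subst vec_eq_iff, rule allI)
    fix i
    have z0: "z \<noteq> 0" using z by auto
    have "((\<lambda>n. (\<Sum>\<^sub>\<infinity>m. a i j (n - int m) * \<xi> m $ j) * z powi n) has_sum E z $ i $ j * x z $ j) UNIV" for j
      by (rule laurent_times_power_series[OF a(1)[OF z0] x[OF z(2)] z0])
    then have "((\<lambda>n. \<Sum>j\<in>UNIV. (\<Sum>\<^sub>\<infinity>m. a i j (n - int m) * \<xi> m $ j) * z powi n) has_sum
        (\<Sum>j\<in>UNIV. E z $ i $ j * x z $ j)) UNIV"
      by (intro has_sum_finite_sum) auto
    then have Ex: "((\<lambda>n. q i n * z powi n) has_sum (E z *v x z) $ i) UNIV"
      by (simp add: q_def sum_distrib_right matrix_vector_mult_def)
    have "((\<lambda>n. \<xi> n $ i * z ^ n) has_sum x z $ i - c $ i) (UNIV - {0})"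
      using has_sum_Diff[OF x[OF z(2), of i] has_sum_finite[of "{0}"]] \<xi>(1) by simp
    then have X: "((\<lambda>n. - q i n * z powi n) has_sum x z $ i - c $ i) {0<..}"
      by (subst has_sum_reindex_bij_witness[of "{0<..}" int nat "UNIV - {0}", where h = "\<lambda>n. \<xi> n $ i * z ^ n"])
        (auto simp: power_int_def \<xi>(3) q_def)
    have "norm (inverse z) < 2" using z z0 by (simp add: norm_divide norm_inverse field_simps)
    from v[OF this, of i] have V: "((\<lambda>n. q i n * z powi n) has_sum v (inverse z) $ i) {..0}"
      by (subst has_sum_reindex_bij_witness[of "{..0}" "\<lambda>n. - int n" "\<lambda>n. nat (- n)" UNIV, where h = "\<lambda>n. q i (- int n) * inverse z ^ n"])
        (auto simp: power_int_def)
    have "((\<lambda>n. q i n * z powi n) has_sum (v (inverse z) $ i + - (x z $ i - c $ i))) ({..0} \<union> {0<..})"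
      using has_sum_uminusI[OF X] by (intro has_sum_Un_disjoint V) auto
    moreover have "{..0} \<union> {0<..} = (UNIV :: int set)" by auto
    ultimately have "(E z *v x z) $ i = v (inverse z) $ i + - (x z $ i - c $ i)"
      using Ex has_sum_unique by metis
    then show "(x z + E z *v x z) $ i = (c + v (inverse z)) $ i" by simp
  qed
  \<comment> \<open>At \<open>norm u = 4/3\<close> the geometric series has ratio 2/3 and triples
    the constant 12.\<close>
  have "norm (v u $ i) \<le> 36 * real CARD('k) * B" if "norm u \<le> 4/3" for u i
  proof -
    have "norm (v u $ i) \<le> (12 * real CARD('k) * B) / (1 - (1/2) * norm u)"
      using power_series_ball_holomorphic(3)[where b = "\<lambda>n. q i (- int n)" and z = u, OF qb] that by (simp add: v_def)
    also have "\<dots> \<le> (12 * real CARD('k) * B) / (1/3)"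
      using that \<open>B \<ge> 0\<close> by (intro divide_left_mono) (auto simp: zero_less_mult_iff)
    finally show ?thesis by simp
  qed
  moreover have "(\<lambda>z. x z $ i) holomorphic_on ball 0 1" "(\<lambda>u. v u $ i) holomorphic_on ball 0 2" for i
    using power_series_ball_holomorphic(2)[where b = "\<lambda>m. \<xi> m $ i", OF \<xi>b] power_series_ball_holomorphic(2)[where b = "\<lambda>n. q i (- int n)", OF qb]
    by (simp_all add: x_def v_def)
  ultimately show ?thesis using eq that by blast
qed

section \<open>Holomorphic matrices\<close>

definition holo_matrix_on :: "(complex \<Rightarrow> complex^'n^'m) \<Rightarrow> complex set \<Rightarrow> bool" where
  "holo_matrix_on A S \<longleftrightarrow> (\<forall>i j. (\<lambda>z. A z $ i $ j) holomorphic_on S)"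

lemma holo_matrix_eq: "holo_matrix A \<longleftrightarrow> holo_matrix_on A UNIV"
  by (simp add: holo_matrix_def holo_matrix_on_def)

lemma holo_matrix_on_subset: "holo_matrix_on A S \<Longrightarrow> T \<subseteq> S \<Longrightarrow> holo_matrix_on A T"
  unfolding holo_matrix_on_def using holomorphic_on_subset by blast

lemma holo_matrix_on_mult:
  "holo_matrix_on A S \<Longrightarrow> holo_matrix_on B S \<Longrightarrow> holo_matrix_on (\<lambda>z. A z ** B z) S"
  unfolding holo_matrix_on_def matrix_matrix_mult_def by (auto intro!: holomorphic_intros)

lemma holo_matrix_on_det:
  fixes A :: "complex \<Rightarrow> complex^'n^'n"
  shows "holo_matrix_on A S \<Longrightarrow> (\<lambda>z. det (A z)) holomorphic_on S"
  unfolding holo_matrix_on_def det_def by (auto intro!: holomorphic_intros)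

lemma matrix_inv_mult:
  assumes "invertible A"
  shows "A ** matrix_inv A = mat 1" "matrix_inv A ** A = mat 1"
  using someI_ex[OF assms[unfolded invertible_def]] unfolding matrix_inv_def by auto

text \<open>Cramer's rule for the columns of the inverse. It exhibits the entries as quotients of
  polynomials in the entries of \<open>A\<close>, from which \<open>holo_matrix_on_inv\<close> reads
  off holomorphy.\<close>

lemma matrix_inv_entry:
  fixes A :: "complex^'n^'n"
  assumes "invertible A"
  shows "matrix_inv A $ k $ l = det (\<chi> i j. if j = k then axis l 1 $ i else A $ i $ j) / det A"
proof -
  have "A *v (matrix_inv A *v axis l 1) = axis l 1"
    using assms by (simp add: matrix_vector_mul_assoc matrix_inv_mult)
  moreover have "det A \<noteq> 0" using assms by (simp add: invertible_det_nz)
  ultimately have "matrix_inv A *v axis l 1 = (\<chi> k. det (\<chi> i j. if j = k then axis l 1 $ i else A $ i $ j) / det A)"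
    using cramer by blast
  moreover have "(matrix_inv A *v axis l 1) $ k = matrix_inv A $ k $ l"
    by (simp add: matrix_vector_mult_def axis_def if_distrib cong: if_cong)
  ultimately show ?thesis by simp
qed

lemma holo_matrix_on_inv:
  fixes A :: "complex \<Rightarrow> complex^'n^'n"
  assumes "holo_matrix_on A S" "\<And>z. z \<in> S \<Longrightarrow> invertible (A z)"
  shows "holo_matrix_on (\<lambda>z. matrix_inv (A z)) S"
  unfolding holo_matrix_on_def
proof (intro allI)
  fix k l
  have "(\<lambda>z. det (\<chi> i j. if j = k then axis l 1 $ i else A z $ i $ j)) holomorphic_on S"
  proof (rule holo_matrix_on_det, unfold holo_matrix_on_def, intro allI)
    fix i j show "(\<lambda>z. (\<chi> i j. if j = k then axis l 1 $ i else A z $ i $ j) $ i $ j) holomorphic_on S"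
      using assms(1) by (cases "j = k") (auto simp: holo_matrix_on_def)
  qed
  moreover have "(\<lambda>z. det (A z)) holomorphic_on S" by (rule holo_matrix_on_det[OF assms(1)])
  ultimately have "(\<lambda>z. det (\<chi> i j. if j = k then axis l 1 $ i else A z $ i $ j) / det (A z)) holomorphic_on S"
    using assms(2) by (intro holomorphic_on_divide) (auto simp: invertible_det_nz)
  then show "(\<lambda>z. matrix_inv (A z) $ k $ l) holomorphic_on S"
    by (rule holomorphic_transform) (simp add: matrix_inv_entry assms(2))
qed

section \<open>Column operations and the zeros of the determinant\<close>

definition replace_column :: "'n \<Rightarrow> 'a^'m \<Rightarrow> 'a^'n^'m \<Rightarrow> 'a^'n^'m" where
  "replace_column j x A = (\<chi> r s. if s = j then x $ r else A $ r $ s)"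

lemma replace_column_nth [simp]:
  "replace_column j x A $ r $ s = (if s = j then x $ r else A $ r $ s)"
  by (simp add: replace_column_def)

lemma det_replace_column: "det (replace_column j (A *v c) A) = c $ j * det A" for A :: "complex^'n^'n"
  unfolding replace_column_def by (rule cramer_lemma)

text \<open>Column operations commute with multiplication from the left. An operation on a frame
  \<open>T\<close> therefore acts in the same way on \<open>P ** T\<close>, whose behaviour at
  infinity has to be followed.\<close>

lemma mult_replace_column: "P ** replace_column j x A = replace_column j (P *v x) (P ** A)"
  by (auto simp: vec_eq_iff matrix_matrix_mult_def matrix_vector_mult_def intro!: sum.cong)

lemma holo_matrix_on_replace_column:
  assumes "holo_matrix_on A S" "\<And>i. (\<lambda>z. x z $ i) holomorphic_on S"
  shows "holo_matrix_on (\<lambda>z. replace_column j (x z) (A z)) S"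
  unfolding holo_matrix_on_def
proof (intro allI)
  fix i k show "(\<lambda>z. replace_column j (x z) (A z) $ i $ k) holomorphic_on S"
    using assms by (cases "k = j") (auto simp: holo_matrix_on_def)
qed

lemma singular_matrix_kernel:
  fixes A :: "complex^'n^'n"
  assumes "det A = 0"
  obtains c where "c \<noteq> 0" "A *v c = 0"
proof -
  have "\<not> (\<exists>B. B ** A = mat 1)" using assms invertible_det_nz invertible_left_inverse by metis
  then show ?thesis using that matrix_left_invertible_ker by blast
qed

lemma holomorphic_matrix_divide_root:
  fixes T :: "complex \<Rightarrow> complex^'n^'n"
  assumes T: "holo_matrix_on T UNIV" and 0: "T a *v c = 0"
  obtains g where "\<And>i. (\<lambda>z. g z $ i) holomorphic_on UNIV" "\<And>z. T z *v c = (z - a) *s g z"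
proof -
  have "\<exists>g. g holomorphic_on UNIV \<and> (\<forall>z. (T z *v c) $ i = (z - a) * g z)" for i
  proof -
    have "(\<lambda>z. (T z *v c) $ i) holomorphic_on UNIV"
      using T unfolding holo_matrix_on_def matrix_vector_mult_def by (auto intro!: holomorphic_intros)
    from holomorphic_divide_root[OF this, of a] 0 show ?thesis by auto
  qed
  then have "\<forall>i. \<exists>g. g holomorphic_on UNIV \<and> (\<forall>z. (T z *v c) $ i = (z - a) * g z)" ..
  from choice[OF this] obtain g where
    "\<forall>i. g i holomorphic_on UNIV \<and> (\<forall>z. (T z *v c) $ i = (z - a) * g i z)" ..
  then show ?thesis by (intro that[of "\<lambda>z. \<chi> i. g i z"]) (auto simp: vec_eq_iff algebra_simps)
qed

lemma entire_eq_except_point: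
  fixes f g :: "complex \<Rightarrow> complex"
  assumes "f holomorphic_on UNIV" "g holomorphic_on UNIV" "\<And>z. z \<noteq> a \<Longrightarrow> f z = g z"
  shows "f z = g z"
proof (cases "z = a")
  case True
  have "isCont f a" "isCont g a"
    using assms(1,2) holomorphic_on_imp_continuous_on continuous_on_eq_continuous_at open_UNIV by blast+
  then have f: "f \<midarrow>a\<rightarrow> f a" and g: "g \<midarrow>a\<rightarrow> g a" by (simp_all add: isCont_def)
  have "f \<midarrow>a\<rightarrow> g a"
    by (rule Lim_transform_eventually[OF g]) (use assms(3) in \<open>auto simp: eventually_at_filter\<close>)
  then show ?thesis using True f LIM_unique by blast
qed (use assms(3) in auto)

text \<open>Away from \<open>a\<close> the new column is \<open>T z\<close> applied to
  \<open>c\<close> divided by \<open>z - a\<close>, so the determinant is multiplied by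
  \<open>c $ j / (z - a)\<close> and loses exactly one factor \<open>z - a\<close>. Both sides are
  entire, so the equation extends to \<open>a\<close>.\<close>

lemma det_divide_column:
  fixes T :: "complex \<Rightarrow> complex^'n^'n"
  assumes T: "holo_matrix_on T UNIV" and g: "\<And>i. (\<lambda>z. g z $ i) holomorphic_on UNIV"
    and eq: "\<And>z. T z *v c = (z - a) *s g z"
    and d: "\<And>z. det (T z) = (z - a) * e z" and e: "e holomorphic_on UNIV"
  shows "det (replace_column j (g z) (T z)) = c $ j * e z"
proof (rule entire_eq_except_point[where a = a and f = "\<lambda>z. det (replace_column j (g z) (T z))"
      and g = "\<lambda>z. c $ j * e z"])
  show "(\<lambda>z. det (replace_column j (g z) (T z))) holomorphic_on UNIV"
    by (intro holo_matrix_on_det holo_matrix_on_replace_column T g)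
  show "(\<lambda>z. c $ j * e z) holomorphic_on UNIV" by (intro holomorphic_intros e)
  fix z assume z: "z \<noteq> a"
  have "T z *v ((1 / (z - a)) *s c) = (1 / (z - a)) *s (T z *v c)"
    by (simp add: vector_scalar_commute)
  also have "\<dots> = g z" using z by (simp only: eq vector_smult_assoc) simp
  finally have "det (replace_column j (g z) (T z)) = ((1 / (z - a)) *s c) $ j * det (T z)"
    using det_replace_column[of j "T z" "(1 / (z - a)) *s c"] by simp
  then show "det (replace_column j (g z) (T z)) = c $ j * e z" using z d by simp
qed

text \<open>All zeros lie in a disc, so there are finitely many. The induction is on the number of
  distinct zeros, each being divided out with its full multiplicity; the list \<open>as\<close>
  repeats it accordingly.\<close>

lemma entire_factor_zeros:
  assumes "f holomorphic_on UNIV" "\<And>z. norm z \<ge> R \<Longrightarrow> f z \<noteq> 0"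
  shows "\<exists>as e. e holomorphic_on UNIV \<and> (\<forall>z. e z \<noteq> 0) \<and> (\<forall>z. f z = (\<Prod>a\<leftarrow>as. z - a) * e z)"
proof -
  have fin: "finite {z. f z = 0}"
  proof (cases "f constant_on UNIV")
    case True
    \<comment> \<open>A point outside the disc, also for negative \<open>R\<close>; it shows that a
      constant \<open>f\<close> is not 0.\<close>
    have "f (of_real \<bar>R\<bar>) \<noteq> 0" by (rule assms(2)) simp
    then have "{z. f z = 0} = {}" using True unfolding constant_on_def by force
    then show ?thesis by simp
  next
    case False
    have "finite {z \<in> cball 0 R. f z = 0}"
      by (rule holomorphic_compact_finite_zeros[of f UNIV]) (use assms(1) False in auto)
    moreover have "{z. f z = 0} \<subseteq> {z \<in> cball 0 R. f z = 0}" using assms(2) by force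
    ultimately show ?thesis using finite_subset by blast
  qed
  show ?thesis
    using assms fin
  proof (induction "card {z. f z = 0}" arbitrary: f)
    case 0
    then show ?case by (intro exI[of _ "[]"] exI[of _ f]) auto
  next
    case (Suc n)
    then obtain a where a: "f a = 0" by (metis (mono_tags, lifting) Collect_empty_eq card.empty nat.distinct(1))
    have nc: "\<not> f constant_on UNIV"
    proof
      assume "f constant_on UNIV"
      then have "f (of_real \<bar>R\<bar>) = 0" using a unfolding constant_on_def by auto
      then show False using Suc.prems(2)[of "of_real \<bar>R\<bar>"] by simp
    qed
    obtain g r n' where g: "0 < n'" "0 < r" "g holomorphic_on ball a r"
      "\<And>w. w \<in> ball a r \<Longrightarrow> f w = (w - a) ^ n' * g w" "\<And>w. w \<in> ball a r \<Longrightarrow> g w \<noteq> 0"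
      using holomorphic_factor_zero_nonconstant[OF Suc.prems(1) open_UNIV connected_UNIV UNIV_I a nc] by metis
    define F where "F = (\<lambda>z. if z \<in> ball a r then g z else f z / (z - a) ^ n')"
    have hF: "F holomorphic_on UNIV"
      unfolding F_def
    proof (rule holomorphic_entire_glue[where T = "- {a}"])
      show "(\<lambda>z. f z / (z - a) ^ n') holomorphic_on - {a}"
        using Suc.prems(1) by (intro holomorphic_intros) (auto intro: holomorphic_on_subset)
    qed (use g in auto)
    have fF: "f z = (z - a) ^ n' * F z" for z
      using g(2) g(4)[of z] by (cases "z = a") (auto simp: F_def)
    have zF: "{z. F z = 0} = {z. f z = 0} - {a}"
    proof (intro set_eqI)
      fix z
      have "F a \<noteq> 0" using g(2,5) by (simp add: F_def)
      then show "z \<in> {z. F z = 0} \<longleftrightarrow> z \<in> {z. f z = 0} - {a}"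
        using fF[of z] g(1) by (cases "z = a") auto
    qed
    have c: "n = card {z. F z = 0}" using Suc.hyps(2) Suc.prems(3) a zF by simp
    have "F z \<noteq> 0" if "norm z \<ge> R" for z using Suc.prems(2)[OF that] fF[of z] by auto
    from Suc.hyps(1)[OF c hF this] obtain as e where
      ae: "e holomorphic_on UNIV" "\<forall>z. e z \<noteq> 0" "\<forall>z. F z = (\<Prod>a\<leftarrow>as. z - a) * e z"
      using zF Suc.prems(3) by auto
    then have "\<forall>z. f z = (\<Prod>a\<leftarrow>replicate n' a @ as. z - a) * e z"
      using fF by (simp add: prod_list_replicate)
    then show ?case using ae by blast
  qed
qed

text \<open>At a zero \<open>a\<close> of the determinant a constant vector \<open>c\<close> is
  killed by \<open>T a\<close>, so \<open>T z *v c\<close> is divisible by \<open>z - a\<close>. The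
  quotient takes the place of a column \<open>j\<close> with \<open>c $ j \<noteq> 0\<close>, and
  the determinant loses one factor. The growth bound on \<open>P ** T\<close> is carried through the
  induction because it later provides the extension over infinity.\<close>

lemma remove_zeros:
  fixes T P :: "complex \<Rightarrow> complex^'n^'n"
  assumes "holo_matrix_on T UNIV" "e holomorphic_on UNIV" "\<And>z. e z \<noteq> 0"
    "\<And>z. det (T z) = (\<Prod>a\<leftarrow>as. z - a) * e z"
    "\<forall>z i j. norm z \<ge> r \<longrightarrow> norm ((P z ** T z) $ i $ j) \<le> C * norm z ^ d" "C \<ge> 0"
  shows "\<exists>(H :: complex \<Rightarrow> complex^'n^'n) r C. holo_matrix_on H UNIV \<and> (\<forall>z. invertible (H z)) \<and>
    (\<forall>z i j. norm z \<ge> r \<longrightarrow> norm ((P z ** H z) $ i $ j) \<le> C * norm z ^ d)"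
  using assms
proof (induction as arbitrary: T e r C)
  case Nil
  then have "\<forall>z. invertible (T z)" by (simp add: invertible_det_nz)
  with Nil.prems(1,5) have "holo_matrix_on T UNIV \<and> (\<forall>z. invertible (T z)) \<and>
    (\<forall>z i j. r \<le> norm z \<longrightarrow> norm ((P z ** T z) $ i $ j) \<le> C * norm z ^ d)" by blast
  show ?case by (rule exI[of _ T], rule exI[of _ r], rule exI[of _ C]) fact
next
  case (Cons a as)
  have "det (T a) = 0" using Cons.prems(4)[of a] by simp
  then obtain c where c: "c \<noteq> 0" "T a *v c = 0" by (rule singular_matrix_kernel)
  then obtain j where j: "c $ j \<noteq> 0" by (auto simp: vec_eq_iff)
  obtain g where g: "\<And>i. (\<lambda>z. g z $ i) holomorphic_on UNIV" "\<And>z. T z *v c = (z - a) *s g z"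
    by (rule holomorphic_matrix_divide_root[OF Cons.prems(1) c(2)]) blast
  define T' where "T' = (\<lambda>z. replace_column j (g z) (T z))"
  define D where "D = C * (1 + (\<Sum>s\<in>UNIV. norm (c $ s)))"
  have D: "C \<le> D" "C * (\<Sum>s\<in>UNIV. norm (c $ s)) \<le> D"
    using Cons.prems(6) by (auto simp: D_def algebra_simps sum_nonneg)
  \<comment> \<open>Beyond radius \<open>norm a + 1\<close> the divisor \<open>z - a\<close> has
    norm at least 1, so the division does not enlarge the column. The constant grows to
    \<open>D\<close> because the new column combines all old ones.\<close>
  show ?case
  proof (rule Cons.IH[of T' "\<lambda>z. c $ j * e z" "max r (norm a + 1)" D])
    show "holo_matrix_on T' UNIV"
      unfolding T'_def by (rule holo_matrix_on_replace_column[OF Cons.prems(1) g(1)])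
    show "(\<lambda>z. c $ j * e z) holomorphic_on UNIV" by (intro holomorphic_intros Cons.prems)
    show "c $ j * e z \<noteq> 0" for z using j Cons.prems(3) by simp
    show "det (T' z) = (\<Prod>a\<leftarrow>as. z - a) * (c $ j * e z)" for z
    proof -
      have "(\<lambda>z. \<Prod>a\<leftarrow>as. z - a) holomorphic_on UNIV"
        by (induction as) (auto intro!: holomorphic_intros)
      then have "det (T' z) = c $ j * ((\<Prod>a\<leftarrow>as. z - a) * e z)"
        unfolding T'_def
        by (intro det_divide_column[OF Cons.prems(1) g]) (auto simp: Cons.prems(4) intro!: holomorphic_intros Cons.prems(2))
      then show ?thesis by simp
    qed
    show "D \<ge> 0" using D Cons.prems(6) by simp
    show "\<forall>z i k. max r (norm a + 1) \<le> norm z \<longrightarrow> norm ((P z ** T' z) $ i $ k) \<le> D * norm z ^ d"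
    proof (intro allI impI)
    fix z :: complex and i k :: 'n assume z: "max r (norm a + 1) \<le> norm z"
    have za: "1 \<le> norm (z - a)" using z norm_triangle_ineq2[of z a] by linarith
    have b: "norm ((P z ** T z) $ i $ s) \<le> C * norm z ^ d" for s using Cons.prems(5) z by simp
    show "norm ((P z ** T' z) $ i $ k) \<le> D * norm z ^ d"
    proof (cases "k = j")
      case True
      have gz: "g z = T z *v ((1 / (z - a)) *s c)"
      proof -
        have "z \<noteq> a" using za by auto
        then have "(1 / (z - a)) *s (T z *v c) = g z" by (simp only: g(2) vector_smult_assoc) simp
        then show ?thesis by (simp add: vector_scalar_commute)
      qed
      have "(P z *v g z) $ i = (1 / (z - a)) * ((P z ** T z) *v c) $ i"
        unfolding gz matrix_vector_mul_assoc by (simp add: vector_scalar_commute)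
      also have "((P z ** T z) *v c) $ i = (\<Sum>s\<in>UNIV. (P z ** T z) $ i $ s * c $ s)"
        by (simp add: matrix_vector_mult_def)
      finally have "norm ((P z *v g z) $ i) \<le> (1 / norm (z - a)) * norm (\<Sum>s\<in>UNIV. (P z ** T z) $ i $ s * c $ s)"
        by (simp add: norm_mult norm_divide)
      also have "\<dots> \<le> 1 * norm (\<Sum>s\<in>UNIV. (P z ** T z) $ i $ s * c $ s)"
        using za by (intro mult_right_mono) (simp_all add: divide_le_eq_1)
      also have "\<dots> \<le> (\<Sum>s\<in>UNIV. (C * norm z ^ d) * norm (c $ s))"
        by (simp, intro sum_norm_le) (auto simp: norm_mult intro!: mult_right_mono b)
      also have "\<dots> = C * (\<Sum>s\<in>UNIV. norm (c $ s)) * norm z ^ d"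
        by (simp add: sum_distrib_left[symmetric] sum_distrib_right[symmetric])
      also have "\<dots> \<le> D * norm z ^ d" by (intro mult_right_mono D) auto
      finally show ?thesis using True by (simp add: T'_def mult_replace_column)
    next
      case False
      have "norm ((P z ** T z) $ i $ k) \<le> D * norm z ^ d"
        by (rule order_trans[OF b]) (intro mult_right_mono D, simp)
      then show ?thesis using False by (simp add: T'_def mult_replace_column)
    qed
    qed
  qed
qed

text \<open>The counterpart of \<open>remove_zeros\<close> at infinity. A kernel vector
  \<open>c\<close> of \<open>B 0\<close> combines the columns of \<open>P ** H\<close>, whose
  exponents \<open>m\<close> differ; multiplying column \<open>s\<close> by \<open>z\<close> to the
  power \<open>m j - m s\<close> brings them to the common exponent \<open>m j\<close>. The combined
  column is divisible by \<open>inverse z\<close>, which lowers \<open>m j\<close> by one and the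
  order \<open>q\<close> of \<open>det B\<close> at 0 by one. Meanwhile \<open>det H\<close> is
  multiplied by the constant \<open>c $ j\<close>, so \<open>H\<close> stays invertible
  everywhere.\<close>

lemma reduce_at_infinity:
  fixes P H B :: "complex \<Rightarrow> complex^'n^'n" and m :: "'n \<Rightarrow> int"
  assumes "holo_matrix_on H UNIV" "\<And>z. invertible (H z)" "holo_matrix_on B UNIV"
    "\<And>z i j. z \<noteq> 0 \<Longrightarrow> (P z ** H z) $ i $ j = B (inverse z) $ i $ j * z powi m j"
    "\<And>u. det (B u) = u ^ q * e u" "e holomorphic_on UNIV" "e 0 \<noteq> 0"
  shows "\<exists>(H :: complex \<Rightarrow> complex^'n^'n) (B :: complex \<Rightarrow> complex^'n^'n) (m :: 'n \<Rightarrow> int). holo_matrix_on H UNIV \<and> (\<forall>z. invertible (H z)) \<and> holo_matrix_on B UNIV \<and>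
    (\<forall>z i j. z \<noteq> 0 \<longrightarrow> (P z ** H z) $ i $ j = B (inverse z) $ i $ j * z powi m j) \<and> det (B 0) \<noteq> 0"
  using assms
proof (induction q arbitrary: H B m e)
  case 0
  then have "det (B 0) \<noteq> 0" by simp
  then show ?case using 0 by blast
next
  case (Suc q)
  have "det (B 0) = 0" using Suc.prems(5)[of 0] by simp
  then obtain c where c: "c \<noteq> 0" "B 0 *v c = 0" by (rule singular_matrix_kernel)
  define S where "S = {s. c $ s \<noteq> 0}"
  have "S \<noteq> {}" using c(1) by (auto simp: vec_eq_iff S_def)
  \<comment> \<open>The column \<open>j\<close> to be replaced has the largest exponent among those
    that occur in the combination; this makes the powers of \<open>z\<close> in \<open>b\<close>
    nonnegative and the new \<open>H\<close> entire.\<close>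
  then have "Max (m ` S) \<in> m ` S" by (intro Max_in) (auto simp: S_def)
  then obtain j where j: "j \<in> S" "m j = Max (m ` S)" by (auto simp: image_iff)
  have mj: "m s \<le> m j" if "s \<in> S" for s using that unfolding j(2) by (intro Max_ge) (auto simp: S_def)
  obtain g where g: "\<And>i. (\<lambda>z. g z $ i) holomorphic_on UNIV" "\<And>z. B z *v c = (z - 0) *s g z"
    by (rule holomorphic_matrix_divide_root[OF Suc.prems(3) c(2)]) blast
  define B' where "B' = (\<lambda>z. replace_column j (g z) (B z))"
  \<comment> \<open>Where \<open>nat\<close> truncates a negative exponent, \<open>c $ s\<close> is
    0.\<close>
  define b where "b = (\<lambda>z. \<chi> s. c $ s * z ^ nat (m j - m s))"
  define H' where "H' = (\<lambda>z. replace_column j (H z *v b z) (H z))"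
  show ?case
  proof (rule Suc.IH[of H' B' "m(j := m j - 1)" "\<lambda>u. c $ j * e u"])
    show "holo_matrix_on H' UNIV"
      unfolding H'_def b_def matrix_vector_mult_def using Suc.prems(1)
      by (intro holo_matrix_on_replace_column) (auto simp: holo_matrix_on_def intro!: holomorphic_intros)
    show "invertible (H' z)" for z
      using Suc.prems(2)[of z] j(1) by (simp add: H'_def invertible_det_nz det_replace_column b_def S_def)
    show "holo_matrix_on B' UNIV"
      unfolding B'_def by (rule holo_matrix_on_replace_column[OF Suc.prems(3) g(1)])
    have "det (B' u) = c $ j * (u ^ q * e u)" for u
      unfolding B'_def
      by (rule det_divide_column[OF Suc.prems(3) g]) (auto simp: Suc.prems(5) intro!: holomorphic_intros Suc.prems(6))
    then show "det (B' u) = u ^ q * (c $ j * e u)" for u by simp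
    show "(\<lambda>u. c $ j * e u) holomorphic_on UNIV" by (intro holomorphic_intros Suc.prems)
    show "c $ j * e 0 \<noteq> 0" using Suc.prems(7) j by (simp add: S_def)
    fix z :: complex and i k assume z: "z \<noteq> 0"
    show "(P z ** H' z) $ i $ k = B' (inverse z) $ i $ k * z powi (m(j := m j - 1)) k"
    proof (cases "k = j")
      case True
      have t: "(P z ** H z) $ i $ s * b z $ s = z powi m j * (B (inverse z) $ i $ s * c $ s)" for s
      proof (cases "s \<in> S")
        case s: True
        have "z powi m s * z ^ nat (m j - m s) = z powi m j"
          using z mj[OF s] by (simp flip: power_int_add power_int_of_nat)
        then show ?thesis using Suc.prems(4)[OF z, of i s] by (simp add: b_def mult_ac)
      qed (simp add: S_def b_def)
      have "(P z *v (H z *v b z)) $ i = (\<Sum>s\<in>UNIV. (P z ** H z) $ i $ s * b z $ s)"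
        by (simp add: matrix_vector_mul_assoc) (simp add: matrix_vector_mult_def)
      also have "\<dots> = z powi m j * (B (inverse z) *v c) $ i"
        unfolding t by (simp add: matrix_vector_mult_def sum_distrib_left)
      also have "\<dots> = z powi (m j - 1) * g (inverse z) $ i"
        using z by (simp add: g(2) power_int_diff divide_inverse)
      finally show ?thesis using True by (simp add: H'_def B'_def mult_replace_column)
    next
      case False
      then show ?thesis using Suc.prems(4)[OF z, of i k] by (simp add: H'_def B'_def mult_replace_column)
    qed
  qed
qed

section \<open>The Birkhoff-Grothendieck theorem\<close>

lemma matrix_add_mult_distrib:
  "(A + B) ** C = A ** C + B ** C" for A B :: "'a::semiring_1^'n^'m"
  by (simp add: matrix_matrix_mult_def vec_eq_iff distrib_right sum.distrib)

lemma mat_scalar_mult_nth: "(mat c ** A) $ i $ j = c * A $ i $ j" for A :: "complex^'n^'m"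
  by (simp add: matrix_matrix_mult_def mat_def if_distrib if_distribR cong: if_cong)

lemma mat_scalar_commute: "A ** mat c = mat c ** A" for A :: "complex^'n^'m"
  by (simp add: vec_eq_iff mat_scalar_mult_nth)
    (simp add: matrix_matrix_mult_def mat_def if_distrib if_distribR mult.commute cong: if_cong)

lemma invertible_mat_scalar: "c \<noteq> 0 \<Longrightarrow> invertible (mat c :: complex^'n^'n)"
proof -
  assume c: "c \<noteq> 0"
  have "(mat a :: complex^'n^'n) ** mat b = mat (a * b)" for a b :: complex
    by (simp add: vec_eq_iff mat_scalar_mult_nth) (simp add: mat_def)
  then show ?thesis unfolding invertible_def using c
    by (intro exI[of _ "mat (inverse c)"]) simp
qed

lemma split_patching_mult_nth:
  "((A :: complex^'k^'k) ** split_patching n z) $ i $ j = A $ i $ j * z powi (- n j)"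
  by (simp add: matrix_matrix_mult_def split_patching_def if_distrib cong: if_cong)

text \<open>In a kernel vector, a component of largest norm \<open>M\<close> satisfies
  \<open>M \<le> (real CARD('k) * b) * M\<close>, which forces \<open>M\<close> to be 0.\<close>

lemma invertible_identity_plus_small:
  fixes V :: "complex^'k^'k"
  assumes "\<And>i j. norm (V $ i $ j) \<le> b" "real CARD('k) * b < 1"
  shows "invertible (mat 1 + V)"
proof -
  have "a = 0" if a: "(mat 1 + V) *v a = 0" for a :: "complex^'k"
  proof -
    define M where "M = Max (range (\<lambda>i. norm (a $ i)))"
    have le: "norm (a $ i) \<le> M" for i unfolding M_def by (intro Max_ge) auto
    have "M \<in> range (\<lambda>i. norm (a $ i))" unfolding M_def by (intro Max_in) auto
    then obtain i where i: "norm (a $ i) = M" by auto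
    have M0: "M \<ge> 0" using i norm_ge_zero by metis
    have "a + V *v a = 0" using a by (simp add: matrix_vector_mult_add_rdistrib)
    then have "a $ i = - (V *v a) $ i" by (metis add_eq_0_iff vector_uminus_component minus_minus)
    then have "M = norm (\<Sum>j\<in>UNIV. V $ i $ j * a $ j)" using i by (simp add: matrix_vector_mult_def)
    also have "\<dots> \<le> (\<Sum>j\<in>(UNIV :: 'k set). b * M)"
    proof (rule sum_norm_le)
      fix j
      have "b \<ge> 0" using order_trans[OF norm_ge_zero assms(1)] .
      then show "norm (V $ i $ j * a $ j) \<le> b * M"
        unfolding norm_mult by (intro mult_mono assms(1) le) auto
    qed
    finally have "M \<le> (real CARD('k) * b) * M" by simp
    then have "M \<le> 0" using assms(2) M0 by (metis mult_le_cancel_right1 not_le)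
    have "norm (a $ i) \<le> 0" for i using le[of i] \<open>M \<le> 0\<close> by (rule order_trans)
    then show "a = 0" by (simp add: vec_eq_iff)
  qed
  then have "\<exists>B. B ** (mat 1 + V) = mat 1" using matrix_left_invertible_ker by blast
  then show ?thesis by (simp add: invertible_left_inverse)
qed

lemma annulus_entries_bounded:
  fixes P :: "complex \<Rightarrow> complex^'k^'k"
  assumes "holo_matrix_on P (- {0})"
  obtains C where "C \<ge> 0" "\<And>i j z. 1/2 \<le> norm z \<Longrightarrow> norm z \<le> 4 \<Longrightarrow> norm (P z $ i $ j) \<le> C"
proof -
  let ?A = "cball 0 4 - ball 0 (1/2) :: complex set"
  have "\<exists>C. \<forall>z\<in>?A. norm (P z $ i $ j) \<le> C" for i j
  proof -
    have "continuous_on ?A (\<lambda>z. P z $ i $ j)"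
      using assms unfolding holo_matrix_on_def
      by (intro continuous_on_subset[OF holomorphic_on_imp_continuous_on]) auto
    then have "bounded ((\<lambda>z. P z $ i $ j) ` ?A)"
      by (intro compact_imp_bounded compact_continuous_image compact_diff) auto
    then show ?thesis unfolding bounded_iff by auto
  qed
  then obtain C where C: "\<And>i j z. z \<in> ?A \<Longrightarrow> norm (P z $ i $ j) \<le> C i j" by metis
  define D where "D = (\<Sum>i\<in>UNIV. \<Sum>j\<in>UNIV. \<bar>C i j\<bar>)"
  have CD: "C i j \<le> D" for i j
  proof -
    have "\<bar>C i j\<bar> \<le> (\<Sum>j\<in>UNIV. \<bar>C i j\<bar>)" by (rule member_le_sum) auto
    also have "\<dots> \<le> D" unfolding D_def by (rule member_le_sum[where f = "\<lambda>i. \<Sum>j\<in>UNIV. \<bar>C i j\<bar>"]) (auto intro: sum_nonneg)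
    finally show ?thesis by simp
  qed
  have "D \<ge> 0" unfolding D_def by (intro sum_nonneg) auto
  moreover have "norm (P z $ i $ j) \<le> D" if "1/2 \<le> norm z" "norm z \<le> 4" for i j z
    by (rule order_trans[OF C CD]) (use that in auto)
  ultimately show ?thesis by (rule that)
qed

lemma laurent_truncation_matrix:
  fixes R :: "complex \<Rightarrow> complex^'k^'k"
  assumes "holo_matrix_on R (- {0})" "\<epsilon> > 0"
  obtains N Q where "holo_matrix_on Q UNIV"
    "\<And>i j z. 1/2 \<le> norm z \<Longrightarrow> norm z \<le> 4 \<Longrightarrow> norm (R z $ i $ j - Q z $ i $ j / z ^ N) \<le> \<epsilon>"
proof -
  have "\<exists>N0. \<forall>N\<ge>N0. \<exists>p. p holomorphic_on UNIV \<and>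
    (\<forall>z. 1/2 \<le> norm z \<longrightarrow> norm z \<le> 4 \<longrightarrow> norm (R z $ i $ j - p z / z ^ N) \<le> \<epsilon>)" for i j
    by (rule laurent_truncation[OF _ assms(2)]) (use assms(1) in \<open>simp add: holo_matrix_on_def\<close>)
  then obtain N0 where N0: "\<And>i j N. N \<ge> N0 i j \<Longrightarrow> \<exists>p. p holomorphic_on UNIV \<and>
    (\<forall>z. 1/2 \<le> norm z \<longrightarrow> norm z \<le> 4 \<longrightarrow> norm (R z $ i $ j - p z / z ^ N) \<le> \<epsilon>)" by metis
  define N where "N = Max (range (\<lambda>(i, j). N0 i j))"
  have "N0 i j \<le> N" for i j unfolding N_def by (intro Max_ge) auto
  with N0 have "\<exists>p. p holomorphic_on UNIV \<and>
    (\<forall>z. 1/2 \<le> norm z \<longrightarrow> norm z \<le> 4 \<longrightarrow> norm (R z $ i $ j - p z / z ^ N) \<le> \<epsilon>)" for i j by blast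
  then obtain p where p: "\<And>i j. p i j holomorphic_on UNIV"
    "\<And>i j z. 1/2 \<le> norm z \<Longrightarrow> norm z \<le> 4 \<Longrightarrow> norm (R z $ i $ j - p i j z / z ^ N) \<le> \<epsilon>" by metis
  show ?thesis
    by (rule that[of "\<lambda>z. \<chi> i j. p i j z" N]) (auto simp: holo_matrix_on_def p)
qed

text \<open>Truncating the Laurent series of \<open>P\<inverse>\<close> gives a rational matrix \<open>Q z / z ^ N\<close> for which
  \<open>P Q / z ^ N\<close> is close to the identity near the unit circle, so a Neumann series splits it into
  a factor \<open>Y\<close> that is holomorphic at infinity and a factor that is holomorphic at zero.\<close>

lemma meromorphic_frame:
  fixes P :: "complex \<Rightarrow> complex^'k^'k"
  assumes P: "holo_matrix_on P (- {0})" "\<And>z. z \<noteq> 0 \<Longrightarrow> invertible (P z)"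
  obtains T C N where "holo_matrix_on T UNIV" "\<And>z. norm z \<ge> 3/4 \<Longrightarrow> det (T z) \<noteq> 0" "C \<ge> 0"
    "\<And>z i j. norm z \<ge> 3/4 \<Longrightarrow> norm ((P z ** T z) $ i $ j) \<le> C * norm z ^ N"
proof -
  let ?K = "real CARD('k)"
  have K: "?K \<ge> 1" by (simp add: Suc_leI)
  define R where "R = (\<lambda>z. matrix_inv (P z))"
  have R: "holo_matrix_on R (- {0})" unfolding R_def by (rule holo_matrix_on_inv) (use P in auto)
  have PR: "P z ** R z = mat 1" "R z ** P z = mat 1" if "z \<noteq> 0" for z
    using matrix_inv_mult[OF P(2)[OF that]] by (simp_all add: R_def)
  obtain Cp where Cp: "Cp \<ge> 0" "\<And>i j z. 1/2 \<le> norm z \<Longrightarrow> norm z \<le> 4 \<Longrightarrow> norm (P z $ i $ j) \<le> Cp"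
    by (rule annulus_entries_bounded[OF P(1)]) blast
  \<comment> \<open>The constant 72 serves two demands. \<open>near_identity_column\<close> asks for
    \<open>?K ^ 2 * (9 * B) \<le> 1/2\<close>, and the entries of \<open>V\<close> will be bounded
    by \<open>36 * ?K * B\<close>, so their row sums are at most 1/2 and \<open>mat 1 + V\<close> is
    invertible.\<close>
  define B where "B = 1 / (72 * ?K ^ 2)"
  have B: "B > 0" "?K ^ 2 * (9 * B) \<le> 1/2" "?K * (36 * ?K * B) = 1/2"
    using K by (auto simp: B_def power2_eq_square)
  \<comment> \<open>\<open>E\<close> will be \<open>P\<close> times the truncation error, so an
    entry is a sum of \<open>?K\<close> products of size at most \<open>Cp * \<epsilon>\<close>. The
    1 added to \<open>Cp\<close> keeps the denominator positive.\<close>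
  define \<epsilon> where "\<epsilon> = B / (?K * (Cp + 1))"
  have \<epsilon>: "\<epsilon> > 0" "?K * (Cp * \<epsilon>) \<le> B"
  proof -
    show "\<epsilon> > 0" using B(1) K Cp(1) by (simp add: \<epsilon>_def)
    have "?K * (Cp * \<epsilon>) = B * (Cp / (Cp + 1))" using K by (simp add: \<epsilon>_def)
    also have "\<dots> \<le> B * 1" using B(1) Cp(1) by (intro mult_left_mono) auto
    finally show "?K * (Cp * \<epsilon>) \<le> B" by simp
  qed
  obtain N Q where Q: "holo_matrix_on Q UNIV"
    "\<And>i j z. 1/2 \<le> norm z \<Longrightarrow> norm z \<le> 4 \<Longrightarrow> norm (R z $ i $ j - Q z $ i $ j / z ^ N) \<le> \<epsilon>"
    by (rule laurent_truncation_matrix[OF R \<epsilon>(1)]) blast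
  define Rn where "Rn = (\<lambda>z. mat (1 / z ^ N) ** Q z)"
  have Rn: "Rn z $ i $ j = Q z $ i $ j / z ^ N" for z i j by (simp add: Rn_def mat_scalar_mult_nth)
  define E where "E = (\<lambda>z. P z ** Rn z - mat 1)"
  have holoRn: "holo_matrix_on Rn (- {0})"
    unfolding holo_matrix_on_def Rn using Q(1)
    by (auto simp: holo_matrix_on_def intro!: holomorphic_intros intro: holomorphic_on_subset)
  have E_holo: "(\<lambda>z. E z $ i $ j) holomorphic_on - {0}" for i j
    using holo_matrix_on_mult[OF P(1) holoRn] unfolding E_def holo_matrix_on_def
    by (auto intro!: holomorphic_intros)
  have E_bound: "norm (E z $ i $ j) \<le> B" if z: "1/2 \<le> norm z" "norm z \<le> 4" for i j z
  proof -
    have "z \<noteq> 0" using z by auto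
    then have "E z = P z ** (Rn z - R z)"
      by (simp add: E_def PR(1)[symmetric] matrix_matrix_mult_def vec_eq_iff sum_subtractf algebra_simps)
    then have "norm (E z $ i $ j) = norm (\<Sum>k\<in>UNIV. P z $ i $ k * (Rn z - R z) $ k $ j)"
      by (simp add: matrix_matrix_mult_def)
    also have "\<dots> \<le> (\<Sum>k\<in>(UNIV::'k set). Cp * \<epsilon>)"
    proof (rule sum_norm_le)
      fix k
      have "norm ((Rn z - R z) $ k $ j) \<le> \<epsilon>" using Q(2)[OF z, of k j] by (simp add: Rn norm_minus_commute)
      then show "norm (P z $ i $ k * (Rn z - R z) $ k $ j) \<le> Cp * \<epsilon>"
        unfolding norm_mult using Cp z by (intro mult_mono) auto
    qed
    also have "\<dots> \<le> B" using \<epsilon>(2) by simp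
    finally show ?thesis .
  qed
  have norm_axis_le: "norm (axis l 1 :: complex^'k) \<le> 1" for l
    by (rule order_trans[OF norm_vec_le_sum]) (simp add: axis_def if_distrib cong: if_cong)
  have "\<exists>x v :: complex \<Rightarrow> complex^'k. (\<forall>i. (\<lambda>z. x z $ i) holomorphic_on ball 0 1) \<and>
    (\<forall>i. (\<lambda>u. v u $ i) holomorphic_on ball 0 2) \<and>
    (\<forall>z. 1/2 < norm z \<longrightarrow> norm z < 1 \<longrightarrow> x z + E z *v x z = axis l 1 + v (inverse z)) \<and>
    (\<forall>u i. norm u \<le> 4/3 \<longrightarrow> norm (v u $ i) \<le> 36 * ?K * B)" for l
  proof (rule near_identity_column[OF E_holo E_bound B(2) norm_axis_le[of l]])
    fix x v :: "complex \<Rightarrow> complex^'k"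
    assume "\<And>i. (\<lambda>z. x z $ i) holomorphic_on ball 0 1" "\<And>i. (\<lambda>u. v u $ i) holomorphic_on ball 0 2"
      "\<And>z. 1/2 < norm z \<Longrightarrow> norm z < 1 \<Longrightarrow> x z + E z *v x z = axis l 1 + v (inverse z)"
      "\<And>u i. norm u \<le> 4/3 \<Longrightarrow> norm (v u $ i) \<le> 36 * ?K * B"
    then show ?thesis by (intro exI[of _ x] exI[of _ v]) simp
  qed
  then obtain x v :: "'k \<Rightarrow> complex \<Rightarrow> complex^'k" where xv:
    "\<And>l i. (\<lambda>z. x l z $ i) holomorphic_on ball 0 1"
    "\<And>l i. (\<lambda>u. v l u $ i) holomorphic_on ball 0 2"
    "\<And>l z. 1/2 < norm z \<Longrightarrow> norm z < 1 \<Longrightarrow> x l z + E z *v x l z = axis l 1 + v l (inverse z)"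
    "\<And>l u i. norm u \<le> 4/3 \<Longrightarrow> norm (v l u $ i) \<le> 36 * ?K * B"
    by metis
  define X where "X = (\<lambda>z. \<chi> i l. x l z $ i)"
  define V where "V = (\<lambda>u. \<chi> i l. v l u $ i)"
  define Y where "Y = (\<lambda>u. mat 1 + V u)"
  have XY: "P z ** Rn z ** X z = Y (inverse z)" if z: "1/2 < norm z" "norm z < 1" for z
  proof -
    have "P z ** Rn z = mat 1 + E z" by (simp add: E_def)
    then have "P z ** Rn z ** X z = X z + E z ** X z"
      by (simp add: matrix_add_mult_distrib)
    also have "\<dots> = Y (inverse z)"
    proof (simp add: vec_eq_iff, intro allI)
      fix i l
      have "(x l z + E z *v x l z) $ i = (axis l 1 + v l (inverse z)) $ i" using xv(3)[OF z] by simp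
      then show "X z $ i $ l + (E z ** X z) $ i $ l = Y (inverse z) $ i $ l"
        by (simp add: X_def Y_def V_def matrix_matrix_mult_def matrix_vector_mult_def mat_def axis_def)
    qed
    finally show ?thesis .
  qed
  have Vb: "norm (V u $ i $ j) \<le> 36 * ?K * B" if "norm u \<le> 4/3" for u i j
    using xv(4)[OF that] by (simp add: V_def)
  have Yinv: "invertible (Y u)" if "norm u \<le> 4/3" for u
    unfolding Y_def by (rule invertible_identity_plus_small[OF Vb[OF that]]) (use B(3) in simp)
  \<comment> \<open>\<open>T1\<close> is holomorphic near zero, and \<open>P ** T2\<close> is
    \<open>z ^ N\<close> times a matrix holomorphic at infinity. Multiplying
    \<open>P ** Rn ** X = Y (inverse z)\<close> by \<open>R\<close> and \<open>z ^ N\<close> shows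
    that \<open>T1\<close> and \<open>T2\<close> agree for \<open>1/2 < norm z < 1\<close>, so
    together they form one entire matrix.\<close>
  define T1 where "T1 = (\<lambda>z. Q z ** X z)"
  define T2 where "T2 = (\<lambda>z. mat (z ^ N) ** (R z ** Y (inverse z)))"
  have T12: "T1 z = T2 z" if z: "1/2 < norm z" "norm z < 1" for z
  proof -
    have z0: "z \<noteq> 0" using z by auto
    have "R z ** Y (inverse z) = (R z ** P z) ** Rn z ** X z"
      by (simp add: XY[OF z, symmetric] matrix_mul_assoc)
    then have "R z ** Y (inverse z) = Rn z ** X z" by (simp add: PR z0)
    then have "T2 z = mat (z ^ N) ** Rn z ** X z" by (simp only: T2_def matrix_mul_assoc[symmetric])
    moreover have "mat (z ^ N) ** Rn z = Q z" using z0 by (simp add: vec_eq_iff mat_scalar_mult_nth Rn)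
    ultimately show ?thesis by (simp add: T1_def)
  qed
  define T where "T = (\<lambda>z. if z \<in> ball 0 1 then T1 z else T2 z)"
  have h1: "holo_matrix_on T1 (ball 0 1)"
    unfolding T1_def by (rule holo_matrix_on_mult[OF holo_matrix_on_subset[OF Q(1)]]) (auto simp: holo_matrix_on_def X_def xv(1))
  have h2: "holo_matrix_on T2 (- cball 0 (1/2))"
  proof -
    have "(\<lambda>z. v l (inverse z) $ i) holomorphic_on - cball 0 (1/2)" for l i
    proof -
      have "((\<lambda>u. v l u $ i) \<circ> inverse) holomorphic_on - cball 0 (1/2)"
      proof (rule holomorphic_on_compose_gen[OF _ xv(2)])
        show "inverse holomorphic_on - cball (0::complex) (1/2)" by (intro holomorphic_intros) auto
        show "inverse ` (- cball 0 (1/2)) \<subseteq> ball (0::complex) 2"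
        proof clarify
          fix z :: complex assume "z \<notin> cball 0 (1/2)"
          then have "1/2 < norm z" by simp
          from less_imp_inverse_less[OF this] show "inverse z \<in> ball 0 2" by (simp add: norm_inverse norm_divide)
        qed
      qed
      then show ?thesis by (simp add: comp_def)
    qed
    then have "holo_matrix_on (\<lambda>z. Y (inverse z)) (- cball 0 (1/2))"
      by (auto simp: holo_matrix_on_def Y_def V_def intro!: holomorphic_intros)
    then have "holo_matrix_on (\<lambda>z. R z ** Y (inverse z)) (- cball 0 (1/2))"
      by (intro holo_matrix_on_mult holo_matrix_on_subset[OF R]) auto
    then show ?thesis unfolding T2_def holo_matrix_on_def mat_scalar_mult_nth
      by (auto intro!: holomorphic_intros)
  qed
  have hT: "holo_matrix_on T UNIV"
    unfolding holo_matrix_on_def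
  proof (intro allI)
    fix i j
    have "(\<lambda>z. if z \<in> ball 0 1 then T1 z $ i $ j else T2 z $ i $ j) holomorphic_on UNIV"
    proof (rule holomorphic_entire_glue[where T = "- cball 0 (1/2)"])
      show "ball 0 1 \<union> - cball 0 (1/2) = (UNIV :: complex set)" by auto
    qed (use h1 h2 T12 in \<open>auto simp: holo_matrix_on_def\<close>)
    then show "(\<lambda>z. T z $ i $ j) holomorphic_on UNIV"
      by (rule holomorphic_transform) (simp add: T_def)
  qed
  have T2: "T z = T2 z" if "norm z > 1/2" for z using T12[of z] that by (auto simp: T_def)
  \<comment> \<open>The radius 3/4 lies inside the overlap: from there on \<open>T\<close> is
    \<open>T2\<close>, and \<open>norm (inverse z) \<le> 4/3\<close> is the range in which
    \<open>Y\<close> is known to be invertible.\<close>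
  have detT: "det (T z) \<noteq> 0" if z: "norm z \<ge> 3/4" for z
  proof -
    have z0: "z \<noteq> 0" using z by auto
    have "norm (inverse z) \<le> 4/3" using z z0 by (simp add: norm_inverse norm_divide field_simps)
    moreover have "invertible (R z)" unfolding invertible_def using PR[OF z0] by blast
    ultimately have "invertible (T2 z)"
      unfolding T2_def by (intro invertible_mult invertible_mat_scalar Yinv) (use z0 in auto)
    then show ?thesis using T2[of z] z by (simp add: invertible_det_nz)
  qed
  have bound: "norm ((P z ** T z) $ i $ j) \<le> (1 + 36 * ?K * B) * norm z ^ N" if z: "norm z \<ge> 3/4" for z i j
  proof -
    have z0: "z \<noteq> 0" using z by auto
    have zi: "norm (inverse z) \<le> 4/3" using z z0 by (simp add: norm_inverse norm_divide field_simps)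
    have "P z ** T z = (P z ** mat (z ^ N)) ** (R z ** Y (inverse z))"
      using T2[of z] z by (simp add: T2_def matrix_mul_assoc)
    also have "\<dots> = mat (z ^ N) ** ((P z ** R z) ** Y (inverse z))"
      by (simp only: mat_scalar_commute[of "P z"] matrix_mul_assoc)
    finally have "P z ** T z = mat (z ^ N) ** ((P z ** R z) ** Y (inverse z))" .
    then have "(P z ** T z) $ i $ j = z ^ N * Y (inverse z) $ i $ j"
      by (simp add: PR z0 mat_scalar_mult_nth)
    moreover have "norm (Y (inverse z) $ i $ j) \<le> 1 + 36 * ?K * B"
    proof -
      have "norm (Y (inverse z) $ i $ j) \<le> norm ((mat 1 :: complex^'k^'k) $ i $ j) + norm (V (inverse z) $ i $ j)"
        unfolding Y_def by (simp add: norm_triangle_ineq)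
      also have "norm ((mat 1 :: complex^'k^'k) $ i $ j) \<le> 1" by (simp add: mat_def)
      finally show ?thesis using Vb[OF zi, of i j] by linarith
    qed
    ultimately show ?thesis by (simp add: norm_mult norm_power mult.commute mult_left_mono)
  qed
  show ?thesis
    by (rule that[OF hT detT _ bound]) (use B(1) in \<open>auto intro!: add_nonneg_nonneg\<close>)
qed

text \<open>Once the zeros in the plane are removed, \<open>H\<close> is invertible everywhere and
  \<open>P ** H\<close> has a pole of order at most \<open>N\<close> at infinity. In the coordinate
  \<open>u = inverse z\<close> the matrix \<open>u ^ N P H\<close> is bounded near 0 and extends to
  \<open>B\<close>, which can degenerate only at \<open>u = 0\<close>. After that is repaired,
  \<open>B\<close> serves as \<open>Hhat\<close>; the exponents are the negatives of the column
  orders \<open>m\<close>, because \<open>split_patching\<close> contains the powers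
  \<open>- n i\<close>.\<close>

theorem birkhoff_grothendieck:
  fixes P :: "complex \<Rightarrow> complex^'k^'k"
  assumes P: "holo_matrix_on P (- {0})" "\<And>z. z \<noteq> 0 \<Longrightarrow> invertible (P z)"
  obtains n H Hhat where "birkhoff P n H Hhat"
proof -
  obtain T C N where T: "holo_matrix_on T UNIV" "\<And>z. norm z \<ge> 3/4 \<Longrightarrow> det (T z) \<noteq> 0" "C \<ge> 0"
    "\<And>z i j. norm z \<ge> 3/4 \<Longrightarrow> norm ((P z ** T z) $ i $ j) \<le> C * norm z ^ N"
    by (rule meromorphic_frame[OF P]) blast+
  obtain as e where e: "e holomorphic_on UNIV" "\<And>z. e z \<noteq> 0" "\<And>z. det (T z) = (\<Prod>a\<leftarrow>as. z - a) * e z"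
    using entire_factor_zeros[OF holo_matrix_on_det[OF T(1)] T(2)] by blast
  have "\<forall>z i j. 3/4 \<le> norm z \<longrightarrow> norm ((P z ** T z) $ i $ j) \<le> C * norm z ^ N" using T(4) by simp
  from remove_zeros[OF T(1) e this T(3)] obtain H :: "complex \<Rightarrow> complex^'k^'k" and r C where
    "holo_matrix_on H UNIV \<and> (\<forall>z. invertible (H z)) \<and>
      (\<forall>z i j. norm z \<ge> r \<longrightarrow> norm ((P z ** H z) $ i $ j) \<le> C * norm z ^ N)"
    by blast
  then have H: "holo_matrix_on H UNIV" "\<And>z. invertible (H z)"
    "\<And>z i j. norm z \<ge> r \<Longrightarrow> norm ((P z ** H z) $ i $ j) \<le> C * norm z ^ N"
    by simp_all
  define L where "L = (\<lambda>u. mat (u ^ N) ** (P (inverse u) ** H (inverse u)))"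
  have L: "\<exists>b. b holomorphic_on UNIV \<and> (\<forall>u. u \<noteq> 0 \<longrightarrow> b u = L u $ i $ j)" for i j
  proof -
    have "holo_matrix_on (\<lambda>z. P z ** H z) (- {0})"
      by (intro holo_matrix_on_mult P holo_matrix_on_subset[OF H(1)]) auto
    then have "(\<lambda>z. (P z ** H z) $ i $ j) \<circ> inverse holomorphic_on - {0}"
      unfolding holo_matrix_on_def
      by (intro holomorphic_on_compose_gen[of inverse "- {0}" _ "- {0}"] holomorphic_intros) auto
    then have hol: "(\<lambda>u. L u $ i $ j) holomorphic_on UNIV - {0}"
      unfolding L_def mat_scalar_mult_nth comp_def Compl_eq_Diff_UNIV[symmetric]
      by (intro holomorphic_intros)
    have "norm (L u $ i $ j) \<le> C" if u: "u \<noteq> 0" "norm u < 1 / (\<bar>r\<bar> + 1)" for u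
    proof -
      have "r * norm u \<le> \<bar>r\<bar> * norm u" by (rule mult_right_mono) auto
      moreover have "(\<bar>r\<bar> + 1) * norm u < 1" using u(2) by (simp add: field_simps)
      ultimately have "r * norm u \<le> 1" using norm_ge_zero[of u] unfolding distrib_right by linarith
      then have "norm (inverse u) \<ge> r" using u(1) by (simp add: norm_inverse norm_divide field_simps)
      from H(3)[OF this, of i j] have "norm ((P (inverse u) ** H (inverse u)) $ i $ j) * norm u ^ N
          \<le> (C * norm (inverse u) ^ N) * norm u ^ N"
        by (rule mult_right_mono) simp
      also have "\<dots> = C" using u by (simp add: norm_inverse power_mult_distrib[symmetric])
      finally show ?thesis by (simp add: L_def mat_scalar_mult_nth norm_mult norm_power mult.commute)
    qed
    then have "\<forall>\<^sub>F u in at 0. norm (L u $ i $ j) \<le> C"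
      unfolding eventually_at by (intro exI[of _ "1 / (\<bar>r\<bar> + 1)"]) auto
    then show ?thesis
      using holomorphic_on_extend_bounded[OF hol] by auto
  qed
  then obtain b where b: "\<And>i j. b i j holomorphic_on UNIV" "\<And>i j u. u \<noteq> 0 \<Longrightarrow> b i j u = L u $ i $ j"
    by metis
  define B where "B = (\<lambda>u. \<chi> i j. b i j u)"
  have BL: "B u = L u" if "u \<noteq> 0" for u using that by (simp add: B_def vec_eq_iff b(2))
  have hB: "holo_matrix_on B UNIV" by (simp add: holo_matrix_on_def B_def b(1))
  have "invertible (L u)" if "u \<noteq> 0" for u
    unfolding L_def by (intro invertible_mult invertible_mat_scalar P(2) H(2)) (use that in auto)
  then have dB: "det (B u) \<noteq> 0" if "u \<noteq> 0" for u using BL[OF that] that by (simp add: invertible_det_nz)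
  have "det (B u) \<noteq> 0" if "norm u \<ge> 1" for u using dB[of u] that by fastforce
  then obtain as' e' where e': "e' holomorphic_on UNIV" "\<And>z. e' z \<noteq> 0"
    "\<And>z. det (B z) = (\<Prod>a\<leftarrow>as'. z - a) * e' z"
    using entire_factor_zeros[OF holo_matrix_on_det[OF hB], of 1] by blast
  \<comment> \<open>Off 0 the matrix \<open>B\<close> is a product of invertible ones, so every
    listed zero is 0 and the product over the list is a power of the coordinate.\<close>
  have "a = 0" if "a \<in> set as'" for a
  proof (rule ccontr)
    assume "a \<noteq> 0"
    moreover have "(\<Prod>x\<leftarrow>as'. a - x) = 0" using that by (induction as') auto
    ultimately show False using dB[of a] e'(3)[of a] by simp
  qed
  then have "(\<Prod>a\<leftarrow>as'. z - a) = z ^ length as'" for z by (induction as') auto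
  with e' have dete: "det (B u) = u ^ length as' * e' u" for u by simp
  have PH: "(P z ** H z) $ i $ j = B (inverse z) $ i $ j * z powi int N" if "z \<noteq> 0" for z i j
    using that BL[of "inverse z"] by (simp add: L_def mat_scalar_mult_nth power_inverse)
  from reduce_at_infinity[OF H(1,2) hB PH dete e'(1) e'(2)] obtain H B :: "complex \<Rightarrow> complex^'k^'k" and m :: "'k \<Rightarrow> int" where
    "holo_matrix_on H UNIV \<and> (\<forall>z. invertible (H z)) \<and> holo_matrix_on B UNIV \<and>
    (\<forall>z i j. z \<noteq> 0 \<longrightarrow> (P z ** H z) $ i $ j = B (inverse z) $ i $ j * z powi m j) \<and> det (B 0) \<noteq> 0"
    by blast
  then have HB: "holo_matrix_on H UNIV" "\<And>z. invertible (H z)" "holo_matrix_on B UNIV"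
    "\<And>z i j. z \<noteq> 0 \<Longrightarrow> (P z ** H z) $ i $ j = B (inverse z) $ i $ j * z powi m j" "det (B 0) \<noteq> 0"
    by simp_all
  have eq: "P z ** H z = B (inverse z) ** split_patching (\<lambda>j. - m j) z" if "z \<noteq> 0" for z
    by (simp add: vec_eq_iff split_patching_mult_nth HB(4)[OF that])
  have "invertible (B u)" for u
  proof (cases "u = 0")
    case False
    have "det (B u) * det (split_patching (\<lambda>j. - m j) (inverse u)) = det (P (inverse u)) * det (H (inverse u))"
      using eq[of "inverse u"] False by (metis det_mul inverse_inverse_eq inverse_nonzero_iff_nonzero)
    then show ?thesis using P(2)[of "inverse u"] HB(2)[of "inverse u"] False
      by (auto simp: invertible_det_nz)
  qed (use HB(5) in \<open>simp add: invertible_det_nz\<close>)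
  moreover have "P z = B (inverse z) ** split_patching (\<lambda>j. - m j) z ** matrix_inv (H z)" if "z \<noteq> 0" for z
    using matrix_inv_mult(1)[OF HB(2), of z] by (simp add: eq[OF that, symmetric] flip: matrix_mul_assoc)
  ultimately show ?thesis
    using HB(1-3) by (intro that[of "\<lambda>j. - m j" H B]) (auto simp: birkhoff_def holo_matrix_eq)
qed

section \<open>Split bundles on the projective line\<close>

lemma poly_eq_truncated_sum:
  fixes p :: "complex poly"
  assumes "\<And>r. r \<ge> N \<Longrightarrow> coeff p r = 0"
  shows "poly p z = (\<Sum>r<N. coeff p r * z ^ r)"
proof -
  have "poly p z = (\<Sum>r\<le>degree p. coeff p r * z ^ r)" by (rule poly_altdef)
  also have "\<dots> = (\<Sum>r\<in>{..degree p} \<inter> {..<N}. coeff p r * z ^ r)"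
    using assms by (intro sum.mono_neutral_right) auto
  also have "\<dots> = (\<Sum>r<N. coeff p r * z ^ r)"
    by (intro sum.mono_neutral_left) (auto simp: coeff_eq_0)
  finally show ?thesis .
qed

text \<open>The cocycle condition bounds \<open>f\<close> by a multiple of
  \<open>norm z powi n\<close> outside the unit disc. Liouville's theorem leaves a polynomial of
  degree at most \<open>n\<close>, and 0 when \<open>n\<close> is negative. The count
  \<open>nat (n + 1)\<close> of coefficients covers both cases, being 0 in the second.\<close>

lemma line_bundle_section_polynomial:
  fixes f fhat :: "complex \<Rightarrow> complex"
  assumes f: "f holomorphic_on UNIV" "fhat holomorphic_on UNIV"
    and eq: "\<And>z. z \<noteq> 0 \<Longrightarrow> fhat (inverse z) = z powi (- n) * f z"
  obtains p where "\<And>z. poly p z = f z" "\<And>r. r \<ge> nat (n + 1) \<Longrightarrow> coeff p r = 0"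
proof -
  have "bounded (fhat ` cball 0 1)"
    by (intro compact_imp_bounded compact_continuous_image
        holomorphic_on_imp_continuous_on[THEN continuous_on_subset, OF f(2)]) auto
  then obtain B where "\<forall>x\<in>cball 0 1. norm (fhat x) \<le> B" unfolding bounded_iff by auto
  then have B: "norm (fhat u) \<le> B" if "norm u \<le> 1" for u using that by simp
  have bound: "norm (f z) \<le> B * norm z powi n" if "1 \<le> norm z" for z
  proof -
    have z0: "z \<noteq> 0" using that by auto
    have "norm (inverse z) \<le> 1" using that z0 by (simp add: norm_inverse norm_divide field_simps)
    moreover have "f z = fhat (inverse z) * z powi n" using z0 by (simp add: eq power_int_minus)
    ultimately show ?thesis using B by (simp add: norm_mult norm_power_int mult_right_mono)
  qed
  show ?thesis
  proof (cases "n \<ge> 0")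
    case True
    define p where "p = (\<Sum>k\<le>nat n. monom ((deriv ^^ k) f 0 / fact k) k)"
    have "norm (f z) \<le> B * norm z ^ nat n" if "1 \<le> norm z" for z
      using bound[OF that] True by (simp add: power_int_def)
    from Liouville_polynomial[OF f(1) this] have "poly p z = f z" for z
      by (simp add: p_def poly_sum poly_monom)
    moreover have "coeff p r = 0" if "r \<ge> nat (n + 1)" for r
      using that True by (auto simp: p_def coeff_sum intro!: sum.neutral)
    ultimately show ?thesis by (rule that)
  next
    case False
    have B0: "B \<ge> 0" using order_trans[OF norm_ge_zero B[of 0]] by simp
    have "(f \<longlongrightarrow> 0) at_infinity"
    proof (rule Lim_null_comparison)
      show "\<forall>\<^sub>F z in at_infinity. norm (f z) \<le> B * norm (inverse z)"
        unfolding eventually_at_infinity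
      proof (intro exI[of _ 1] allI impI)
        fix z :: complex assume z: "1 \<le> norm z"
        have "norm z powi n \<le> norm z powi (-1)" using False z by (intro power_int_increasing) auto
        then have "B * norm z powi n \<le> B * norm (inverse z)"
          using B0 by (intro mult_left_mono) (auto simp: power_int_minus norm_inverse norm_divide)
        then show "norm (f z) \<le> B * norm (inverse z)" using bound[OF z] by linarith
      qed
      show "((\<lambda>z. B * norm (inverse z)) \<longlongrightarrow> 0) (at_infinity :: complex filter)"
        by (intro tendsto_mult_right_zero tendsto_norm_zero tendsto_inverse_0)
    qed
    then have "f z = 0" for z by (rule Liouville_weak_0[OF f(1)])
    then show ?thesis by (intro that[of 0]) auto
  qed
qed

section \<open>Comparison of two splittings of one bundle\<close>

lemma matrix_inv_unique:
  fixes A B :: "complex^'n^'n"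
  assumes "A ** B = mat 1"
  shows "matrix_inv A = B"
proof -
  have "B ** A = mat 1" using assms matrix_left_right_inverse by blast
  then have "invertible A" using assms unfolding invertible_def by blast
  then have "matrix_inv A = matrix_inv A ** (A ** B)" using assms by simp
  also have "\<dots> = B" using matrix_inv_mult(2)[OF \<open>invertible A\<close>] by (simp add: matrix_mul_assoc)
  finally show ?thesis .
qed

lemma matrix_inv_of_mult:
  fixes A B :: "complex^'n^'n"
  assumes "invertible A" "invertible B"
  shows "matrix_inv (A ** B) = matrix_inv B ** matrix_inv A"
proof (rule matrix_inv_unique)
  have "A ** B ** (matrix_inv B ** matrix_inv A) = A ** (B ** matrix_inv B) ** matrix_inv A"
    by (simp only: matrix_mul_assoc)
  then show "A ** B ** (matrix_inv B ** matrix_inv A) = mat 1"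
    using assms by (simp add: matrix_inv_mult)
qed

lemma invertible_matrix_inv: "invertible A \<Longrightarrow> invertible (matrix_inv A)" for A :: "complex^'n^'n"
  unfolding invertible_def[of "matrix_inv A"] using matrix_inv_mult by blast

lemma mult_split_patching_nth:
  "(split_patching n z ** (A :: complex^'k^'k)) $ i $ j = z powi (- n i) * A $ i $ j"
  by (simp add: matrix_matrix_mult_def split_patching_def if_distrib if_distribR cong: if_cong)

lemma split_patching_vector_nth:
  "(split_patching n z *v (a :: complex^'k)) $ i = z powi (- n i) * a $ i"
  by (simp add: matrix_vector_mult_def split_patching_def if_distrib if_distribR cong: if_cong)

lemma split_patching_inv:
  fixes n :: "'k::finite \<Rightarrow> int"
  assumes "z \<noteq> 0"
  shows "split_patching n z ** split_patching (\<lambda>i. - n i) z = mat 1"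
    "invertible (split_patching n z)" "matrix_inv (split_patching n z) = split_patching (\<lambda>i. - n i) z"
proof -
  have *: "split_patching n z ** split_patching (\<lambda>i. - n i) z = mat 1" for n :: "'k \<Rightarrow> int"
    using assms by (auto simp: vec_eq_iff mult_split_patching_nth) (simp add: split_patching_def mat_def flip: power_int_add)
  show "split_patching n z ** split_patching (\<lambda>i. - n i) z = mat 1" by (rule *)
  then show "matrix_inv (split_patching n z) = split_patching (\<lambda>i. - n i) z" by (rule matrix_inv_unique)
  show "invertible (split_patching n z)"
    using *[of n] *[of "\<lambda>i. - n i"] unfolding invertible_def by auto
qed

text \<open>Two frames of one bundle differ by an isomorphism between the split bundles with
  exponents \<open>n\<close> and \<open>n'\<close>. Its entry in row \<open>i\<close> and column
  \<open>j\<close> is a section of the line bundle of degree \<open>n' i - n j\<close>.\<close>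

lemma birkhoff_comparison:
  assumes "birkhoff P n H Hhat" "birkhoff P n' H' Hhat'" "z \<noteq> 0"
  shows "(matrix_inv (Hhat' (inverse z)) ** Hhat (inverse z)) $ i $ j
    = z powi (n j - n' i) * (matrix_inv (H' z) ** H z) $ i $ j"
proof -
  let ?D = "split_patching n z" and ?D' = "split_patching n' z"
  let ?K = "matrix_inv (Hhat' (inverse z))"
  note b = assms(1,2)[unfolded birkhoff_def]
  have 1: "?K ** Hhat' (inverse z) = mat 1" using b matrix_inv_mult by blast
  have 2: "matrix_inv (H z) ** H z = mat 1" using b matrix_inv_mult by blast
  have "Hhat (inverse z) ** ?D ** matrix_inv (H z) = Hhat' (inverse z) ** ?D' ** matrix_inv (H' z)"
    using b assms(3) by metis
  then have "?K ** (Hhat (inverse z) ** ?D ** matrix_inv (H z)) ** H z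
      = ?K ** (Hhat' (inverse z) ** ?D' ** matrix_inv (H' z)) ** H z" by simp
  moreover have "?K ** (Hhat (inverse z) ** ?D ** matrix_inv (H z)) ** H z
      = ?K ** Hhat (inverse z) ** ?D ** (matrix_inv (H z) ** H z)" by (simp only: matrix_mul_assoc)
  moreover have "?K ** (Hhat' (inverse z) ** ?D' ** matrix_inv (H' z)) ** H z
      = (?K ** Hhat' (inverse z)) ** (?D' ** (matrix_inv (H' z) ** H z))" by (simp only: matrix_mul_assoc)
  ultimately have "?K ** Hhat (inverse z) ** ?D = ?D' ** (matrix_inv (H' z) ** H z)"
    by (simp add: 1 2)
  then have "(?K ** Hhat (inverse z)) $ i $ j * z powi (- n j)
      = z powi (- n' i) * (matrix_inv (H' z) ** H z) $ i $ j"
    by (metis split_patching_mult_nth mult_split_patching_nth)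
  then have "(?K ** Hhat (inverse z)) $ i $ j * (z powi (- n j) * z powi n j)
      = z powi (n j) * z powi (- n' i) * (matrix_inv (H' z) ** H z) $ i $ j" by (simp add: mult_ac)
  then show ?thesis using assms(3) by (simp flip: power_int_add)
qed

lemma birkhoff_transition_holo:
  assumes "birkhoff P n H Hhat" "birkhoff P n' H' Hhat'"
  shows "holo_matrix (\<lambda>z. matrix_inv (H' z) ** H z)" "holo_matrix (\<lambda>z. matrix_inv (Hhat' z) ** Hhat z)"
    "invertible (matrix_inv (H' z) ** H z)" "invertible (matrix_inv (Hhat' z) ** Hhat z)"
  using assms unfolding birkhoff_def holo_matrix_eq
  by (auto intro!: holo_matrix_on_mult holo_matrix_on_inv invertible_mult invertible_matrix_inv)

text \<open>An entry that would map a summand to one of smaller degree vanishes. The determinant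
  does not, so some term of its expansion has only nonzero factors, and \<open>\<sigma>\<close> is
  the permutation of that term.\<close>

lemma birkhoff_degree_le:
  fixes n n' :: "'k::finite \<Rightarrow> int"
  assumes "birkhoff P n H Hhat" "birkhoff P n' H' Hhat'"
  obtains \<sigma> where "\<sigma> permutes (UNIV :: 'k set)" "\<And>i. n (\<sigma> i) \<le> n' i"
proof -
  let ?A = "\<lambda>z. matrix_inv (H' z) ** H z" and ?B = "\<lambda>z. matrix_inv (Hhat' z) ** Hhat z"
  have zero: "?A z $ i $ j = 0" if "n' i < n j" for i j z
  proof -
    obtain p where p: "\<And>z. poly p z = ?A z $ i $ j" "\<And>r. r \<ge> nat (n' i - n j + 1) \<Longrightarrow> coeff p r = 0"
    proof (rule line_bundle_section_polynomial[of "\<lambda>z. ?A z $ i $ j" "\<lambda>z. ?B z $ i $ j" "n' i - n j"])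
      show "?B (inverse z) $ i $ j = z powi (- (n' i - n j)) * ?A z $ i $ j" if "z \<noteq> 0" for z
        using birkhoff_comparison[OF assms that] by simp
    qed (use birkhoff_transition_holo[OF assms] in \<open>auto simp: holo_matrix_def\<close>)
    have "p = 0" using p(2) that by (intro poly_eqI) auto
    then show ?thesis using p(1)[of z] by simp
  qed
  have "det (?A 1) \<noteq> 0" using birkhoff_transition_holo(3)[OF assms, of 1] by (simp add: invertible_det_nz)
  then have "\<exists>\<sigma>. \<sigma> permutes UNIV \<and> of_int (sign \<sigma>) * (\<Prod>i\<in>UNIV. ?A 1 $ i $ \<sigma> i) \<noteq> 0"
    unfolding det_def using sum.neutral by (metis (mono_tags, lifting) mem_Collect_eq)
  then obtain \<sigma> where \<sigma>: "\<sigma> permutes UNIV" "(\<Prod>i\<in>UNIV. ?A 1 $ i $ \<sigma> i) \<noteq> 0" by auto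
  then have "?A 1 $ i $ \<sigma> i \<noteq> 0" for i by simp
  then have "n (\<sigma> i) \<le> n' i" for i using zero[of i "\<sigma> i" 1] by (meson not_less)
  then show ?thesis using that \<sigma>(1) by blast
qed

text \<open>With the comparison in both directions the sums of the exponents agree, so each
  inequality \<open>n (\<sigma> i) \<le> n' i\<close> is an equality. Moving row \<open>i\<close> of
  the transition matrix to place \<open>\<sigma> i\<close> turns an isomorphism between two split
  bundles into an automorphism of the first one; the permutation that remains is
  \<open>\<rho>\<close>.\<close>

lemma birkhoff_unique:
  fixes n n' :: "'k::finite \<Rightarrow> int"
  assumes b: "birkhoff P n H Hhat" and b': "birkhoff P n' H' Hhat'"
  obtains \<rho> g ghat where "bij \<rho>" "n' = n \<circ> \<rho>" "(g, ghat) \<in> cech_H0_End_inv (split_patching n)"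
    "\<And>z i y. (matrix_inv (H' z) *v y) $ i = (g z *v (matrix_inv (H z) *v y)) $ \<rho> i"
    "\<And>z i y. (matrix_inv (Hhat' z) *v y) $ i = (ghat z *v (matrix_inv (Hhat z) *v y)) $ \<rho> i"
proof -
  let ?A = "\<lambda>z. matrix_inv (H' z) ** H z" and ?B = "\<lambda>z. matrix_inv (Hhat' z) ** Hhat z"
  obtain \<sigma> where \<sigma>: "\<sigma> permutes (UNIV :: 'k set)" "\<And>i. n (\<sigma> i) \<le> n' i"
    by (rule birkhoff_degree_le[OF b b']) blast
  obtain \<tau> where \<tau>: "\<tau> permutes (UNIV :: 'k set)" "\<And>i. n' (\<tau> i) \<le> n i"
    by (rule birkhoff_degree_le[OF b' b]) blast
  have "(\<Sum>i\<in>UNIV. n' i) = (\<Sum>i\<in>UNIV. n' (\<tau> i))"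
    using sum.permute[OF \<tau>(1), of n'] by (simp add: comp_def)
  also have "\<dots> \<le> (\<Sum>i\<in>UNIV. n i)" by (intro sum_mono \<tau>)
  also have "\<dots> = (\<Sum>i\<in>UNIV. n (\<sigma> i))"
    using sum.permute[OF \<sigma>(1), of n] by (simp add: comp_def)
  finally have "(\<Sum>i\<in>UNIV. n' i - n (\<sigma> i)) \<le> 0" by (simp add: sum_subtractf)
  moreover have "(\<Sum>i\<in>UNIV. n' i - n (\<sigma> i)) \<ge> 0" using \<sigma>(2) by (intro sum_nonneg) simp
  ultimately have "(\<Sum>i\<in>UNIV. n' i - n (\<sigma> i)) = 0" by simp
  then have "\<forall>i\<in>UNIV. n' i - n (\<sigma> i) = 0" using \<sigma>(2) by (subst (asm) sum_nonneg_eq_0_iff) auto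
  then have nn: "n' i = n (\<sigma> i)" for i by simp
  have bij: "bij \<sigma>" using \<sigma>(1) permutes_bij by blast
  have inv: "inv \<sigma> (\<sigma> i) = i" "\<sigma> (inv \<sigma> i) = i" for i
    using bij by (simp_all add: bij_is_inj bij_is_surj surj_f_inv_f)
  define g where "g = (\<lambda>z. \<chi> a j. ?A z $ inv \<sigma> a $ j)"
  define ghat where "ghat = (\<lambda>z. \<chi> a j. ?B z $ inv \<sigma> a $ j)"
  have perm: "invertible (\<chi> a j. X $ inv \<sigma> a $ j)" if "invertible X" for X :: "complex^'k^'k"
  proof -
    have "v = 0" if v: "(\<chi> a j. X $ inv \<sigma> a $ j) *v v = 0" for v
    proof -
      have "(X *v v) $ i = ((\<chi> a j. X $ inv \<sigma> a $ j) *v v) $ \<sigma> i" for i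
        by (simp add: matrix_vector_mult_def inv)
      then have "X *v v = 0" using v by (simp add: vec_eq_iff)
      moreover have "\<exists>B. B ** X = mat 1" using \<open>invertible X\<close> unfolding invertible_def by blast
      ultimately show "v = 0" unfolding matrix_left_invertible_ker by blast
    qed
    then have "\<exists>B. B ** (\<chi> a j. X $ inv \<sigma> a $ j) = mat 1"
      unfolding matrix_left_invertible_ker by blast
    then show ?thesis by (simp add: invertible_left_inverse)
  qed
  have coc: "ghat (inverse z) = split_patching n z ** g z ** matrix_inv (split_patching n z)" if z: "z \<noteq> 0" for z
    unfolding vec_eq_iff
  proof (intro allI)
    fix a j
    have "ghat (inverse z) $ a $ j = z powi (n j - n a) * g z $ a $ j"
      using birkhoff_comparison[OF b b' z, of "inv \<sigma> a" j] by (simp add: g_def ghat_def nn inv)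
    then show "ghat (inverse z) $ a $ j = (split_patching n z ** g z ** matrix_inv (split_patching n z)) $ a $ j"
      using z by (simp add: split_patching_inv split_patching_mult_nth mult_split_patching_nth
          power_int_diff power_int_minus field_simps)
  qed
  note h = birkhoff_transition_holo[OF b b']
  have "(g, ghat) \<in> cech_H0_End_inv (split_patching n)"
  proof -
    have "holo_matrix g" "holo_matrix ghat"
      using h(1,2) by (simp_all add: holo_matrix_def g_def ghat_def)
    moreover have "invertible (g z)" "invertible (ghat z)" for z
      unfolding g_def ghat_def by (intro perm h)+
    ultimately show ?thesis unfolding cech_H0_End_inv_def using coc by simp
  qed
  moreover have "(matrix_inv (H' z) *v y) $ i = (g z *v (matrix_inv (H z) *v y)) $ \<sigma> i" for z i y
  proof -
    have "(g z *v (matrix_inv (H z) *v y)) $ \<sigma> i = (?A z *v (matrix_inv (H z) *v y)) $ i"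
      by (simp add: g_def matrix_vector_mult_def inv)
    also have "?A z *v (matrix_inv (H z) *v y) = matrix_inv (H' z) ** (H z ** matrix_inv (H z)) *v y"
      by (simp only: matrix_vector_mul_assoc matrix_mul_assoc)
    also have "H z ** matrix_inv (H z) = mat 1" using b matrix_inv_mult unfolding birkhoff_def by blast
    finally show ?thesis by simp
  qed
  moreover have "(matrix_inv (Hhat' z) *v y) $ i = (ghat z *v (matrix_inv (Hhat z) *v y)) $ \<sigma> i" for z i y
  proof -
    have "(ghat z *v (matrix_inv (Hhat z) *v y)) $ \<sigma> i = (?B z *v (matrix_inv (Hhat z) *v y)) $ i"
      by (simp add: ghat_def matrix_vector_mult_def inv)
    also have "?B z *v (matrix_inv (Hhat z) *v y) = matrix_inv (Hhat' z) ** (Hhat z ** matrix_inv (Hhat z)) *v y"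
      by (simp only: matrix_vector_mul_assoc matrix_mul_assoc)
    also have "Hhat z ** matrix_inv (Hhat z) = mat 1" using b matrix_inv_mult unfolding birkhoff_def by blast
    finally show ?thesis by simp
  qed
  ultimately show ?thesis using bij nn by (intro that[of \<sigma> g ghat]) auto
qed

text \<open>The inverse of \<open>g\<close> is placed to the right of \<open>H\<close>, so that
  inverting the new \<open>H\<close> puts \<open>g\<close> in front. The exponents survive because
  the cocycle condition, with \<open>D\<close> for the diagonal matrix, reads
  \<open>D g = ghat D\<close>.\<close>

lemma birkhoff_gauge:
  assumes b: "birkhoff P n H Hhat" and g: "(g, ghat) \<in> cech_H0_End_inv (split_patching n)"
  shows "birkhoff P n (\<lambda>z. H z ** matrix_inv (g z)) (\<lambda>z. Hhat z ** matrix_inv (ghat z))"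
    "matrix_inv (H z ** matrix_inv (g z)) *v y = g z *v (matrix_inv (H z) *v y)"
    "matrix_inv (Hhat z ** matrix_inv (ghat z)) *v y = ghat z *v (matrix_inv (Hhat z) *v y)"
proof -
  note bd = b[unfolded birkhoff_def] and gd = g[unfolded cech_H0_End_inv_def, simplified]
  have inv_inv: "matrix_inv (matrix_inv X) = X" if "invertible X" for X :: "complex^'a^'a"
    using matrix_inv_mult(2)[OF that] by (rule matrix_inv_unique)
  have i1: "matrix_inv (H z ** matrix_inv (g z)) = g z ** matrix_inv (H z)" for z
    using bd gd by (simp add: matrix_inv_of_mult invertible_matrix_inv inv_inv)
  have i2: "matrix_inv (Hhat z ** matrix_inv (ghat z)) = ghat z ** matrix_inv (Hhat z)" for z
    using bd gd by (simp add: matrix_inv_of_mult invertible_matrix_inv inv_inv)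
  show "matrix_inv (H z ** matrix_inv (g z)) *v y = g z *v (matrix_inv (H z) *v y)"
    "matrix_inv (Hhat z ** matrix_inv (ghat z)) *v y = ghat z *v (matrix_inv (Hhat z) *v y)"
    by (simp_all add: i1 i2 matrix_vector_mul_assoc)
  have "P z = Hhat (inverse z) ** matrix_inv (ghat (inverse z)) ** split_patching n z
      ** matrix_inv (H z ** matrix_inv (g z))" if z: "z \<noteq> 0" for z
  proof -
    let ?D = "split_patching n z"
    have Di: "matrix_inv ?D ** ?D = mat 1" using matrix_inv_mult(2)[OF split_patching_inv(2)[OF z]] .
    have gh: "ghat (inverse z) = ?D ** g z ** matrix_inv ?D" using gd z by blast
    have "ghat (inverse z) ** ?D = ?D ** g z ** (matrix_inv ?D ** ?D)"
      by (simp only: gh matrix_mul_assoc)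
    then have e: "?D ** g z = ghat (inverse z) ** ?D" by (simp add: Di)
    have "Hhat (inverse z) ** matrix_inv (ghat (inverse z)) ** ?D ** matrix_inv (H z ** matrix_inv (g z))
        = Hhat (inverse z) ** matrix_inv (ghat (inverse z)) ** (?D ** g z) ** matrix_inv (H z)"
      by (simp only: i1 matrix_mul_assoc)
    also have "\<dots> = Hhat (inverse z) ** (matrix_inv (ghat (inverse z)) ** ghat (inverse z)) ** ?D ** matrix_inv (H z)"
      by (simp only: e matrix_mul_assoc)
    also have "\<dots> = Hhat (inverse z) ** ?D ** matrix_inv (H z)"
      using matrix_inv_mult(2)[of "ghat (inverse z)"] gd by simp
    also have "\<dots> = P z" using bd z by metis
    finally show ?thesis by simp
  qed
  then show "birkhoff P n (\<lambda>z. H z ** matrix_inv (g z)) (\<lambda>z. Hhat z ** matrix_inv (ghat z))"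
    using bd gd unfolding birkhoff_def holo_matrix_eq
    by (auto intro!: holo_matrix_on_mult holo_matrix_on_inv invertible_mult invertible_matrix_inv)
qed

lemma birkhoff_cocycle:
  assumes b: "birkhoff P n H Hhat"
    and a: "\<And>i. (\<lambda>z. a z $ i) holomorphic_on UNIV" "\<And>i. (\<lambda>z. ahat z $ i) holomorphic_on UNIV"
    and eq: "\<And>z. z \<noteq> 0 \<Longrightarrow> ahat (inverse z) = P z *v a z"
  shows "(\<lambda>z. matrix_inv (H z) *v a z, \<lambda>z. matrix_inv (Hhat z) *v ahat z) \<in> cech_H0 (split_patching n)"
proof -
  note bd = b[unfolded birkhoff_def]
  have hol: "(\<lambda>z. (A z *v x z) $ i) holomorphic_on UNIV"
    if "holo_matrix A" "\<And>i. (\<lambda>z. x z $ i) holomorphic_on UNIV" for A :: "complex \<Rightarrow> complex^'a^'a" and x i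
    using that unfolding holo_matrix_def matrix_vector_mult_def by (auto intro!: holomorphic_intros)
  have hi: "holo_matrix (\<lambda>z. matrix_inv (H z))" "holo_matrix (\<lambda>z. matrix_inv (Hhat z))"
    using bd unfolding holo_matrix_eq by (auto intro!: holo_matrix_on_inv)
  have "matrix_inv (Hhat (inverse z)) *v ahat (inverse z) = split_patching n z *v (matrix_inv (H z) *v a z)"
    if z: "z \<noteq> 0" for z
  proof -
    have "P z = Hhat (inverse z) ** split_patching n z ** matrix_inv (H z)" using bd z by blast
    then have "matrix_inv (Hhat (inverse z)) *v ahat (inverse z)
      = (matrix_inv (Hhat (inverse z)) ** Hhat (inverse z)) ** split_patching n z ** matrix_inv (H z) *v a z"
      using eq[OF z] by (simp only: matrix_vector_mul_assoc matrix_mul_assoc)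
    also have "matrix_inv (Hhat (inverse z)) ** Hhat (inverse z) = mat 1"
      using bd matrix_inv_mult by blast
    finally show ?thesis by (simp add: matrix_vector_mul_assoc)
  qed
  then show ?thesis unfolding cech_H0_def using hol[OF hi(1) a(1)] hol[OF hi(2) a(2)] by simp
qed

section \<open>Holomorphic charts and tangent vectors\<close>

text \<open>The pointwise form of \<open>holo_on\<close>: the derivative is complex linear, being
  given by a matrix, and nothing is said about its continuity.\<close>

definition cdiff :: "(complex^'n \<Rightarrow> complex^'m) \<Rightarrow> complex^'n \<Rightarrow> bool" where
  "cdiff f a \<longleftrightarrow> (\<exists>A. (f has_derivative (\<lambda>h. A *v h)) (at a))"

lemma holo_on_cdiff: "holo_on f S \<longleftrightarrow> (\<forall>a\<in>S. cdiff f a)"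
  by (simp add: holo_on_def cdiff_def)

lemma jacobian_eq:
  fixes A :: "complex^'n^'m"
  assumes "(f has_derivative (\<lambda>h. A *v h)) (at a)"
  shows "jacobian f (at a) = A"
  using frechet_derivative_at[OF assms, symmetric] unfolding jacobian_def by (simp add: matrix_of_matrix_vector_mul)

lemma cdiff_has_derivative: "cdiff f a \<Longrightarrow> (f has_derivative (\<lambda>h. jacobian f (at a) *v h)) (at a)"
  unfolding cdiff_def using jacobian_eq by metis

lemma cdiff_continuous: "cdiff f a \<Longrightarrow> isCont f a"
  using cdiff_has_derivative has_derivative_continuous by blast

lemma cdiff_compose:
  assumes "cdiff f a" "cdiff g (f a)"
  shows "cdiff (g \<circ> f) a" "jacobian (g \<circ> f) (at a) = jacobian g (at (f a)) ** jacobian f (at a)"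
proof -
  have "((g \<circ> f) has_derivative (\<lambda>h. jacobian g (at (f a)) *v (jacobian f (at a) *v h))) (at a)"
    using diff_chain_at[OF cdiff_has_derivative[OF assms(1)] cdiff_has_derivative[OF assms(2)]]
    by (simp add: comp_def)
  then have d: "((g \<circ> f) has_derivative (\<lambda>h. (jacobian g (at (f a)) ** jacobian f (at a)) *v h)) (at a)"
    by (simp add: matrix_vector_mul_assoc)
  then show "cdiff (g \<circ> f) a" unfolding cdiff_def by blast
  show "jacobian (g \<circ> f) (at a) = jacobian g (at (f a)) ** jacobian f (at a)"
    using d by (rule jacobian_eq)
qed

lemma cdiff_transform:
  assumes "cdiff f a" "open S" "a \<in> S" "\<And>x. x \<in> S \<Longrightarrow> f x = g x"
  shows "cdiff g a" "jacobian g (at a) = jacobian f (at a)"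
proof -
  have d: "(g has_derivative (\<lambda>h. jacobian f (at a) *v h)) (at a)"
    using cdiff_has_derivative[OF assms(1)] assms(2-4) by (rule has_derivative_transform_within_open)
  then show "cdiff g a" unfolding cdiff_def by blast
  show "jacobian g (at a) = jacobian f (at a)" using d by (rule jacobian_eq)
qed

lemma cdiff_affine:
  fixes A :: "complex^'n^'m"
  shows "cdiff (\<lambda>x. b + A *v (x - c)) a" "jacobian (\<lambda>x. b + A *v (x - c)) (at a) = A"
proof -
  have "((\<lambda>x. A *v x) has_derivative (\<lambda>h. A *v h)) F" for F
    by (rule bounded_linear_imp_has_derivative)
      (simp add: linear_conv_bounded_linear[symmetric] linear_iff algebra_simps matrix_vector_mult_def vec_eq_iff scaleR_sum_right mult_scaleR_right sum.distrib)
  then have "((\<lambda>x. b + A *v (x - c)) has_derivative (\<lambda>h. A *v h)) (at a)"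
    by (auto intro!: derivative_eq_intros simp: algebra_simps)
  then show "cdiff (\<lambda>x. b + A *v (x - c)) a" "jacobian (\<lambda>x. b + A *v (x - c)) (at a) = A"
    by (auto simp: cdiff_def jacobian_eq)
qed

lemma cdiff_linear:
  fixes A :: "complex^'n^'m"
  shows "cdiff (\<lambda>x. A *v x) a" "jacobian (\<lambda>x. A *v x) (at a) = A"
  using cdiff_affine[of 0 A 0 a] by simp_all

text \<open>Complex manifolds enter only through the following consequence, which passes to products.\<close>

definition atlas_manifold :: "('a, 'n::finite) cmfd \<Rightarrow> bool" where
  "atlas_manifold X \<longleftrightarrow> matlas X \<subseteq> charts X \<and> (\<Union>e\<in>matlas X. fst e) = topspace (mtop X)"

lemma complex_manifold_atlas: "complex_manifold X \<Longrightarrow> atlas_manifold X"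
  by (simp add: complex_manifold_def atlas_manifold_def)

lemma atlas_manifold_matlas: "atlas_manifold X \<Longrightarrow> e \<in> matlas X \<Longrightarrow> e \<in> charts X"
  unfolding atlas_manifold_def by blast

lemma atlas_manifold_cover:
  assumes "atlas_manifold X" "p \<in> topspace (mtop X)"
  obtains e where "e \<in> matlas X" "p \<in> fst e" "e \<in> charts_at X p"
  using assms unfolding atlas_manifold_def charts_at_def by blast

lemma is_chart_props:
  assumes "is_chart T c"
  shows "openin T (fst c)" "inj_on (snd c) (fst c)" "open (snd c ` fst c)"
    "\<And>p. p \<in> fst c \<Longrightarrow> chart_inv c (snd c p) = p"
    "\<And>u. u \<in> snd c ` fst c \<Longrightarrow> snd c (chart_inv c u) = u"
    "\<And>u. u \<in> snd c ` fst c \<Longrightarrow> chart_inv c u \<in> fst c"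
    "\<And>D. openin T D \<Longrightarrow> open (snd c ` (fst c \<inter> D))"
proof -
  have h: "homeomorphic_map (subtopology T (fst c)) (top_of_set (snd c ` fst c)) (snd c)"
    and o: "openin T (fst c)" "open (snd c ` fst c)"
    using assms by (auto simp: is_chart_def)
  then show "openin T (fst c)" "open (snd c ` fst c)" by simp_all
  have ts: "topspace (subtopology T (fst c)) = fst c"
    using openin_subset[OF o(1)] by auto
  show inj: "inj_on (snd c) (fst c)"
    using homeomorphic_imp_injective_map[OF h] ts by simp
  show "\<And>p. p \<in> fst c \<Longrightarrow> chart_inv c (snd c p) = p"
    using inj by (simp add: chart_inv_def)
  show "\<And>u. u \<in> snd c ` fst c \<Longrightarrow> snd c (chart_inv c u) = u"
    by (simp add: chart_inv_def f_inv_into_f)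
  show "\<And>u. u \<in> snd c ` fst c \<Longrightarrow> chart_inv c u \<in> fst c"
    by (simp add: chart_inv_def inv_into_into)
  fix D assume "openin T D"
  then have "openin (subtopology T (fst c)) (fst c \<inter> D)"
    by (auto simp: openin_subtopology_alt)
  then have "openin (top_of_set (snd c ` fst c)) (snd c ` (fst c \<inter> D))"
    using homeomorphic_imp_open_map[OF h] by (auto simp: open_map_def)
  then show "open (snd c ` (fst c \<inter> D))" using o(2) openin_open_trans by blast
qed

lemma charts_props:
  assumes "c \<in> charts X"
  shows "openin (mtop X) (fst c)" "inj_on (snd c) (fst c)" "open (snd c ` fst c)"
    "\<And>p. p \<in> fst c \<Longrightarrow> chart_inv c (snd c p) = p"
    "\<And>u. u \<in> snd c ` fst c \<Longrightarrow> snd c (chart_inv c u) = u"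
    "\<And>u. u \<in> snd c ` fst c \<Longrightarrow> chart_inv c u \<in> fst c"
    "\<And>D. openin (mtop X) D \<Longrightarrow> open (snd c ` (fst c \<inter> D))"
  using is_chart_props[of "mtop X" c] assms by (auto simp: charts_def)

lemma chart_inv_nbhd:
  assumes "c \<in> charts X" "openin (mtop X) D" "p \<in> fst c" "p \<in> D"
  obtains V where "open V" "snd c p \<in> V" "V \<subseteq> snd c ` fst c" "\<And>u. u \<in> V \<Longrightarrow> chart_inv c u \<in> fst c \<inter> D"
proof
  show "open (snd c ` (fst c \<inter> D))" by (rule charts_props(7)[OF assms(1,2)])
  show "snd c p \<in> snd c ` (fst c \<inter> D)" using assms by blast
  show "chart_inv c u \<in> fst c \<inter> D" if "u \<in> snd c ` (fst c \<inter> D)" for u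
    using that charts_props(4)[OF assms(1)] by auto
qed auto

lemma chart_atlas_cdiff:
  assumes "c \<in> charts X" "e \<in> matlas X" "p \<in> fst c" "p \<in> fst e"
  shows "cdiff (snd e \<circ> chart_inv c) (snd c p)" "cdiff (snd c \<circ> chart_inv e) (snd e p)"
  using assms by (auto simp: charts_def compatible_def holo_on_cdiff)

lemma cdiff_change_atlas_chart:
  fixes f :: "'a \<Rightarrow> complex^'m"
  assumes X: "atlas_manifold X" and c: "c \<in> charts X" and e: "e \<in> matlas X" and p: "p \<in> fst c" "p \<in> fst e"
    and f: "cdiff (f \<circ> chart_inv e) (snd e p)"
  shows "cdiff (f \<circ> chart_inv c) (snd c p)"
    "jacobian (f \<circ> chart_inv c) (at (snd c p)) =
      jacobian (f \<circ> chart_inv e) (at (snd e p)) ** jacobian (snd e \<circ> chart_inv c) (at (snd c p))"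
proof -
  have "openin (mtop X) (fst e)" using charts_props(1)[OF atlas_manifold_matlas[OF X e]] .
  then obtain V where V: "open V" "snd c p \<in> V" "\<And>u. u \<in> V \<Longrightarrow> chart_inv c u \<in> fst c \<inter> fst e"
    using chart_inv_nbhd[OF c _ p] by metis
  have a: "(snd e \<circ> chart_inv c) (snd c p) = snd e p" using charts_props(4)[OF c p(1)] by simp
  note comp = cdiff_compose[OF chart_atlas_cdiff(1)[OF c e p], of "f \<circ> chart_inv e", unfolded a, OF f]
  have eq: "((f \<circ> chart_inv e) \<circ> (snd e \<circ> chart_inv c)) u = (f \<circ> chart_inv c) u" if "u \<in> V" for u
    using V(3)[OF that] charts_props(4)[OF atlas_manifold_matlas[OF X e]] by simp
  show "cdiff (f \<circ> chart_inv c) (snd c p)" by (rule cdiff_transform(1)[OF comp(1) V(1,2) eq])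
  show "jacobian (f \<circ> chart_inv c) (at (snd c p)) =
      jacobian (f \<circ> chart_inv e) (at (snd e p)) ** jacobian (snd e \<circ> chart_inv c) (at (snd c p))"
    by (rule trans[OF cdiff_transform(2)[OF comp(1) V(1,2) eq] comp(2)])
qed

text \<open>Membership in \<open>charts\<close> is compatibility with the atlas
  \<open>matlas\<close>. Two charts at \<open>p\<close> are therefore compared through an atlas
  chart at \<open>p\<close>.\<close>

lemma charts_compatible:
  assumes X: "atlas_manifold X" and "c \<in> charts_at X p" "d \<in> charts_at X p"
  shows "cdiff (snd d \<circ> chart_inv c) (snd c p)"
proof -
  have p: "p \<in> fst c" "p \<in> fst d" "c \<in> charts X" "d \<in> charts X" using assms by (auto simp: charts_at_def)
  have "p \<in> topspace (mtop X)" using p openin_subset[OF charts_props(1)] by blast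
  then obtain e where e: "e \<in> matlas X" "p \<in> fst e"
    by (rule atlas_manifold_cover[OF X])
  show ?thesis
    by (rule cdiff_change_atlas_chart(1)[OF X p(3) e(1) p(1) e(2) chart_atlas_cdiff(2)[OF p(4) e(1) p(2) e(2)]])
qed

lemma cdiff_change_chart:
  fixes f :: "'a \<Rightarrow> complex^'m"
  assumes X: "atlas_manifold X" and c: "c \<in> charts_at X p" and d: "d \<in> charts_at X p"
    and f: "cdiff (f \<circ> chart_inv d) (snd d p)"
  shows "cdiff (f \<circ> chart_inv c) (snd c p)"
    "jacobian (f \<circ> chart_inv c) (at (snd c p)) =
      jacobian (f \<circ> chart_inv d) (at (snd d p)) ** jacobian (snd d \<circ> chart_inv c) (at (snd c p))"
proof -
  have p: "p \<in> fst c" "p \<in> fst d" "c \<in> charts X" "d \<in> charts X" using assms by (auto simp: charts_at_def)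
  obtain V where V: "open V" "snd c p \<in> V" "\<And>u. u \<in> V \<Longrightarrow> chart_inv c u \<in> fst c \<inter> fst d"
    using chart_inv_nbhd[OF p(3) charts_props(1)[OF p(4)] p(1,2)] by metis
  have a: "(snd d \<circ> chart_inv c) (snd c p) = snd d p" using charts_props(4)[OF p(3,1)] by simp
  note comp = cdiff_compose[OF charts_compatible[OF X c d], of "f \<circ> chart_inv d", unfolded a, OF f]
  have eq: "((f \<circ> chart_inv d) \<circ> (snd d \<circ> chart_inv c)) u = (f \<circ> chart_inv c) u" if "u \<in> V" for u
    using V(3)[OF that] charts_props(4)[OF p(4)] by simp
  show "cdiff (f \<circ> chart_inv c) (snd c p)" by (rule cdiff_transform(1)[OF comp(1) V(1,2) eq])
  show "jacobian (f \<circ> chart_inv c) (at (snd c p)) =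
      jacobian (f \<circ> chart_inv d) (at (snd d p)) ** jacobian (snd d \<circ> chart_inv c) (at (snd c p))"
    by (rule trans[OF cdiff_transform(2)[OF comp(1) V(1,2) eq] comp(2)])
qed

section \<open>Tangent vectors, derivatives and normal cosets\<close>

lemma tangent_space_change:
  assumes "v \<in> tangent_space X p" "c \<in> charts_at X p" "d \<in> charts_at X p"
  shows "v d = jacobian (snd d \<circ> chart_inv c) (at (snd c p)) *v v c"
  using assms unfolding tangent_space_def by blast

lemma tangent_space_outside: "v \<in> tangent_space X p \<Longrightarrow> c \<notin> charts_at X p \<Longrightarrow> v c = 0"
  unfolding tangent_space_def by blast

lemma tangent_eqI:
  assumes "v \<in> tangent_space X p" "u \<in> tangent_space X p" "c \<in> charts_at X p" "v c = u c"
  shows "v = u"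
proof
  fix d show "v d = u d"
  proof (cases "d \<in> charts_at X p")
    case True
    then show ?thesis by (simp only: tangent_space_change[OF assms(1,3) True] tangent_space_change[OF assms(2,3) True] assms(4))
  next
    case False
    show ?thesis
      by (simp only: tangent_space_outside[OF assms(1) False] tangent_space_outside[OF assms(2) False])
  qed
qed

lemma mderiv_some_chart:
  fixes f :: "'a \<Rightarrow> complex^'m"
  assumes "v \<in> tangent_space X p" "c \<in> charts_at X p"
  obtains d where "d \<in> charts_at X p" "mderiv X f p v = jacobian (f \<circ> chart_inv d) (at (snd d p)) *v v d"
proof -
  have "(SOME c. c \<in> charts_at X p) \<in> charts_at X p" using assms(2) by (rule someI)
  then show ?thesis using that unfolding mderiv_def Let_def by blast
qed

text \<open>\<open>mderiv\<close> is computed in a chart picked by \<open>SOME\<close>. The chain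
  rule and the transformation law of \<open>v\<close> move it to any chart in which \<open>f\<close>
  is known to be differentiable.\<close>

lemma mderiv_chart:
  fixes f :: "'a \<Rightarrow> complex^'m"
  assumes X: "atlas_manifold X" and v: "v \<in> tangent_space X p" and c: "c \<in> charts_at X p"
    and f: "cdiff (f \<circ> chart_inv c) (snd c p)"
  shows "mderiv X f p v = jacobian (f \<circ> chart_inv c) (at (snd c p)) *v v c"
proof -
  obtain d where d: "d \<in> charts_at X p" "mderiv X f p v = jacobian (f \<circ> chart_inv d) (at (snd d p)) *v v d"
    by (rule mderiv_some_chart[OF v c])
  have "jacobian (f \<circ> chart_inv d) (at (snd d p)) *v v d
      = jacobian (f \<circ> chart_inv c) (at (snd c p)) *v (jacobian (snd c \<circ> chart_inv d) (at (snd d p)) *v v d)"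
    using cdiff_change_chart(2)[OF X d(1) c f] by (simp add: matrix_vector_mul_assoc)
  then show ?thesis using d(2) tangent_space_change[OF v d(1) c] by simp
qed

text \<open>The vector with components \<open>\<eta>\<close> in the chart \<open>c\<close>. By
  \<open>tangent_eqI\<close> there is no other, so evaluation at one chart identifies the tangent
  space with the coordinate space.\<close>

definition tangent_of :: "('a, 'n::finite) cmfd \<Rightarrow> 'a \<Rightarrow> ('a, 'n) chart \<Rightarrow> complex^'n \<Rightarrow> ('a, 'n) tangent" where
  "tangent_of X p c \<eta> = (\<lambda>d. if d \<in> charts_at X p then jacobian (snd d \<circ> chart_inv c) (at (snd c p)) *v \<eta> else 0)"

lemma tangent_of:
  assumes X: "atlas_manifold X" and c: "c \<in> charts_at X p"
  shows "tangent_of X p c \<eta> \<in> tangent_space X p" "tangent_of X p c \<eta> c = \<eta>"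
proof -
  show "tangent_of X p c \<eta> \<in> tangent_space X p"
    unfolding tangent_space_def mem_Collect_eq
  proof (intro conjI ballI allI impI)
    fix d e assume de: "d \<in> charts_at X p" "e \<in> charts_at X p"
    have "jacobian (snd e \<circ> chart_inv c) (at (snd c p)) =
      jacobian (snd e \<circ> chart_inv d) (at (snd d p)) ** jacobian (snd d \<circ> chart_inv c) (at (snd c p))"
      by (rule cdiff_change_chart(2)[OF X c de(1) charts_compatible[OF X de]])
    then show "tangent_of X p c \<eta> e = jacobian (snd e \<circ> chart_inv d) (at (snd d p)) *v tangent_of X p c \<eta> d"
      using de by (simp add: tangent_of_def matrix_vector_mul_assoc)
  qed (simp add: tangent_of_def)
  have p: "p \<in> fst c" "c \<in> charts X" using c by (auto simp: charts_at_def)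
  have "cdiff (\<lambda>x. x) (snd c p)" "jacobian (\<lambda>x. x) (at (snd c p)) = mat 1"
    using cdiff_linear[of "mat 1 :: complex^'b^'b" "snd c p"] by simp_all
  then have "jacobian (snd c \<circ> chart_inv c) (at (snd c p)) = mat 1"
    using cdiff_transform(2)[of "\<lambda>x. x" "snd c p" "snd c ` fst c" "snd c \<circ> chart_inv c"]
      charts_props(3,5)[OF p(2)] p(1) by auto
  then show "tangent_of X p c \<eta> c = \<eta>" using c by (simp add: tangent_of_def)
qed

lemma tangent_space_lincomb:
  assumes "u \<in> tangent_space X p" "v \<in> tangent_space X p"
  shows "lincomb a u b v \<in> tangent_space X p"
  unfolding tangent_space_def mem_Collect_eq
proof (intro conjI ballI allI impI)
  fix c d assume cd: "c \<in> charts_at X p" "d \<in> charts_at X p"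
  show "lincomb a u b v d = jacobian (snd d \<circ> chart_inv c) (at (snd c p)) *v lincomb a u b v c"
    using tangent_space_change[OF assms(1) cd] tangent_space_change[OF assms(2) cd]
    by (simp add: lincomb_def matrix_vector_right_distrib vector_scalar_commute)
qed (simp add: lincomb_def tangent_space_outside[OF assms(1)] tangent_space_outside[OF assms(2)])

lemma sub_tangent_space_lincomb:
  assumes "u \<in> sub_tangent_space X S p" "v \<in> sub_tangent_space X S p"
  shows "lincomb a u b v \<in> sub_tangent_space X S p"
  unfolding sub_tangent_space_def mem_Collect_eq
proof (intro conjI allI impI ballI)
  have uv: "u \<in> tangent_space X p" "v \<in> tangent_space X p"
    using assms unfolding sub_tangent_space_def by blast+
  show "lincomb a u b v \<in> tangent_space X p" by (rule tangent_space_lincomb[OF uv])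
  fix c J j assume "slice_chart X S p c J" "j \<in> J"
  then have "u c $ j = 0" "v c $ j = 0" using assms unfolding sub_tangent_space_def by blast+
  then show "lincomb a u b v c $ j = 0" by (simp add: lincomb_def)
qed

lemma normal_coset_eqI:
  assumes "u \<in> tangent_space X p" "v \<in> tangent_space X p" "lincomb 1 u (-1) v \<in> sub_tangent_space X S p"
  shows "normal_coset X S p u = normal_coset X S p v"
proof -
  have 1: "lincomb 1 w (-1) v = lincomb 1 (lincomb 1 w (-1) u) 1 (lincomb 1 u (-1) v)"
    and 2: "lincomb 1 w (-1) u = lincomb 1 (lincomb 1 w (-1) v) (-1) (lincomb 1 u (-1) v)" for w
    by (auto simp: lincomb_def)
  show ?thesis
    unfolding normal_coset_def
  proof (intro Collect_cong conj_cong refl iffI)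
    fix w
    show "lincomb 1 w (-1) v \<in> sub_tangent_space X S p" if "lincomb 1 w (-1) u \<in> sub_tangent_space X S p"
      unfolding 1[of w] by (rule sub_tangent_space_lincomb[OF that assms(3)])
    show "lincomb 1 w (-1) u \<in> sub_tangent_space X S p" if "lincomb 1 w (-1) v \<in> sub_tangent_space X S p"
      unfolding 2[of w] by (rule sub_tangent_space_lincomb[OF that assms(3)])
  qed
qed

text \<open>Provides charts in which a curve becomes a coordinate line: \<open>\<sigma>\<close> will
  be the shear that subtracts the curve. As \<open>\<sigma>\<close> is a bijection of the whole
  coordinate space, the domain of the chart is unchanged.\<close>

lemma charts_compose:
  assumes X: "atlas_manifold X" and c: "c \<in> charts X"
    and s: "\<And>u. cdiff \<sigma> u" "\<And>u. cdiff \<tau> u" "\<And>u. \<tau> (\<sigma> u) = u" "\<And>u. \<sigma> (\<tau> u) = u"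
  shows "(fst c, \<sigma> \<circ> snd c) \<in> charts X"
proof -
  let ?d = "(fst c, \<sigma> \<circ> snd c)"
  have cs: "continuous_on A \<sigma>" "continuous_on A \<tau>" for A
    using s(1,2) cdiff_continuous by (auto intro!: continuous_at_imp_continuous_on)
  have h: "homeomorphic_map (subtopology (mtop X) (fst c)) (top_of_set (snd c ` fst c)) (snd c)"
    using c by (auto simp: charts_def is_chart_def)
  have img: "\<sigma> ` A = \<tau> -` A" for A
  proof (intro set_eqI iffI)
    fix y assume "y \<in> \<tau> -` A"
    then have "\<sigma> (\<tau> y) \<in> \<sigma> ` A" by blast
    then show "y \<in> \<sigma> ` A" by (simp add: s(4))
  qed (auto simp: s(3))
  have inj: "inj_on (\<sigma> \<circ> snd c) (fst c)"
    by (rule comp_inj_on[OF charts_props(2)[OF c]]) (rule inj_on_inverseI[of _ \<tau>], rule s(3))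
  have inv: "chart_inv ?d v = chart_inv c (\<tau> v)" if "v \<in> (\<sigma> \<circ> snd c) ` fst c" for v
  proof -
    from that obtain p where p: "p \<in> fst c" "v = (\<sigma> \<circ> snd c) p" by blast
    then have "chart_inv ?d v = p" by (simp only: chart_inv_def fst_conv snd_conv inv_into_f_f[OF inj])
    moreover have "chart_inv c (\<tau> v) = p" using p charts_props(4)[OF c] s(3) by simp
    ultimately show ?thesis by simp
  qed
  have chart: "is_chart (mtop X) ?d"
    unfolding is_chart_def
  proof (intro conjI)
    show "openin (mtop X) (fst ?d)" using charts_props(1)[OF c] by simp
    show "open (snd ?d ` fst ?d)"
      using img[of "snd c ` fst c"] open_vimage[OF charts_props(3)[OF c] cs(2)] by (simp add: image_comp)
    have "homeomorphic_map (top_of_set (snd c ` fst c)) (top_of_set (\<sigma> ` snd c ` fst c)) \<sigma>"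
      unfolding homeomorphic_map_maps homeomorphic_maps_def
      by (intro exI[of _ \<tau>]) (auto simp: cs s(3,4))
    from homeomorphic_map_compose[OF h this]
    show "homeomorphic_map (subtopology (mtop X) (fst ?d)) (top_of_set (snd ?d ` fst ?d)) (snd ?d)"
      by (simp add: image_comp)
  qed
  have "compatible ?d e" if e: "e \<in> matlas X" for e
    unfolding compatible_def holo_on_cdiff
  proof (intro conjI ballI)
    fix v assume "v \<in> snd ?d ` (fst ?d \<inter> fst e)"
    then obtain p where p: "p \<in> fst c" "p \<in> fst e" "v = \<sigma> (snd c p)" by auto
    have 1: "cdiff ((snd e \<circ> chart_inv c) \<circ> \<tau>) v"
      using chart_atlas_cdiff(1)[OF c e p(1,2)] s(2,3) p(3) by (intro cdiff_compose) auto
    show "cdiff (snd e \<circ> chart_inv ?d) v"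
      by (rule cdiff_transform(1)[OF 1 is_chart_props(3)[OF chart]]) (use p inv in auto)
  next
    fix v assume "v \<in> snd e ` (fst ?d \<inter> fst e)"
    then obtain p where p: "p \<in> fst c" "p \<in> fst e" "v = snd e p" by auto
    show "cdiff (snd ?d \<circ> chart_inv e) v"
      using cdiff_compose(1)[OF chart_atlas_cdiff(2)[OF c e p(1,2)], of \<sigma>] s(1) p(3) by (simp add: comp_assoc)
  qed
  with chart show ?thesis by (simp add: charts_def)
qed

section \<open>Charts of the projective line\<close>

lemma openin_P1:
  "openin (mtop P1) V \<longleftrightarrow> (\<exists>U. open U \<and> V = Some ` U) \<or> (\<exists>C. compact C \<and> V = insert None (Some ` (- C)))"
  by (auto simp: P1_def openin_Alexandroff_compactification Compl_eq_Diff_UNIV compact_imp_closed)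

lemma openin_P1_Some: "open U \<Longrightarrow> openin (mtop P1) (Some ` U)"
  unfolding openin_P1 by blast

lemma openin_P1_None: "compact C \<Longrightarrow> openin (mtop P1) (insert None (Some ` (- C)))"
  unfolding openin_P1 by blast

lemma topspace_P1: "topspace (mtop P1) = UNIV"
  by (simp add: P1_def UNIV_option_conv)

text \<open>The patches of the projective line differ in the coordinate \<open>l\<close> and its
  inverse \<open>pt\<close>, so both charts come from one statement. The image of each chart is the
  whole plane, which is why \<open>pt\<close> is a total function.\<close>

lemma P1_chart:
  fixes l :: "complex option \<Rightarrow> complex" and pt :: "complex \<Rightarrow> complex option"
  assumes B: "openin (mtop P1) B" and pt: "continuous_map euclidean (mtop P1) pt"
    and l: "\<And>U. open U \<Longrightarrow> openin (mtop P1) {q \<in> B. l q \<in> U}"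
    and inv: "\<And>z. pt z \<in> B" "\<And>z. l (pt z) = z" "\<And>q. q \<in> B \<Longrightarrow> pt (l q) = q"
  shows "is_chart (mtop P1) (B, \<lambda>q. vec (l q) :: complex^1)" (is ?th1)
    "chart_inv (B, \<lambda>q. vec (l q) :: complex^1) u = pt (u $ 1)" (is ?th2)
    "(\<lambda>q. vec (l q) :: complex^1) ` B = UNIV" (is ?th3)
proof -
  let ?v = "\<lambda>q. vec (l q) :: complex^1"
  have v: "?v (pt (u $ 1)) = u" for u by (simp add: inv(2) vec_eq_iff forall_1)
  show th3: ?th3 using v inv(1) by (metis (no_types, lifting) UNIV_eq_I image_eqI)
  have "homeomorphic_maps (subtopology (mtop P1) B) (top_of_set UNIV) ?v (\<lambda>u. pt (u $ 1))"
    unfolding homeomorphic_maps_def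
  proof (intro conjI ballI)
    show "continuous_map (subtopology (mtop P1) B) (top_of_set UNIV) ?v"
      unfolding continuous_map_def
    proof (intro conjI allI impI)
      fix O' :: "(complex^1) set" assume "openin (top_of_set UNIV) O'"
      then have o: "open O'" by simp
      have "open ((\<lambda>z. vec z :: complex^1) -` O')"
        using o by (intro open_vimage) (auto simp: vec_def intro!: continuous_intros)
      from l[OF this] have "openin (mtop P1) {q \<in> B. ?v q \<in> O'}" by simp
      then show "openin (subtopology (mtop P1) B) {q \<in> topspace (subtopology (mtop P1) B). ?v q \<in> O'}"
        by (auto simp: openin_subtopology topspace_P1 intro!: exI[of _ "{q \<in> B. ?v q \<in> O'}"])
    qed auto
    have "continuous_map (top_of_set UNIV) euclidean (\<lambda>u :: complex^1. u $ 1)"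
      by (auto intro!: continuous_intros)
    from continuous_map_compose[OF this pt]
    show "continuous_map (top_of_set UNIV) (subtopology (mtop P1) B) (\<lambda>u :: complex^1. pt (u $ 1))"
      using inv(1) by (auto simp: continuous_map_in_subtopology comp_def)
  qed (use v inv(3) in \<open>auto simp: topspace_P1\<close>)
  then have "homeomorphic_map (subtopology (mtop P1) B) (top_of_set UNIV) ?v"
    using homeomorphic_map_maps by blast
  then show ?th1 unfolding is_chart_def fst_conv snd_conv th3 using B by simp
  have inj: "inj_on ?v B" using inv(3) by (intro inj_onI) (metis vec_component)
  show ?th2
    using inv_into_f_f[OF inj inv(1), of "u $ 1"] by (simp add: chart_inv_def v)
qed

lemma patchU_open: "openin (mtop P1) patchU"
proof -
  have "patchU = Some ` UNIV" by (auto simp: patchU_def notin_range_Some)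
  then show ?thesis using openin_P1_Some[of UNIV] by simp
qed

lemma patchUhat_open: "openin (mtop P1) patchUhat"
proof -
  have "patchUhat = insert None (Some ` (- {0}))"
  proof (intro set_eqI)
    fix q show "q \<in> patchUhat \<longleftrightarrow> q \<in> insert None (Some ` (- {0}))"
      by (cases q) (auto simp: patchUhat_def)
  qed
  then show ?thesis using openin_P1_None[of "{0}"] by simp
qed

lemma Some_continuous: "continuous_map euclidean (mtop P1) Some"
  unfolding continuous_map_def
proof (intro conjI allI impI)
  fix V assume "openin (mtop P1) V"
  then consider U where "open U" "V = Some ` U" | C where "compact C" "V = insert None (Some ` (- C))"
    unfolding openin_P1 by blast
  then show "openin euclidean {x \<in> topspace euclidean. Some x \<in> V}"
  proof cases
    case 1
    then have "{x. Some x \<in> V} = U" by auto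
    then show ?thesis using 1 by simp
  next
    case 2
    then have "{x. Some x \<in> V} = - C" by auto
    then show ?thesis using 2 by (simp add: open_Compl compact_imp_closed)
  qed
qed (simp add: topspace_P1)

lemma open_inverse_preimage:
  fixes U :: "complex set"
  assumes "open U"
  shows "open {z. z \<noteq> 0 \<and> inverse z \<in> U}"
proof -
  have "open (- {0} \<inter> inverse -` U)"
    using assms by (intro continuous_open_preimage) (auto intro!: continuous_intros)
  moreover have "- {0} \<inter> inverse -` U = {z. z \<noteq> 0 \<and> inverse z \<in> U}" by auto
  ultimately show ?thesis by simp
qed

lemma hatpt_continuous: "continuous_map euclidean (mtop P1) hatpt"
  unfolding continuous_map_def
proof (intro conjI allI impI)
  fix V assume "openin (mtop P1) V"
  then consider U where "open U" "V = Some ` U" | C where "compact C" "V = insert None (Some ` (- C))"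
    unfolding openin_P1 by blast
  then show "openin euclidean {x \<in> topspace euclidean. hatpt x \<in> V}"
  proof cases
    case 1
    then have "{x. hatpt x \<in> V} = {z. z \<noteq> 0 \<and> inverse z \<in> U}" by (auto simp: hatpt_def)
    then show ?thesis using open_inverse_preimage[OF 1(1)] by simp
  next
    case 2
    obtain R where R: "R > 0" "\<And>x. x \<in> C \<Longrightarrow> norm x \<le> R"
      using compact_imp_bounded[OF 2(1)] unfolding bounded_pos by blast
    \<comment> \<open>The ball makes 0 an interior point: the inverses of its nonzero points exceed
      \<open>R\<close> in norm and miss \<open>C\<close>.\<close>
    have "{x. hatpt x \<in> V} = ball 0 (1 / R) \<union> {z. z \<noteq> 0 \<and> inverse z \<in> - C}"
    proof (intro set_eqI iffI)
      fix x assume "x \<in> ball 0 (1 / R) \<union> {z. z \<noteq> 0 \<and> inverse z \<in> - C}"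
      moreover have "inverse x \<notin> C" if "x \<noteq> 0" "norm x < 1 / R"
      proof
        assume "inverse x \<in> C"
        from R(2)[OF this] that R(1) show False by (simp add: norm_inverse norm_divide field_simps)
      qed
      ultimately show "x \<in> {x. hatpt x \<in> V}" using 2(2) by (auto simp: hatpt_def)
    next
      fix x assume "x \<in> {x. hatpt x \<in> V}"
      then show "x \<in> ball 0 (1 / R) \<union> {z. z \<noteq> 0 \<and> inverse z \<in> - C}"
        using 2(2) R(1) by (cases "x = 0") (auto simp: hatpt_def)
    qed
    moreover have "open (- C)" using 2(1) by (simp add: open_Compl compact_imp_closed)
    ultimately show ?thesis using open_inverse_preimage[of "- C"] by auto
  qed
qed (simp add: topspace_P1)

text \<open>When \<open>U\<close> contains 0, it contains a ball about 0, so the points whose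
  inverse is missing from \<open>U\<close> stay bounded. Together with 0 they form a compact set,
  whose complement is a neighbourhood of infinity.\<close>

lemma patchUhat_preimage_open:
  assumes U: "open U"
  shows "openin (mtop P1) {q \<in> patchUhat. lamhat q \<in> U}"
proof (cases "0 \<in> U")
  case False
  have "{q \<in> patchUhat. lamhat q \<in> U} = Some ` {z. z \<noteq> 0 \<and> inverse z \<in> U}"
  proof (intro set_eqI)
    fix q show "q \<in> {q \<in> patchUhat. lamhat q \<in> U} \<longleftrightarrow> q \<in> Some ` {z. z \<noteq> 0 \<and> inverse z \<in> U}"
      using False by (cases q) (auto simp: patchUhat_def lamhat_def)
  qed
  then show ?thesis using openin_P1_Some[OF open_inverse_preimage[OF U]] by simp
next
  case True
  then obtain e where e: "e > 0" "ball 0 e \<subseteq> U" using U open_contains_ball by blast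
  define C where "C = - {z. z \<noteq> 0 \<and> inverse z \<in> U}"
  have "closed C" unfolding C_def using open_inverse_preimage[OF U] by (simp add: closed_Compl)
  moreover have "norm z \<le> 1 / e" if "z \<in> C" for z
  proof (cases "z = 0")
    case False
    then have "inverse z \<notin> U" using that by (simp add: C_def)
    then have "\<not> norm (inverse z) < e" using e(2) by auto
    then show ?thesis using False e(1) by (simp add: norm_inverse norm_divide field_simps)
  qed (use e(1) in simp)
  then have "bounded C" unfolding bounded_iff by blast
  ultimately have "compact C" by (simp add: compact_eq_bounded_closed)
  moreover have "{q \<in> patchUhat. lamhat q \<in> U} = insert None (Some ` (- C))"
  proof (intro set_eqI)
    fix q show "q \<in> {q \<in> patchUhat. lamhat q \<in> U} \<longleftrightarrow> q \<in> insert None (Some ` (- C))"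
      using True by (cases q) (auto simp: patchUhat_def lamhat_def C_def)
  qed
  ultimately show ?thesis using openin_P1_None by metis
qed

lemma patchU_preimage_open:
  assumes U: "open U"
  shows "openin (mtop P1) {q \<in> patchU. lam q \<in> U}"
proof -
  have "{q \<in> patchU. lam q \<in> U} = Some ` U"
  proof (intro set_eqI)
    fix q show "q \<in> {q \<in> patchU. lam q \<in> U} \<longleftrightarrow> q \<in> Some ` U"
      by (cases q) (auto simp: patchU_def lam_def)
  qed
  then show ?thesis using openin_P1_Some[OF U] by simp
qed

lemma patchU_props: "Some z \<in> patchU" "lam (Some z) = z" "q \<in> patchU \<Longrightarrow> Some (lam q) = q"
  by (auto simp: patchU_def lam_def split: option.splits)

lemma patchUhat_props: "hatpt z \<in> patchUhat" "lamhat (hatpt z) = z" "q \<in> patchUhat \<Longrightarrow> hatpt (lamhat q) = q"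
  by (auto simp: patchUhat_def lamhat_def hatpt_def split: option.splits)

lemmas patchU_chart = P1_chart[OF patchU_open Some_continuous patchU_preimage_open patchU_props]
lemmas patchUhat_chart = P1_chart[OF patchUhat_open hatpt_continuous patchUhat_preimage_open patchUhat_props]

section \<open>Curves, the charts of the projective line, and partial derivatives\<close>

lemma has_derivative_vec_lambda:
  fixes f :: "'m::finite \<Rightarrow> 'a::real_normed_vector \<Rightarrow> complex"
  assumes "\<And>i. (f i has_derivative f' i) (at a)"
  shows "((\<lambda>x. \<chi> i. f i x) has_derivative (\<lambda>h. \<chi> i. f' i h)) (at a)"
proof -
  have ax: "(\<chi> i. g i) = (\<Sum>i\<in>UNIV. axis i (g i))" for g :: "'m \<Rightarrow> complex"
    by (simp add: vec_eq_iff axis_def if_distrib cong: if_cong)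
  have bl: "bounded_linear (axis i :: complex \<Rightarrow> complex^'m)" for i
    by (simp add: linear_conv_bounded_linear[symmetric] linear_iff axis_def vec_eq_iff)
  show ?thesis unfolding ax
    by (intro has_derivative_sum bounded_linear.has_derivative[OF bl] assms)
qed

text \<open>Curves are parametrised by \<open>complex^1\<close>, the coordinate space of
  \<open>P1\<close>, while one-variable analysis is stated over \<open>complex\<close>. This lemma
  and \<open>cdiff_curveD\<close> pass between the two.\<close>

lemma cdiff_curveI:
  fixes f :: "'m::finite \<Rightarrow> complex \<Rightarrow> complex"
  assumes "\<And>i. (f i has_field_derivative D i) (at (a $ 1))"
  shows "((\<lambda>u::complex^1. \<chi> i. f i (u $ 1)) has_derivative (\<lambda>h. (\<chi> i j. D i) *v h)) (at a)"
proof -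
  have "((\<lambda>u::complex^1. f i (u $ 1)) has_derivative (\<lambda>h. D i * h $ 1)) (at a)" for i
  proof -
    have "((\<lambda>u::complex^1. u $ 1) has_derivative (\<lambda>h. h $ 1)) (at a)"
      by (rule bounded_linear_imp_has_derivative) (rule bounded_linear_vec_nth)
    from has_derivative_compose[OF this, of "f i" "\<lambda>h. D i * h"] assms[of i]
    show ?thesis by (simp add: has_field_derivative_def)
  qed
  then have "((\<lambda>u::complex^1. \<chi> i. f i (u $ 1)) has_derivative (\<lambda>h. \<chi> i. D i * h $ 1)) (at a)"
    by (rule has_derivative_vec_lambda)
  moreover have "(\<lambda>h. \<chi> i. D i * h $ 1) = (\<lambda>h::complex^1. (\<chi> i j. D i) *v h)"
    by (auto simp: vec_eq_iff matrix_vector_mult_def sum_1 UNIV_1)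
  ultimately show ?thesis by simp
qed

lemma cdiff_curveD:
  fixes g :: "complex^1 \<Rightarrow> complex^'m"
  assumes "cdiff g (vec z)"
  shows "((\<lambda>z. g (vec z) $ i) has_field_derivative jacobian g (at (vec z)) $ i $ 1) (at z)"
proof -
  have "((\<lambda>z. vec z :: complex^1) has_derivative (\<lambda>h. vec h)) (at z)"
    unfolding vec_def by (intro has_derivative_vec_lambda has_derivative_ident)
  from has_derivative_compose[OF this cdiff_has_derivative[OF assms]]
  have "((\<lambda>z. g (vec z)) has_derivative (\<lambda>h. jacobian g (at (vec z)) *v vec h)) (at z)" .
  from has_derivative_compose[OF this bounded_linear_imp_has_derivative[OF bounded_linear_vec_nth]]
  have "((\<lambda>z. g (vec z) $ i) has_derivative (\<lambda>h. (jacobian g (at (vec z)) *v vec h) $ i)) (at z)" .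
  moreover have "(\<lambda>h. (jacobian g (at (vec z)) *v vec h) $ i) = (\<lambda>h. jacobian g (at (vec z)) $ i $ 1 * h)"
    by (auto simp: matrix_vector_mult_def UNIV_1)
  ultimately show ?thesis by (simp add: has_field_derivative_def)
qed

text \<open>Membership in \<open>charts\<close> asks for compatibility with both atlas charts, each
  in both directions; hence four transition functions.\<close>

lemma P1_charts_aux:
  assumes c: "is_chart (mtop P1) (B, \<lambda>q. vec (l q) :: complex^1)"
    "\<And>u. chart_inv (B, \<lambda>q. vec (l q) :: complex^1) u = pt (u $ 1)"
    and tr: "\<And>z. pt z \<in> patchU \<Longrightarrow> (\<lambda>z. lam (pt z)) field_differentiable at z"
      "\<And>z. pt z \<in> patchUhat \<Longrightarrow> (\<lambda>z. lamhat (pt z)) field_differentiable at z"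
      "\<And>z. Some z \<in> B \<Longrightarrow> (\<lambda>z. l (Some z)) field_differentiable at z"
      "\<And>z. hatpt z \<in> B \<Longrightarrow> (\<lambda>z. l (hatpt z)) field_differentiable at z"
    and inv: "\<And>q. q \<in> B \<Longrightarrow> pt (l q) = q"
  shows "(B, \<lambda>q. vec (l q) :: complex^1) \<in> charts P1"
proof -
  have cd: "cdiff (\<lambda>u::complex^1. vec (f (u $ 1)) :: complex^1) a" if "f field_differentiable at (a $ 1)"
    for f and a :: "complex^1"
  proof -
    from that obtain D where "(f has_field_derivative D) (at (a $ 1))"
      unfolding field_differentiable_def by blast
    from cdiff_curveI[of "\<lambda>_. f" "\<lambda>_. D" a, OF this] show ?thesis unfolding cdiff_def vec_def by blast
  qed
  have comp: "compatible (B1, \<lambda>q. vec (l1 q) :: complex^1) (B2, \<lambda>q. vec (l2 q) :: complex^1)"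
    if i1: "\<And>u. chart_inv (B1, \<lambda>q. vec (l1 q) :: complex^1) u = pt1 (u $ 1)"
      and i2: "\<And>u. chart_inv (B2, \<lambda>q. vec (l2 q) :: complex^1) u = pt2 (u $ 1)"
      and t1: "\<And>z. pt1 z \<in> B2 \<Longrightarrow> (\<lambda>z. l2 (pt1 z)) field_differentiable at z"
      and t2: "\<And>z. pt2 z \<in> B1 \<Longrightarrow> (\<lambda>z. l1 (pt2 z)) field_differentiable at z"
      and p1: "\<And>q. q \<in> B1 \<Longrightarrow> pt1 (l1 q) = q" and p2: "\<And>q. q \<in> B2 \<Longrightarrow> pt2 (l2 q) = q"
    for B1 B2 l1 l2 pt1 pt2
    unfolding compatible_def holo_on_cdiff comp_def i1 i2 snd_conv fst_conv
    using cd[of "\<lambda>z. l2 (pt1 z)"] cd[of "\<lambda>z. l1 (pt2 z)"] t1 t2 p1 p2 by auto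
  show ?thesis
    unfolding charts_def
    using c(1) comp[OF c(2) patchU_chart(2) tr(1,3) inv patchU_props(3)]
      comp[OF c(2) patchUhat_chart(2) tr(2,4) inv patchUhat_props(3)]
    by (simp add: P1_def)
qed

lemma patchU_in_charts: "(patchU, \<lambda>q. vec (lam q) :: complex^1) \<in> charts P1"
proof (rule P1_charts_aux[OF patchU_chart(1,2)])
  show "(\<lambda>z. lamhat (Some z)) field_differentiable at z" if "Some z \<in> patchUhat" for z
    using that by (auto simp: lamhat_def patchUhat_def intro!: derivative_intros)
  show "(\<lambda>z. lam (hatpt z)) field_differentiable at z" if "hatpt z \<in> patchU" for z
  proof -
    have "z \<noteq> 0" using that by (auto simp: hatpt_def patchU_def)
    moreover have "(\<lambda>z. lam (hatpt z)) = inverse" by (auto simp: lam_def hatpt_def)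
    ultimately show ?thesis by (auto intro!: derivative_intros)
  qed
qed (auto simp: patchU_props intro!: derivative_intros)

lemma patchUhat_in_charts: "(patchUhat, \<lambda>q. vec (lamhat q) :: complex^1) \<in> charts P1"
proof (rule P1_charts_aux[OF patchUhat_chart(1,2)])
  show "(\<lambda>z. lamhat (Some z)) field_differentiable at z" if "Some z \<in> patchUhat" for z
    using that by (auto simp: lamhat_def patchUhat_def intro!: derivative_intros)
  show "(\<lambda>z. lam (hatpt z)) field_differentiable at z" if "hatpt z \<in> patchU" for z
  proof -
    have "z \<noteq> 0" using that by (auto simp: hatpt_def patchU_def)
    moreover have "(\<lambda>z. lam (hatpt z)) = inverse" by (auto simp: lam_def hatpt_def)
    ultimately show ?thesis by (auto intro!: derivative_intros)
  qed
qed (auto simp: patchUhat_props intro!: derivative_intros)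

text \<open>Cauchy's inequality for the second derivative on discs of radius \<open>r / 2\<close>
  gives \<open>fact 2 * B / (r/2) ^ 2\<close>, which is \<open>8 * B / r ^ 2\<close>. Taylor's
  formula of first order, divided by \<open>t\<close>, then yields the rate.\<close>

lemma difference_quotient_bound:
  assumes f: "f holomorphic_on ball 0 r" "continuous_on (cball 0 r) f" and r: "r > 0"
    and B: "\<And>t. norm t \<le> r \<Longrightarrow> norm (f t) \<le> B" and t: "t \<noteq> 0" "norm t < r / 2"
  shows "norm ((f t - f 0) / t - deriv f 0) \<le> 8 * B / r ^ 2 * norm t"
proof -
  have B0: "B \<ge> 0" using order_trans[OF norm_ge_zero B[of 0]] r by simp
  have 2: "norm ((deriv ^^ 2) f x) \<le> 8 * B / r ^ 2" if "x \<in> ball 0 (r/2)" for x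
  proof -
    have sub: "cball x (r/2) \<subseteq> cball 0 r" "ball x (r/2) \<subseteq> ball 0 r"
      using that by (simp_all add: cball_subset_cball_iff ball_subset_ball_iff)
    have "norm ((deriv ^^ 2) f x) \<le> fact 2 * B / (r/2) ^ 2"
    proof (rule Cauchy_inequality)
      show "f holomorphic_on ball x (r/2)" using f(1) sub(2) holomorphic_on_subset by blast
      show "continuous_on (cball x (r/2)) f" using f(2) sub(1) continuous_on_subset by blast
      show "norm (f y) \<le> B" if "norm (x - y) = r/2" for y
        using sub(1) that B[of y] by (auto simp: dist_norm subset_iff)
    qed (use r in simp)
    also have "\<dots> = 8 * B / r ^ 2" using r by (simp add: power2_eq_square field_simps fact_2)
    finally show ?thesis .
  qed
  define F where "F = (\<lambda>i. (deriv ^^ i) f)"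
  have F: "(F i has_field_derivative F (Suc i) x) (at x within ball 0 (r/2))" if "x \<in> ball 0 (r/2)" for i x
  proof -
    have "F i holomorphic_on ball 0 r" unfolding F_def by (rule holomorphic_higher_deriv[OF f(1) open_ball])
    moreover have "x \<in> ball 0 r" using that r by simp
    ultimately show ?thesis
      using holomorphic_derivI[of "F i" "ball 0 r" x] by (simp add: F_def)
  qed
  have "norm (F 0 t - (\<Sum>i\<le>1. F i 0 * (t - 0) ^ i / fact i)) \<le> 8 * B / r ^ 2 * norm (t - 0) ^ Suc 1 / fact 1"
    by (rule field_Taylor[where S = "ball 0 (r/2)"]) (use F 2 r t in \<open>auto simp: F_def numeral_2_eq_2\<close>)
  then have "norm (f t - f 0 - deriv f 0 * t) \<le> 8 * B / r ^ 2 * norm t ^ 2"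
    by (simp add: F_def power2_eq_square algebra_simps)
  then have "norm (f t - f 0 - deriv f 0 * t) / norm t \<le> 8 * B / r ^ 2 * norm t ^ 2 / norm t"
    by (rule divide_right_mono) simp
  moreover have "(f t - f 0) / t - deriv f 0 = (f t - f 0 - deriv f 0 * t) / t"
    using t(1) by (simp add: field_simps)
  ultimately show ?thesis using t(1) by (simp add: norm_divide power2_eq_square)
qed

text \<open>Osgood's lemma: the partial derivative is a locally uniform limit of difference quotients.\<close>

lemma partial_derivative_holomorphic:
  fixes h :: "complex \<Rightarrow> complex \<Rightarrow> complex"
  assumes S: "open S" and cont: "continuous_on S (\<lambda>(t, z). h t z)"
    and ht: "\<And>t z. (t, z) \<in> S \<Longrightarrow> (\<lambda>t. h t z) field_differentiable at t"
    and hz: "\<And>t z. (t, z) \<in> S \<Longrightarrow> h t field_differentiable at z"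
    and z0: "(0, z0) \<in> S"
  shows "(\<lambda>z. deriv (\<lambda>t. h t z) 0) field_differentiable at z0"
proof -
  obtain A C where AC: "open A" "open C" "0 \<in> A" "z0 \<in> C" "A \<times> C \<subseteq> S"
    using S z0 by (rule open_prod_elim) auto
  obtain r1 where r1: "r1 > 0" "cball 0 r1 \<subseteq> A" using AC(1,3) open_contains_cball by blast
  obtain r2 where r2: "r2 > 0" "cball z0 r2 \<subseteq> C" using AC(2,4) open_contains_cball by blast
  have sub: "(t, z) \<in> S" if "norm t \<le> r1" "z \<in> cball z0 r2" for t z
  proof -
    have "t \<in> A" "z \<in> C" using that r1(2) r2(2) by (auto simp: subset_iff)
    then show ?thesis using AC(5) by blast
  qed
  have "compact (cball (0::complex) r1 \<times> cball z0 r2)" by (intro compact_Times) auto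
  moreover have "continuous_on (cball (0::complex) r1 \<times> cball z0 r2) (\<lambda>(t, z). h t z)"
    by (rule continuous_on_subset[OF cont]) (use sub in auto)
  ultimately have "bounded ((\<lambda>(t, z). h t z) ` (cball 0 r1 \<times> cball z0 r2))"
    by (intro compact_imp_bounded compact_continuous_image)
  then obtain B where "\<forall>y\<in>cball 0 r1 \<times> cball z0 r2. norm (case y of (t, z) \<Rightarrow> h t z) \<le> B"
    unfolding bounded_iff by auto
  then have B: "norm (h t z) \<le> B" if "norm t \<le> r1" "z \<in> cball z0 r2" for t z
    using that by auto
  \<comment> \<open>A null sequence inside \<open>r1 / 2\<close>, where the difference quotients are
    estimated with a constant that does not depend on \<open>z\<close>.\<close>
  define \<delta> where "\<delta> = (\<lambda>n. of_real (r1 / 4 / real (Suc n)) :: complex)"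
  have \<delta>: "\<delta> n \<noteq> 0" "norm (\<delta> n) < r1 / 2" "norm (\<delta> n) = r1 / 4 / real (Suc n)" for n
  proof -
    show n: "norm (\<delta> n) = r1 / 4 / real (Suc n)" using r1(1) by (simp only: \<delta>_def norm_of_real) simp
    show "norm (\<delta> n) < r1 / 2" unfolding n using r1(1) by (simp add: divide_less_eq)
    have "norm (\<delta> n) > 0" unfolding n using r1(1) by simp
    then show "\<delta> n \<noteq> 0" by auto
  qed
  define q where "q = (\<lambda>n z. (h (\<delta> n) z - h 0 z) / \<delta> n)"
  have qh: "q n holomorphic_on ball z0 r2" for n
  proof -
    have "h t holomorphic_on ball z0 r2" if "norm t \<le> r1" for t
      unfolding holomorphic_on_def
    proof
      fix x assume "x \<in> ball z0 r2"
      then have "(t, x) \<in> S" using sub that by simp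
      from field_differentiable_at_within[OF hz[OF this]]
      show "h t field_differentiable at x within ball z0 r2" .
    qed
    moreover have "norm (\<delta> n) \<le> r1" using \<delta>(2)[of n] r1(1) by linarith
    ultimately show ?thesis unfolding q_def using r1(1) \<delta>(1) by (intro holomorphic_intros) auto
  qed
  have qb: "norm (q n z - deriv (\<lambda>t. h t z) 0) \<le> 8 * B / r1 ^ 2 * (r1 / 4 / real (Suc n))"
    if z: "z \<in> cball z0 r2" for n z
    unfolding q_def \<delta>(3)[symmetric]
  proof (rule difference_quotient_bound[of "\<lambda>t. h t z"])
    have fd: "(\<lambda>t. h t z) field_differentiable at t" if "norm t \<le> r1" for t by (rule ht) (rule sub[OF that z])
    show "(\<lambda>t. h t z) holomorphic_on ball 0 r1"
      unfolding holomorphic_on_def using field_differentiable_at_within[OF fd] by simp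
    show "continuous_on (cball 0 r1) (\<lambda>t. h t z)"
      using field_differentiable_imp_continuous_at[OF fd]
      by (intro continuous_at_imp_continuous_on) simp
  qed (use r1 \<delta> B z in auto)
  have lim: "(\<lambda>n. 8 * B / r1 ^ 2 * (r1 / 4 / real (Suc n))) \<longlonglongrightarrow> 0"
    by (rule tendsto_mult_right_zero) (rule LIMSEQ_Suc[OF lim_const_over_n])
  have "uniform_limit (cball z0 r2) q (\<lambda>z. deriv (\<lambda>t. h t z) 0) sequentially"
  proof (rule uniform_limitI)
    fix e :: real assume "e > 0"
    from order_tendstoD(2)[OF lim this]
    show "\<forall>\<^sub>F n in sequentially. \<forall>z\<in>cball z0 r2. dist (q n z) (deriv (\<lambda>t. h t z) 0) < e"
    proof (rule eventually_mono)
      fix n assume n: "8 * B / r1 ^ 2 * (r1 / 4 / real (Suc n)) < e"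
      show "\<forall>z\<in>cball z0 r2. dist (q n z) (deriv (\<lambda>t. h t z) 0) < e"
      proof
        fix z assume "z \<in> cball z0 r2"
        from order_le_less_trans[OF qb[OF this] n] show "dist (q n z) (deriv (\<lambda>t. h t z) 0) < e"
          by (simp add: dist_norm)
      qed
    qed
  qed
  then have ul: "uniform_limit (cball x d) q (\<lambda>z. deriv (\<lambda>t. h t z) 0) sequentially"
    if "cball x d \<subseteq> cball z0 r2" for x d using that uniform_limit_on_subset by blast
  have "(\<lambda>z. deriv (\<lambda>t. h t z) 0) holomorphic_on ball z0 r2"
  proof (rule holomorphic_uniform_sequence[OF open_ball qh])
    fix x assume "x \<in> ball z0 r2"
    from open_contains_cball[THEN iffD1, rule_format, OF open_ball this]
    obtain d where "d > 0" "cball x d \<subseteq> ball z0 r2" by blast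
    moreover from this have "cball x d \<subseteq> cball z0 r2" using ball_subset_cball by blast
    ultimately show "\<exists>d>0. cball x d \<subseteq> ball z0 r2 \<and>
        uniform_limit (cball x d) q (\<lambda>z. deriv (\<lambda>t. h t z) 0) sequentially"
      using ul by blast
  qed
  then show ?thesis using r2(1) by (auto intro: holomorphic_on_imp_differentiable_at)
qed

section \<open>Products of manifolds\<close>

definition join :: "complex^'n \<Rightarrow> complex^'m \<Rightarrow> complex^('n + 'm)" where
  "join u v = (\<chi> i. case i of Inl a \<Rightarrow> u $ a | Inr b \<Rightarrow> v $ b)"

definition joinl :: "complex^('n::finite + 'm::finite) \<Rightarrow> complex^'n" where
  "joinl u = (\<chi> a. u $ Inl a)"

definition joinr :: "complex^('n::finite + 'm::finite) \<Rightarrow> complex^'m" where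
  "joinr u = (\<chi> b. u $ Inr b)"

lemma join_simps [simp]: "joinl (join u v) = u" "joinr (join u v) = v" "join (joinl x) (joinr x) = x"
  by (auto simp: join_def joinl_def joinr_def vec_eq_iff split: sum.split)

definition matl :: "complex^('n::finite + 'm::finite)^'n" where
  "matl = (\<chi> i j. if j = Inl i then 1 else 0)"

definition matr :: "complex^('n::finite + 'm::finite)^'m" where
  "matr = (\<chi> i j. if j = Inr i then 1 else 0)"

lemma matl_mult: "matl *v u = joinl u" and matr_mult: "matr *v u = joinr u"
  by (simp_all add: matl_def matr_def joinl_def joinr_def matrix_vector_mult_def vec_eq_iff
      if_distrib if_distribR cong: if_cong)

lemma cdiff_joinl: "cdiff joinl a" and cdiff_joinr: "cdiff joinr a"
  using cdiff_linear(1)[of matl a] cdiff_linear(1)[of matr a] by (simp_all add: matl_mult matr_mult)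

lemma cdiff_vec_lambda:
  fixes f :: "complex^'a \<Rightarrow> complex^'m"
  assumes "\<And>i. \<exists>r. ((\<lambda>x. f x $ i) has_derivative (\<lambda>h. \<Sum>j\<in>UNIV. r j * h $ j)) (at a)"
  shows "cdiff f a"
proof -
  obtain r where r: "\<And>i. ((\<lambda>x. f x $ i) has_derivative (\<lambda>h. \<Sum>j\<in>UNIV. r i j * h $ j)) (at a)"
    using assms by metis
  from has_derivative_vec_lambda[of "\<lambda>i x. f x $ i", OF r]
  have "(f has_derivative (\<lambda>h. (\<chi> i j. r i j) *v h)) (at a)"
    by (simp add: matrix_vector_mult_def)
  then show ?thesis unfolding cdiff_def by blast
qed

lemma cdiff_component:
  assumes "cdiff f a"
  shows "\<exists>r. ((\<lambda>x. f x $ i) has_derivative (\<lambda>h. \<Sum>j\<in>UNIV. r j * h $ j)) (at a)"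
proof -
  from has_derivative_compose[OF cdiff_has_derivative[OF assms]
      bounded_linear_imp_has_derivative[OF bounded_linear_vec_nth]]
  have "((\<lambda>x. f x $ i) has_derivative (\<lambda>h. (jacobian f (at a) *v h) $ i)) (at a)" .
  then show ?thesis unfolding matrix_vector_mult_def vec_lambda_beta by blast
qed

lemma cdiff_join:
  fixes f :: "complex^'a \<Rightarrow> complex^'n" and g :: "complex^'a \<Rightarrow> complex^'m"
  assumes "cdiff f a" "cdiff g a"
  shows "cdiff (\<lambda>x. join (f x) (g x)) a"
proof (rule cdiff_vec_lambda)
  fix i :: "'n + 'm"
  show "\<exists>r. ((\<lambda>x. join (f x) (g x) $ i) has_derivative (\<lambda>h. \<Sum>j\<in>UNIV. r j * h $ j)) (at a)"
    using cdiff_component[OF assms(1)] cdiff_component[OF assms(2)] by (cases i) (simp_all add: join_def)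
qed

lemma cdiff_const: "cdiff (\<lambda>_. c) a"
  using cdiff_affine(1)[of c "0 :: complex^'a^'b" 0 a] by simp

definition prod_chart :: "('a, 'n::finite) chart \<Rightarrow> ('b, 'm::finite) chart \<Rightarrow> ('a \<times> 'b, 'n + 'm) chart" where
  "prod_chart c d = (fst c \<times> fst d, \<lambda>q. join (snd c (fst q)) (snd d (snd q)))"

lemma matlas_prod: "matlas (prod_mfd X Y) = {prod_chart c d |c d. c \<in> matlas X \<and> d \<in> matlas Y}"
  by (simp add: prod_mfd_def prod_chart_def join_def)

lemma prod_chart_matlas:
  "c \<in> matlas X \<Longrightarrow> d \<in> matlas Y \<Longrightarrow> prod_chart c d \<in> matlas (prod_mfd X Y)"
  unfolding matlas_prod by blast

lemma mem_prod_chart: "q \<in> fst (prod_chart c d) \<longleftrightarrow> fst q \<in> fst c \<and> snd q \<in> fst d"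
  by (simp add: prod_chart_def mem_Times_iff)

lemma prod_chart_image:
  "snd (prod_chart c d) ` (A \<times> C) = {u. joinl u \<in> snd c ` A \<and> joinr u \<in> snd d ` C}"
proof (intro set_eqI iffI)
  fix u assume "u \<in> {u. joinl u \<in> snd c ` A \<and> joinr u \<in> snd d ` C}"
  then obtain p q where "p \<in> A" "q \<in> C" "joinl u = snd c p" "joinr u = snd d q" by blast
  moreover from this have "u = join (snd c p) (snd d q)" by (metis join_simps(3))
  ultimately show "u \<in> snd (prod_chart c d) ` (A \<times> C)"
    unfolding prod_chart_def by force
qed (auto simp: prod_chart_def)

lemma open_join:
  assumes "open A" "open C"
  shows "open {u. joinl u \<in> A \<and> joinr u \<in> C}"
proof -
  have "continuous_on UNIV joinl" "continuous_on UNIV joinr"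
    using cdiff_joinl cdiff_joinr cdiff_continuous by (auto intro!: continuous_at_imp_continuous_on)
  then have "open (joinl -` A \<inter> joinr -` C)"
    using assms by (intro open_Int open_vimage)
  then show ?thesis by (simp add: vimage_def Int_def)
qed

lemma prod_chart_is_chart:
  fixes c :: "('a, 'n::finite) chart" and d :: "('b, 'm::finite) chart"
  assumes c: "is_chart S c" and d: "is_chart T d"
  shows "is_chart (prod_topology S T) (prod_chart c d)"
proof -
  note pc = is_chart_props[OF c] and pd = is_chart_props[OF d]
  have img: "snd (prod_chart c d) ` fst (prod_chart c d)
      = {u. joinl u \<in> snd c ` fst c \<and> joinr u \<in> snd d ` fst d}"
    using prod_chart_image[of c d "fst c" "fst d"] by (simp add: prod_chart_def)
  have o: "open (snd (prod_chart c d) ` fst (prod_chart c d))"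
    unfolding img by (rule open_join[OF pc(3) pd(3)])
  from c d obtain c' d' where
    "homeomorphic_maps (subtopology S (fst c)) (top_of_set (snd c ` fst c)) (snd c) c'"
    "homeomorphic_maps (subtopology T (fst d)) (top_of_set (snd d ` fst d)) (snd d) d'"
    unfolding is_chart_def homeomorphic_map_maps by blast
  then have "homeomorphic_maps (prod_topology (subtopology S (fst c)) (subtopology T (fst d)))
      (prod_topology (top_of_set (snd c ` fst c)) (top_of_set (snd d ` fst d)))
      (\<lambda>(x, y). (snd c x, snd d y)) (\<lambda>(x, y). (c' x, d' y))"
    unfolding homeomorphic_maps_prod by simp
  then have h: "homeomorphic_map (subtopology (prod_topology S T) (fst c \<times> fst d))
      (top_of_set (snd c ` fst c \<times> snd d ` fst d)) (\<lambda>(x, y). (snd c x, snd d y))"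
    unfolding homeomorphic_map_maps subtopology_Times prod_topology_subtopology_eu by blast
  have ct: "continuous_on A (\<lambda>(u, v). join u v)" for A :: "((complex^'n) \<times> (complex^'m)) set"
    unfolding join_def case_prod_beta
  proof (rule continuous_on_vec_lambda)
    fix i :: "'n + 'm"
    show "continuous_on A (\<lambda>x. case i of Inl a \<Rightarrow> fst x $ a | Inr b \<Rightarrow> snd x $ b)"
      by (cases i) (auto intro!: continuous_intros)
  qed
  have ct2: "continuous_on A (\<lambda>u. (joinl u, joinr u))" for A :: "(complex^('n + 'm)) set"
    by (intro continuous_on_Pair continuous_at_imp_continuous_on ballI
        cdiff_continuous[OF cdiff_joinl] cdiff_continuous[OF cdiff_joinr])
  have "homeomorphic_map (top_of_set (snd c ` fst c \<times> snd d ` fst d))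
      (top_of_set {u. joinl u \<in> snd c ` fst c \<and> joinr u \<in> snd d ` fst d}) (\<lambda>(u, v). join u v)"
    unfolding homeomorphic_map_maps homeomorphic_maps_def
    by (intro exI[of _ "\<lambda>u. (joinl u, joinr u)"]) (auto simp: ct ct2)
  from homeomorphic_map_compose[OF h this]
  have "homeomorphic_map (subtopology (prod_topology S T) (fst (prod_chart c d)))
      (top_of_set (snd (prod_chart c d) ` fst (prod_chart c d))) (snd (prod_chart c d))"
    unfolding img by (simp add: prod_chart_def comp_def case_prod_beta)
  moreover have "openin (prod_topology S T) (fst (prod_chart c d))"
    using pc(1) pd(1) by (simp add: prod_chart_def openin_prod_Times_iff)
  ultimately show ?thesis unfolding is_chart_def using o by blast
qed

lemma prod_chart_inv:
  assumes c: "is_chart S c" and d: "is_chart T d"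
    and u: "joinl u \<in> snd c ` fst c" "joinr u \<in> snd d ` fst d"
  shows "chart_inv (prod_chart c d) u = (chart_inv c (joinl u), chart_inv d (joinr u))"
proof -
  note pc = is_chart_props[OF c] and pd = is_chart_props[OF d]
  let ?q = "(chart_inv c (joinl u), chart_inv d (joinr u))"
  have "?q \<in> fst (prod_chart c d)" using pc(6)[OF u(1)] pd(6)[OF u(2)] by (simp add: prod_chart_def)
  moreover have "snd (prod_chart c d) ?q = u" using pc(5)[OF u(1)] pd(5)[OF u(2)] by (simp add: prod_chart_def)
  ultimately show ?thesis using is_chart_props(4)[OF prod_chart_is_chart[OF c d], of ?q] by simp
qed

lemma prod_chart_compatible:
  assumes c: "is_chart S c" "is_chart S c'" "compatible c c'" and d: "is_chart T d" "is_chart T d'" "compatible d d'"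
  shows "compatible (prod_chart c d) (prod_chart c' d')"
proof -
  have one: "cdiff (snd (prod_chart c' d') \<circ> chart_inv (prod_chart c d)) u"
    if c: "is_chart S c" "is_chart S c'" "compatible c c'" and d: "is_chart T d" "is_chart T d'" "compatible d d'"
      and u: "u \<in> snd (prod_chart c d) ` (fst (prod_chart c d) \<inter> fst (prod_chart c' d'))"
    for c c' :: "('a, 'b) chart" and d d' :: "('c, 'd) chart" and u
  proof -
    have "fst (prod_chart c d) \<inter> fst (prod_chart c' d') = (fst c \<inter> fst c') \<times> (fst d \<inter> fst d')"
      by (auto simp: prod_chart_def)
    then have u': "joinl u \<in> snd c ` (fst c \<inter> fst c')" "joinr u \<in> snd d ` (fst d \<inter> fst d')"
      using u prod_chart_image[of c d "fst c \<inter> fst c'" "fst d \<inter> fst d'"] by auto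
    have "cdiff (snd c' \<circ> chart_inv c) (joinl u)" "cdiff (snd d' \<circ> chart_inv d) (joinr u)"
      using c(3) d(3) u' by (auto simp: compatible_def holo_on_cdiff)
    then have "cdiff (\<lambda>u. join (((snd c' \<circ> chart_inv c) \<circ> joinl) u) (((snd d' \<circ> chart_inv d) \<circ> joinr) u)) u"
      by (intro cdiff_join cdiff_compose(1) cdiff_joinl cdiff_joinr)
    moreover have "open {u. joinl u \<in> snd c ` fst c \<and> joinr u \<in> snd d ` fst d}"
      by (rule open_join[OF is_chart_props(3)[OF c(1)] is_chart_props(3)[OF d(1)]])
    ultimately show ?thesis
      by (rule cdiff_transform(1)) (use u' prod_chart_inv[OF c(1) d(1)] in \<open>auto simp: prod_chart_def\<close>)
  qed
  have sym: "compatible c' c" "compatible d' d" using c(3) d(3) by (simp_all add: compatible_def Int_commute)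
  show ?thesis
    unfolding compatible_def holo_on_cdiff
    using one[OF c d] one[OF c(2,1) sym(1) d(2,1) sym(2)] by (auto simp: Int_commute)
qed

lemma prod_atlas_manifold:
  assumes X: "atlas_manifold X" and Y: "atlas_manifold Y"
  shows "atlas_manifold (prod_mfd X Y)"
proof -
  have top: "mtop (prod_mfd X Y) = prod_topology (mtop X) (mtop Y)" by (simp add: prod_mfd_def)
  have ch: "is_chart (mtop X) c" if "c \<in> matlas X" for c
    using atlas_manifold_matlas[OF X that] by (simp add: charts_def)
  have dh: "is_chart (mtop Y) d" if "d \<in> matlas Y" for d
    using atlas_manifold_matlas[OF Y that] by (simp add: charts_def)
  have cc: "compatible c c'" if "c \<in> matlas X" "c' \<in> matlas X" for c c'
    using atlas_manifold_matlas[OF X that(1)] that(2) by (simp add: charts_def)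
  have dd: "compatible d d'" if "d \<in> matlas Y" "d' \<in> matlas Y" for d d'
    using atlas_manifold_matlas[OF Y that(1)] that(2) by (simp add: charts_def)
  have "prod_chart c d \<in> charts (prod_mfd X Y)" if "c \<in> matlas X" "d \<in> matlas Y" for c d
    unfolding charts_def mem_Collect_eq matlas_prod top
    using prod_chart_is_chart[OF ch[OF that(1)] dh[OF that(2)]]
      prod_chart_compatible[OF ch[OF that(1)] ch cc[OF that(1)] dh[OF that(2)] dh dd[OF that(2)]] by blast
  moreover have "(\<Union>e\<in>matlas (prod_mfd X Y). fst e) = topspace (mtop X) \<times> topspace (mtop Y)"
  proof -
    have "(\<Union>e\<in>matlas (prod_mfd X Y). fst e) = (\<Union>c\<in>matlas X. fst c) \<times> (\<Union>d\<in>matlas Y. fst d)"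
      unfolding matlas_prod by (auto simp: prod_chart_def) blast
    then show ?thesis using X Y by (simp add: atlas_manifold_def)
  qed
  ultimately show ?thesis unfolding atlas_manifold_def top by (auto simp: matlas_prod)
qed

text \<open>A chart of the product need not be a product of charts. The function is read in a
  product of atlas charts, where it depends on one block of coordinates, and then carried over to
  \<open>c\<close>.\<close>

lemma prod_cdiff:
  fixes f :: "'a \<Rightarrow> complex^'n" and g :: "'b \<Rightarrow> complex^'m"
  assumes X: "atlas_manifold X" and Y: "atlas_manifold Y"
    and c: "c \<in> charts_at (prod_mfd X Y) (p, q)"
  shows "d \<in> charts_at X p \<Longrightarrow> cdiff (f \<circ> chart_inv d) (snd d p) \<Longrightarrow> cdiff ((f \<circ> fst) \<circ> chart_inv c) (snd c (p, q))"
    "d' \<in> charts_at Y q \<Longrightarrow> cdiff (g \<circ> chart_inv d') (snd d' q) \<Longrightarrow> cdiff ((g \<circ> snd) \<circ> chart_inv c) (snd c (p, q))"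
proof -
  have c': "c \<in> charts (prod_mfd X Y)" "(p, q) \<in> fst c" using c by (auto simp: charts_at_def)
  have "(p, q) \<in> topspace (mtop (prod_mfd X Y))"
    using c' openin_subset[OF charts_props(1)] by blast
  then have tp: "p \<in> topspace (mtop X)" "q \<in> topspace (mtop Y)" by (auto simp: prod_mfd_def)
  obtain eX where eX: "eX \<in> matlas X" "p \<in> fst eX" "eX \<in> charts_at X p"
    by (rule atlas_manifold_cover[OF X tp(1)])
  obtain eY where eY: "eY \<in> matlas Y" "q \<in> fst eY" "eY \<in> charts_at Y q"
    by (rule atlas_manifold_cover[OF Y tp(2)])
  note e = eX eY
  have ie: "is_chart (mtop X) eX" "is_chart (mtop Y) eY" using e by (auto simp: charts_at_def charts_def)
  let ?E = "prod_chart eX eY"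
  have E: "?E \<in> matlas (prod_mfd X Y)" "(p, q) \<in> fst ?E" using prod_chart_matlas[OF e(1,4)] e(2,5) by (simp_all add: mem_prod_chart)
  have EC: "?E \<in> charts_at (prod_mfd X Y) (p, q)"
    using E atlas_manifold_matlas[OF prod_atlas_manifold[OF X Y]] by (simp add: charts_at_def)
  have Ep: "joinl (snd ?E (p, q)) = snd eX p" "joinr (snd ?E (p, q)) = snd eY q"
    by (simp_all add: prod_chart_def)
  have op: "open {u. joinl u \<in> snd eX ` fst eX \<and> joinr u \<in> snd eY ` fst eY}"
    by (rule open_join[OF is_chart_props(3)[OF ie(1)] is_chart_props(3)[OF ie(2)]])
  have mem: "snd ?E (p, q) \<in> {u. joinl u \<in> snd eX ` fst eX \<and> joinr u \<in> snd eY ` fst eY}"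
    using Ep e by auto
  { assume "d \<in> charts_at X p" "cdiff (f \<circ> chart_inv d) (snd d p)"
    from cdiff_change_chart(1)[OF X e(3) this]
    have "cdiff ((f \<circ> chart_inv eX) \<circ> joinl) (snd ?E (p, q))"
      by (intro cdiff_compose(1) cdiff_joinl) (simp add: Ep)
    then have "cdiff ((f \<circ> fst) \<circ> chart_inv ?E) (snd ?E (p, q))"
      by (rule cdiff_transform(1)[OF _ op mem]) (simp add: prod_chart_inv[OF ie])
    then show "cdiff ((f \<circ> fst) \<circ> chart_inv c) (snd c (p, q))"
      by (rule cdiff_change_chart(1)[OF prod_atlas_manifold[OF X Y] c EC]) }
  { assume "d' \<in> charts_at Y q" "cdiff (g \<circ> chart_inv d') (snd d' q)"
    from cdiff_change_chart(1)[OF Y e(6) this]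
    have "cdiff ((g \<circ> chart_inv eY) \<circ> joinr) (snd ?E (p, q))"
      by (intro cdiff_compose(1) cdiff_joinr) (simp add: Ep)
    then have "cdiff ((g \<circ> snd) \<circ> chart_inv ?E) (snd ?E (p, q))"
      by (rule cdiff_transform(1)[OF _ op mem]) (simp add: prod_chart_inv[OF ie])
    then show "cdiff ((g \<circ> snd) \<circ> chart_inv c) (snd c (p, q))"
      by (rule cdiff_change_chart(1)[OF prod_atlas_manifold[OF X Y] c EC]) }
qed

lemma prod_chain:
  fixes f :: "'a \<Rightarrow> complex^'n"
  assumes X: "atlas_manifold X" and Y: "atlas_manifold Y"
    and c: "c \<in> charts_at (prod_mfd X Y) (p, q)"
    and e: "e \<in> charts_at X p" and f: "cdiff (f \<circ> chart_inv e) (snd e p)"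
  shows "jacobian ((f \<circ> fst) \<circ> chart_inv c) (at (snd c (p, q))) =
    jacobian (f \<circ> chart_inv e) (at (snd e p)) ** jacobian ((snd e \<circ> fst) \<circ> chart_inv c) (at (snd c (p, q)))"
proof -
  have c': "c \<in> charts (prod_mfd X Y)" "(p, q) \<in> fst c" and e': "e \<in> charts X" "p \<in> fst e"
    using c e by (auto simp: charts_at_def)
  have "openin (mtop (prod_mfd X Y)) (fst e \<times> topspace (mtop Y))"
    using charts_props(1)[OF e'(1)] by (simp add: prod_mfd_def openin_prod_Times_iff)
  moreover have "(p, q) \<in> fst e \<times> topspace (mtop Y)"
    using e'(2) c'(2) openin_subset[OF charts_props(1)[OF c'(1)]] by (auto simp: prod_mfd_def)
  ultimately obtain V where V: "open V" "snd c (p, q) \<in> V"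
    "\<And>u. u \<in> V \<Longrightarrow> chart_inv c u \<in> fst c \<inter> (fst e \<times> topspace (mtop Y))"
    by (rule chart_inv_nbhd[OF c'(1) _ c'(2)]) blast
  have ce: "cdiff ((snd e \<circ> fst) \<circ> chart_inv c) (snd c (p, q))"
    by (rule prod_cdiff(1)[OF X Y c e charts_compatible[OF X e e]])
  have v: "((snd e \<circ> fst) \<circ> chart_inv c) (snd c (p, q)) = snd e p"
    using charts_props(4)[OF c'] by simp
  note comp = cdiff_compose[OF ce, of "f \<circ> chart_inv e", unfolded v, OF f]
  have eq: "((f \<circ> chart_inv e) \<circ> ((snd e \<circ> fst) \<circ> chart_inv c)) u = ((f \<circ> fst) \<circ> chart_inv c) u" if "u \<in> V" for u
    using V(3)[OF that] charts_props(4)[OF e'(1)] by (auto simp: mem_Times_iff)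
  show ?thesis by (rule trans[OF cdiff_transform(2)[OF comp(1) V(1,2) eq] comp(2)])
qed

text \<open>The curve is known to be differentiable in the chart \<open>e\<close>. Continuity there,
  and openness of the domain of \<open>c\<close>, supply the parameter neighbourhood on which the
  curve stays in \<open>c\<close>.\<close>

lemma prod_curve_cdiff:
  fixes \<gamma> :: "complex^'a \<Rightarrow> 'b"
  assumes X: "atlas_manifold X" and Y: "atlas_manifold Y"
    and c: "c \<in> charts_at (prod_mfd X Y) (\<gamma> a, q)"
    and e: "e \<in> matlas X" "open S" "a \<in> S" "\<And>t. t \<in> S \<Longrightarrow> \<gamma> t \<in> fst e" "cdiff (\<lambda>t. snd e (\<gamma> t)) a"
  shows "cdiff (\<lambda>t. snd c (\<gamma> t, q)) a" "\<exists>T. open T \<and> a \<in> T \<and> (\<forall>t\<in>T. (\<gamma> t, q) \<in> fst c)"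
proof -
  have c': "c \<in> charts (prod_mfd X Y)" "(\<gamma> a, q) \<in> fst c" using c by (auto simp: charts_at_def)
  have "(\<gamma> a, q) \<in> topspace (mtop (prod_mfd X Y))"
    using c' openin_subset[OF charts_props(1)] by blast
  then have "q \<in> topspace (mtop Y)" by (auto simp: prod_mfd_def)
  then obtain eY where eY: "eY \<in> matlas Y" "q \<in> fst eY" by (rule atlas_manifold_cover[OF Y])
  let ?E = "prod_chart e eY"
  have E: "?E \<in> matlas (prod_mfd X Y)" "\<And>t. t \<in> S \<Longrightarrow> (\<gamma> t, q) \<in> fst ?E"
    using prod_chart_matlas[OF e(1) eY(1)] e(4) eY(2) by (simp_all add: mem_prod_chart)
  have EC: "?E \<in> charts (prod_mfd X Y)" by (rule atlas_manifold_matlas[OF prod_atlas_manifold[OF X Y] E(1)])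
  have dE: "cdiff (\<lambda>t. snd ?E (\<gamma> t, q)) a"
    using cdiff_join[OF e(5) cdiff_const[of "snd eY q" a]] by (simp add: prod_chart_def)
  from cdiff_compose(1)[OF this chart_atlas_cdiff(2)[OF c'(1) E(1) c'(2) E(2)[OF e(3)]]]
  show "cdiff (\<lambda>t. snd c (\<gamma> t, q)) a"
    by (rule cdiff_transform(1)[OF _ e(2,3)]) (simp add: charts_props(4)[OF EC E(2)])
  define U where "U = snd ?E ` (fst ?E \<inter> fst c)"
  have "open U" unfolding U_def by (rule charts_props(7)[OF EC charts_props(1)[OF c'(1)]])
  moreover have "snd ?E (\<gamma> a, q) \<in> U" unfolding U_def using E(2)[OF e(3)] c'(2) by (intro imageI IntI)
  ultimately have "\<exists>T. open T \<and> a \<in> T \<and> (\<forall>t\<in>T. snd ?E (\<gamma> t, q) \<in> U)"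
    using cdiff_continuous[OF dE] unfolding continuous_at_open by simp
  then obtain T where T: "open T" "a \<in> T" "\<And>t. t \<in> T \<Longrightarrow> snd ?E (\<gamma> t, q) \<in> U" by blast
  have "(\<gamma> t, q) \<in> fst c" if "t \<in> T \<inter> S" for t
  proof -
    have "snd ?E (\<gamma> t, q) \<in> U" using T(3) that by simp
    then obtain r where r: "snd ?E (\<gamma> t, q) = snd ?E r" "r \<in> fst ?E \<inter> fst c"
      unfolding U_def by (rule imageE)
    have "(\<gamma> t, q) = r"
      by (rule inj_onD[OF charts_props(2)[OF EC] r(1)]) (use E(2)[of t] that r(2) in simp_all)
    then show ?thesis using r(2) by simp
  qed
  then show "\<exists>T. open T \<and> a \<in> T \<and> (\<forall>t\<in>T. (\<gamma> t, q) \<in> fst c)"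
    using T(1,2) e(2,3) by (intro exI[of _ "T \<inter> S"]) auto
qed

section \<open>Families of sections\<close>

text \<open>Used for the coordinates of \<open>Z\<close>, as the pair of \<lambda> and
  \<open>w\<close>, and also for the parameters of \<open>F\<close>, as the pair of \<lambda> and
  the coordinates of \<open>x\<close>.\<close>

definition fpair :: "complex \<Rightarrow> complex^'k \<Rightarrow> complex^('k::finite option)" where
  "fpair z u = (\<chi> i. case i of None \<Rightarrow> z | Some \<mu> \<Rightarrow> u $ \<mu>)"

definition ftail :: "complex^('k::finite option) \<Rightarrow> complex^'k" where
  "ftail y = (\<chi> \<mu>. y $ Some \<mu>)"

lemma fpair_simps [simp]: "fpair z u $ None = z" "fpair z u $ Some \<mu> = u $ \<mu>"
    "ftail (fpair z u) = u" "fpair (y $ None) (ftail y) = y" "ftail y $ \<mu> = y $ Some \<mu>"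
  by (auto simp: fpair_def ftail_def vec_eq_iff split: option.split)

lemma fpair_eq_iff: "y = fpair z u \<longleftrightarrow> y $ None = z \<and> ftail y = u"
  using fpair_simps(1,3,4) by metis

lemma fpair_add: "fpair a u + b *s fpair c v = fpair (a + b * c) (u + b *s v)"
proof (subst vec_eq_iff, rule allI)
  fix i show "(fpair a u + b *s fpair c v) $ i = fpair (a + b * c) (u + b *s v) $ i"
    by (cases i) simp_all
qed

lemma fibre_map_fpair: "fibre_map l \<pi> w p = fpair (l (\<pi> p)) (w p)"
  by (simp add: fibre_map_def fpair_def)

lemma derivative_component:
  assumes "cdiff f a"
  shows "((\<lambda>x. f x $ i) has_derivative (\<lambda>h. (jacobian f (at a) *v h) $ i)) (at a)"
  using has_derivative_compose[OF cdiff_has_derivative[OF assms]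
      bounded_linear_imp_has_derivative[OF bounded_linear_vec_nth]] .

lemma jacobianI:
  assumes "cdiff f a" "(f has_derivative f') (at a)"
  shows "jacobian f (at a) *v h = f' h"
  using has_derivative_unique[OF cdiff_has_derivative[OF assms(1)] assms(2)] by metis

lemma cdiff_fpair:
  fixes f :: "complex^'a \<Rightarrow> complex^('k::finite option)" and g :: "complex^'a \<Rightarrow> complex^'m::finite"
  assumes "cdiff f a" "cdiff g a"
  shows "cdiff (\<lambda>x. fpair (f x $ None) (g x)) a"
    "jacobian (\<lambda>x. fpair (f x $ None) (g x)) (at a) *v h =
      fpair ((jacobian f (at a) *v h) $ None) (jacobian g (at a) *v h)"
proof -
  show 1: "cdiff (\<lambda>x. fpair (f x $ None) (g x)) a"
  proof (rule cdiff_vec_lambda)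
    fix i :: "'m option"
    show "\<exists>r. ((\<lambda>x. fpair (f x $ None) (g x) $ i) has_derivative (\<lambda>h. \<Sum>j\<in>UNIV. r j * h $ j)) (at a)"
      using cdiff_component[OF assms(1)] cdiff_component[OF assms(2)] by (cases i) simp_all
  qed
  let ?d = "\<lambda>h. fpair ((jacobian f (at a) *v h) $ None) (jacobian g (at a) *v h)"
  have "((\<lambda>x. fpair (f x $ None) (g x) $ i) has_derivative (\<lambda>h. ?d h $ i)) (at a)" for i
    using derivative_component[OF assms(1), of None] derivative_component[OF assms(2)]
    by (cases i) simp_all
  from has_derivative_vec_lambda[of "\<lambda>i x. fpair (f x $ None) (g x) $ i", OF this]
  have "((\<lambda>x. fpair (f x $ None) (g x)) has_derivative ?d) (at a)" by simp
  then show "jacobian (\<lambda>x. fpair (f x $ None) (g x)) (at a) *v h = ?d h" by (rule jacobianI[OF 1])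
qed

lemma cdiff_ftail:
  fixes f :: "complex^'a \<Rightarrow> complex^('k::finite option)"
  assumes "cdiff f a"
  shows "cdiff (\<lambda>x. ftail (f x)) a" "jacobian (\<lambda>x. ftail (f x)) (at a) *v h = ftail (jacobian f (at a) *v h)"
proof -
  show 1: "cdiff (\<lambda>x. ftail (f x)) a"
  proof (rule cdiff_vec_lambda)
    fix i :: 'k
    show "\<exists>r. ((\<lambda>x. ftail (f x) $ i) has_derivative (\<lambda>h. \<Sum>j\<in>UNIV. r j * h $ j)) (at a)"
      using cdiff_component[OF assms(1)] by simp
  qed
  have "((\<lambda>x. ftail (f x) $ i) has_derivative (\<lambda>h. ftail (jacobian f (at a) *v h) $ i)) (at a)" for i
    using derivative_component[OF assms, of "Some i"] by simp
  from has_derivative_vec_lambda[of "\<lambda>i x. ftail (f x) $ i", OF this]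
  have "((\<lambda>x. ftail (f x)) has_derivative (\<lambda>h. ftail (jacobian f (at a) *v h))) (at a)" by (simp add: ftail_def)
  then show "jacobian (\<lambda>x. ftail (f x)) (at a) *v h = ftail (jacobian f (at a) *v h)" by (rule jacobianI[OF 1])
qed

text \<open>The coordinate projection onto the subspace that a slice chart with index set
  \<open>J\<close> assigns to the submanifold.\<close>

definition restr_matrix :: "'n set \<Rightarrow> complex^'n^'n" where
  "restr_matrix J = (\<chi> i j. if i = j \<and> i \<notin> J then 1 else 0)"

lemma restr_matrix_mult: "(restr_matrix J *v h) $ i = (if i \<in> J then 0 else h $ i)"
  by (simp add: restr_matrix_def matrix_vector_mult_def if_distrib if_distribR cong: if_cong)

text \<open>One patch of the projective line in abstract form, with domain \<open>B\<close>,
  coordinate \<open>l\<close> and inverse coordinate \<open>pt\<close>. What concerns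
  \<open>dw\<close> and the Kodaira map is proved here once and then instantiated for both
  patches.\<close>

locale curve_patch =
  fixes Z :: "('z, 'k::finite option) cmfd" and M :: "('x, 'm::finite) cmfd"
    and \<pi> :: "'z \<Rightarrow> complex option" and F :: "('z \<times> 'x) set"
    and B :: "complex option set" and l :: "complex option \<Rightarrow> complex" and pt :: "complex \<Rightarrow> complex option"
    and W :: "'z set" and w :: "'z \<Rightarrow> complex^'k"
  assumes Z: "atlas_manifold Z" and M: "atlas_manifold M"
    and fam: "holomorphic_family Z M F"
    and sec: "x \<in> topspace (mtop M) \<Longrightarrow> is_section Z \<pi> (submfd_at F x)"
    and fc: "fibre_coordinates Z \<pi> B l W w"
    and sub: "x \<in> topspace (mtop M) \<Longrightarrow> submfd_at F x \<inter> \<pi> -` B \<subseteq> W"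
    and Bat: "(B, \<lambda>q. vec (l q)) \<in> matlas P1" and Bch: "(B, \<lambda>q. vec (l q)) \<in> charts P1"
    and Binv: "chart_inv (B, \<lambda>q. vec (l q) :: complex^1) u = pt (u $ 1)"
    and pt: "pt z \<in> B" "l (pt z) = z" "q \<in> B \<Longrightarrow> pt (l q) = q"
begin

abbreviation "cW \<equiv> (W, fibre_map l \<pi> w)"
abbreviation "N \<equiv> prod_mfd Z M"

definition sect :: "'x \<Rightarrow> complex option \<Rightarrow> 'z" where
  "sect x q = (THE p. p \<in> submfd_at F x \<and> \<pi> p = q)"

lemma sect_props:
  assumes "x \<in> topspace (mtop M)"
  shows "sect x q \<in> submfd_at F x" "\<pi> (sect x q) = q" "p \<in> submfd_at F x \<Longrightarrow> sect x (\<pi> p) = p"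
    "holomorphic_map P1 Z (sect x)" "submfd_at F x = range (sect x)"
proof -
  obtain s where s: "holomorphic_map P1 Z s" "\<And>q. \<pi> (s q) = q" "submfd_at F x = range s"
    using sec[OF assms] unfolding is_section_def by blast
  have "sect x q = s q" for q
    unfolding sect_def
  proof (rule the_equality)
    show "s q \<in> submfd_at F x \<and> \<pi> (s q) = q" by (simp add: s(2,3))
    fix p assume p: "p \<in> submfd_at F x \<and> \<pi> p = q"
    then obtain q' where "p = s q'" unfolding s(3) by blast
    then show "p = s q" using p s(2) by simp
  qed
  then have e: "sect x = s" by (rule ext)
  show "sect x q \<in> submfd_at F x" "submfd_at F x = range (sect x)"
    unfolding e s(3) by (rule rangeI, rule refl)
  show "\<pi> (sect x q) = q" unfolding e by (rule s(2))
  show "holomorphic_map P1 Z (sect x)" unfolding e by (rule s(1))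
  show "sect x (\<pi> p) = p" if "p \<in> submfd_at F x"
  proof -
    have "p \<in> range s" using that by (simp only: s(3))
    then obtain q where "p = s q" by (rule rangeE)
    then show ?thesis by (simp add: e s(2))
  qed
qed

lemma restr_sect: "restr \<pi> F w q x = w (sect x q)"
  by (simp add: restr_def sect_def)

lemma W_chart: "cW \<in> charts Z" "p \<in> W \<Longrightarrow> cW \<in> charts_at Z p" "p \<in> W \<Longrightarrow> \<pi> p \<in> B"
proof -
  show c: "cW \<in> charts Z" using fc by (simp add: fibre_coordinates_def)
  then show "cW \<in> charts_at Z p" if "p \<in> W" using that by (simp add: charts_at_def)
  have "\<pi> ` W \<subseteq> B" using fc by (simp add: fibre_coordinates_def)
  then show "\<pi> p \<in> B" if "p \<in> W" using that by (rule subsetD[OF _ imageI])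
qed

lemma sect_in_W: "x \<in> topspace (mtop M) \<Longrightarrow> sect x (pt z) \<in> W"
proof (rule subsetD[OF sub])
  assume x: "x \<in> topspace (mtop M)"
  show "sect x (pt z) \<in> submfd_at F x \<inter> \<pi> -` B" using sect_props(1,2)[OF x] pt(1) by simp
qed

lemma fibre_map_sect: "x \<in> topspace (mtop M) \<Longrightarrow> fibre_map l \<pi> w (sect x (pt z)) = fpair z (w (sect x (pt z)))"
  by (simp add: fibre_map_fpair sect_props(2) pt(2))

lemma curve_cdiff:
  assumes x: "x \<in> topspace (mtop M)" and c: "c \<in> charts Z" and z: "sect x (pt z) \<in> fst c"
  shows "cdiff (\<lambda>t::complex^1. snd c (sect x (pt (t $ 1)))) (vec z)"
    "open {t::complex^1. sect x (pt (t $ 1)) \<in> fst c}"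
proof -
  let ?b = "(B, \<lambda>q. vec (l q) :: complex^1)" and ?D = "{p \<in> topspace (mtop P1). sect x p \<in> fst c}"
  note hm = sect_props(4)[OF x, unfolded holomorphic_map_def]
  have img: "snd ?b ` (fst ?b \<inter> ?D) = {t::complex^1. sect x (pt (t $ 1)) \<in> fst c}"
  proof (intro set_eqI iffI)
    fix t :: "complex^1" assume "t \<in> {t. sect x (pt (t $ 1)) \<in> fst c}"
    moreover have "t = vec (l (pt (t $ 1)))" by (simp add: pt(2) vec_eq_iff forall_1)
    ultimately show "t \<in> snd ?b ` (fst ?b \<inter> ?D)"
      using pt(1) by (intro image_eqI[of _ _ "pt (t $ 1)"]) (auto simp: topspace_P1)
  qed (auto simp: pt(3))
  have "holo_on ((snd c \<circ> sect x) \<circ> chart_inv ?b) (snd ?b ` (fst ?b \<inter> ?D))"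
    using hm c Bch unfolding holomorphic_fun_def by blast
  then show "cdiff (\<lambda>t::complex^1. snd c (sect x (pt (t $ 1)))) (vec z)"
    unfolding img holo_on_cdiff using z by (simp add: comp_def Binv)
  have "openin (mtop P1) ?D"
    using hm charts_props(1)[OF c] unfolding continuous_map_def by blast
  from charts_props(7)[OF Bch this]
  show "open {t::complex^1. sect x (pt (t $ 1)) \<in> fst c}" unfolding img .
qed

lemma family_submersion:
  assumes "q \<in> F"
  shows "differential N M snd q ` sub_tangent_space N F q = tangent_space M (snd q)"
proof -
  have "\<forall>q\<in>F. differential N M snd q ` sub_tangent_space N F q = tangent_space M (snd q)"
    using fam unfolding holomorphic_family_def by blast
  then show ?thesis using assms by blast
qed

text \<open>The restriction of \<open>w\<close> to the curves, as a joint function of \<lambda>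
  (component \<open>None\<close>) and of the coordinates of \<open>x\<close> in the chart
  \<open>d\<close>. Differentiability in both together ties the Kodaira map to
  \<open>dw\<close>.\<close>

definition graph_fun :: "('x, 'm) chart \<Rightarrow> complex^('m option) \<Rightarrow> complex^'k" where
  "graph_fun d y = w (sect (chart_inv d (ftail y)) (pt (y $ None)))"

text \<open>The implicit function step. The map \<open>(\<lambda>, x)\<close> restricted to a slice of \<open>F\<close> is injective
  because a point of \<open>F\<close> is determined by its curve and its position on it, so invariance of domain
  replaces the inverse function theorem and no continuity of derivatives is needed.\<close>

lemma graph_derivative:
  fixes z0 :: complex
  assumes x0: "x0 \<in> topspace (mtop M)" and d: "d \<in> charts_at M x0"
  defines "p0 \<equiv> sect x0 (pt z0)" and "y0 \<equiv> fpair z0 (snd d x0)"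
  shows "cdiff (graph_fun d) y0"
    "\<And>c \<xi>. c \<in> charts_at N (p0, x0) \<Longrightarrow> \<xi> \<in> sub_tangent_space N F (p0, x0) \<Longrightarrow>
      (let \<tau> = jacobian ((fibre_map l \<pi> w \<circ> fst) \<circ> chart_inv c) (at (snd c (p0, x0))) *v \<xi> c;
           \<eta> = jacobian ((snd d \<circ> snd) \<circ> chart_inv c) (at (snd c (p0, x0))) *v \<xi> c
       in ftail \<tau> = jacobian (graph_fun d) (at y0) *v fpair (\<tau> $ None) \<eta>)"
proof -
  let ?q0 = "(p0, x0)"
  have NM: "atlas_manifold N" by (rule prod_atlas_manifold[OF Z M])
  have p0: "p0 \<in> submfd_at F x0" "\<pi> p0 = pt z0" "p0 \<in> W"
    using sect_props(1,2)[OF x0] sect_in_W[OF x0] by (auto simp: p0_def)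
  have q0F: "?q0 \<in> F" using p0(1) by (simp add: submfd_at_def)
  have d': "d \<in> charts M" "x0 \<in> fst d" using d by (auto simp: charts_at_def)
  have FM: "q \<in> topspace (mtop N)" if "q \<in> F" for q
    using fam that by (auto simp: holomorphic_family_def complex_submanifold_def)
  obtain c J where cJ: "slice_chart N F ?q0 c J"
    using fam q0F by (auto simp: holomorphic_family_def complex_submanifold_def)
  then have c: "c \<in> charts_at N ?q0"
    and slice: "snd c ` (fst c \<inter> F) = {u \<in> snd c ` fst c. \<forall>j\<in>J. u $ j = 0}"
    by (auto simp: slice_chart_def)
  have c': "c \<in> charts N" "?q0 \<in> fst c" using c by (auto simp: charts_at_def)
  define u0 where "u0 = snd c ?q0"
  have u0J: "u0 $ j = 0" if "j \<in> J" for j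
    using slice c'(2) q0F that unfolding u0_def by blast
  have "openin (mtop N) (W \<times> fst d)"
    using charts_props(1)[OF W_chart(1)] charts_props(1)[OF d'(1)]
    by (simp add: prod_mfd_def openin_prod_Times_iff)
  moreover have "?q0 \<in> W \<times> fst d" using p0(3) d'(2) by simp
  ultimately obtain V where V: "open V" "u0 \<in> V" "V \<subseteq> snd c ` fst c" "\<And>u. u \<in> V \<Longrightarrow> chart_inv c u \<in> fst c \<inter> (W \<times> fst d)"
    unfolding u0_def by (rule chart_inv_nbhd[OF c'(1) _ c'(2)]) blast
  \<comment> \<open>\<open>\<Phi>\<close> reads off the parameters of a point of \<open>F\<close>,
    and \<open>S\<close> recovers the point from them. Since \<open>S\<close> is put together from
    the sections curve by curve, nothing is known yet about its continuity in
    \<open>x\<close>.\<close>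
  define \<Phi> where "\<Phi> = (\<lambda>q. fpair (l (\<pi> (fst q))) (snd d (snd q)))"
  define S where "S = (\<lambda>y. (sect (chart_inv d (ftail y)) (pt (y $ None)), chart_inv d (ftail y)))"
  have \<Phi>0: "\<Phi> ?q0 = y0" by (simp add: \<Phi>_def y0_def p0(2) pt(2))
  have slice_point: "chart_inv c u \<in> F \<and> S (\<Phi> (chart_inv c u)) = chart_inv c u \<and> snd c (chart_inv c u) = u"
    if "u \<in> V" "\<And>j. j \<in> J \<Longrightarrow> u $ j = 0" for u
  proof -
    have "u \<in> snd c ` (fst c \<inter> F)" unfolding slice using that V(3) by blast
    then obtain q where q: "q \<in> fst c" "q \<in> F" "u = snd c q" by blast
    have ciq: "chart_inv c u = q" using charts_props(4)[OF c'(1) q(1)] q(3) by simp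
    obtain p x where px: "q = (p, x)" by (cases q)
    have "q \<in> W \<times> fst d" using V(4)[OF that(1)] ciq by simp
    then have pW: "p \<in> W" "x \<in> fst d" using px by auto
    then have "x \<in> topspace (mtop M)" using openin_subset[OF charts_props(1)[OF d'(1)]] by blast
    moreover have "p \<in> submfd_at F x" using q(2) px by (simp add: submfd_at_def)
    ultimately have "sect x (\<pi> p) = p" by (rule sect_props(3))
    then have "S (\<Phi> q) = q"
      using px pW charts_props(4)[OF d'(1)] W_chart(3) pt(3) by (simp add: S_def \<Phi>_def)
    then show ?thesis using ciq q by simp
  qed
  have wW: "cdiff (fibre_map l \<pi> w \<circ> chart_inv cW) (snd cW p)" if "p \<in> W" for p
    using charts_compatible[OF Z W_chart(2)[OF that] W_chart(2)[OF that]] by simp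
  have J1: "cdiff ((fibre_map l \<pi> w \<circ> fst) \<circ> chart_inv c) u" "cdiff ((snd d \<circ> snd) \<circ> chart_inv c) u"
    if "u \<in> V" for u
  proof -
    obtain p x where px: "chart_inv c u = (p, x)" by (cases "chart_inv c u")
    have m: "(p, x) \<in> fst c" "p \<in> W" "x \<in> fst d" using V(4)[OF that] px by auto
    have cc: "c \<in> charts_at N (p, x)" and dd: "d \<in> charts_at M x" using m c'(1) d'(1) by (auto simp: charts_at_def)
    have u: "snd c (p, x) = u" using charts_props(5)[OF c'(1) subsetD[OF V(3) that]] px by simp
    show "cdiff ((fibre_map l \<pi> w \<circ> fst) \<circ> chart_inv c) u"
      using prod_cdiff(1)[OF Z M cc W_chart(2)[OF m(2)] wW[OF m(2)]] u by simp
    show "cdiff ((snd d \<circ> snd) \<circ> chart_inv c) u"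
      using prod_cdiff(2)[OF Z M cc dd charts_compatible[OF M dd dd]] u by simp
  qed
  define \<Phi>c where "\<Phi>c = \<Phi> \<circ> chart_inv c"
  have \<Phi>c_eq: "\<Phi>c = (\<lambda>u. fpair (((fibre_map l \<pi> w \<circ> fst) \<circ> chart_inv c) u $ None) (((snd d \<circ> snd) \<circ> chart_inv c) u))"
    by (simp add: \<Phi>c_def \<Phi>_def fibre_map_fpair comp_def)
  have \<Phi>c: "cdiff \<Phi>c u" if "u \<in> V" for u unfolding \<Phi>c_eq by (rule cdiff_fpair(1)[OF J1[OF that]])
  define JT where "JT = jacobian ((fibre_map l \<pi> w \<circ> fst) \<circ> chart_inv c) (at u0)"
  define JX where "JX = jacobian ((snd d \<circ> snd) \<circ> chart_inv c) (at u0)"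
  define J\<Phi> where "J\<Phi> = jacobian \<Phi>c (at u0)"
  have J\<Phi>: "J\<Phi> *v h = fpair ((JT *v h) $ None) (JX *v h)" for h
    unfolding J\<Phi>_def \<Phi>c_eq JT_def JX_def by (rule cdiff_fpair(2)[OF J1[OF V(2)]])
  have \<Phi>cu0: "\<Phi>c u0 = y0" using charts_props(4)[OF c'] \<Phi>0 by (simp add: \<Phi>c_def u0_def)
  have tangentJ: "\<xi> c $ j = 0" if "\<xi> \<in> sub_tangent_space N F ?q0" "j \<in> J" for \<xi> j
    using that cJ unfolding sub_tangent_space_def by blast
  \<comment> \<open>The directions in \<open>x\<close> come from the submersion onto
    \<open>M\<close>. The direction of \<lambda> comes from the curve through \<open>p0\<close> at
    fixed \<open>x0\<close>, read in the slice chart as \<open>\<kappa>\<close>; its velocity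
    \<open>\<kappa>'\<close> also lies in the slice and corrects the \<lambda>-component of a
    lift.\<close>
  have surj: "\<exists>h. (\<forall>j\<in>J. h $ j = 0) \<and> J\<Phi> *v h = y" for y
  proof -
    have "tangent_of M x0 d (ftail y) \<in> tangent_space M x0" by (rule tangent_of(1)[OF M d])
    then have "tangent_of M x0 d (ftail y) \<in> differential N M snd ?q0 ` sub_tangent_space N F ?q0"
      using family_submersion[OF q0F] by simp
    then obtain \<xi> where \<xi>: "\<xi> \<in> sub_tangent_space N F ?q0"
      "differential N M snd ?q0 \<xi> = tangent_of M x0 d (ftail y)" by (elim imageE) simp
    have \<xi>T: "\<xi> \<in> tangent_space N ?q0" using \<xi>(1) by (simp add: sub_tangent_space_def)
    have "differential N M snd ?q0 \<xi> d = mderiv N (snd d \<circ> snd) ?q0 \<xi>"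
      using d by (simp add: differential_def)
    also have "\<dots> = JX *v \<xi> c"
      using mderiv_chart[OF NM \<xi>T c] J1(2)[OF V(2)] by (simp add: JX_def u0_def)
    finally have \<xi>X: "JX *v \<xi> c = ftail y" using \<xi>(2) tangent_of(2)[OF M d] by simp
    have "p0 \<in> topspace (mtop Z)" using FM[OF q0F] by (simp add: prod_mfd_def)
    then obtain e where e: "e \<in> matlas Z" "p0 \<in> fst e" "e \<in> charts_at Z p0" by (rule atlas_manifold_cover[OF Z])
    have eC: "e \<in> charts Z" using e(3) by (simp add: charts_at_def)
    define \<gamma> where "\<gamma> = (\<lambda>t::complex^1. sect x0 (pt (t $ 1)))"
    have \<gamma>0: "\<gamma> (vec z0) = p0" by (simp add: \<gamma>_def p0_def)
    have ez: "sect x0 (pt z0) \<in> fst e" using e(2) by (simp add: p0_def)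
    define \<kappa> where "\<kappa> = (\<lambda>t. snd c (\<gamma> t, x0))"
    have "cdiff \<kappa> (vec z0) \<and> (\<exists>T. open T \<and> vec z0 \<in> T \<and> (\<forall>t\<in>T. (\<gamma> t, x0) \<in> fst c))"
      unfolding \<kappa>_def
      by (intro conjI prod_curve_cdiff[OF Z M, of c \<gamma> "vec z0" x0 e "{t. \<gamma> t \<in> fst e}"])
        (use c \<gamma>0 e curve_cdiff[OF x0 eC ez] in \<open>auto simp: \<gamma>_def\<close>)
    then obtain T where \<kappa>: "cdiff \<kappa> (vec z0)" and T: "open T" "vec z0 \<in> T" "\<And>t. t \<in> T \<Longrightarrow> (\<gamma> t, x0) \<in> fst c"
      by blast
    define \<kappa>' where "\<kappa>' = jacobian \<kappa> (at (vec z0)) *v 1"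
    have \<kappa>u0: "\<kappa> (vec z0) = u0" by (simp add: \<kappa>_def \<gamma>0 u0_def)
    have "(\<gamma> t, x0) \<in> F" for t using sect_props(1)[OF x0] by (simp add: \<gamma>_def submfd_at_def)
    then have \<kappa>J: "\<kappa> t $ j = 0" if "t \<in> T" "j \<in> J" for t j
      using T(3)[OF that(1)] slice that(2) unfolding \<kappa>_def by blast
    have \<kappa>'J: "\<kappa>' $ j = 0" if "j \<in> J" for j
    proof -
      have "((\<lambda>t. \<kappa> t $ j) has_derivative (\<lambda>h. (jacobian \<kappa> (at (vec z0)) *v h) $ j)) (at (vec z0))"
        by (rule derivative_component[OF \<kappa>])
      moreover have "((\<lambda>t. \<kappa> t $ j) has_derivative (\<lambda>h. 0)) (at (vec z0))"
        by (rule has_derivative_transform_within_open[OF has_derivative_const T(1,2)]) (simp add: \<kappa>J that)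
      ultimately show ?thesis unfolding \<kappa>'_def using has_derivative_unique by metis
    qed
    have \<kappa>\<Phi>: "J\<Phi> *v \<kappa>' = fpair 1 0"
    proof -
      have k: "(\<Phi>c \<circ> \<kappa>) t = fpair (t $ 1) (snd d x0)" if "t \<in> T" for t
        using charts_props(4)[OF c'(1) T(3)[OF that]] sect_props(2)[OF x0] pt(2)
        by (simp add: \<Phi>c_def \<kappa>_def \<Phi>_def \<gamma>_def)
      have "((\<lambda>t::complex^1. fpair (t $ 1) (snd d x0)) has_derivative (\<lambda>h. fpair (h $ 1) 0)) (at (vec z0))"
      proof -
        have "((\<lambda>t::complex^1. fpair (t $ 1) (snd d x0) $ i) has_derivative (\<lambda>h. fpair (h $ 1) 0 $ i)) (at (vec z0))" for i
          by (cases i) (auto intro!: bounded_linear_imp_has_derivative bounded_linear_vec_nth)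
        from has_derivative_vec_lambda[of "\<lambda>i t. fpair (t $ 1) (snd d x0) $ i", OF this] show ?thesis by simp
      qed
      then have dd: "((\<Phi>c \<circ> \<kappa>) has_derivative (\<lambda>h. fpair (h $ 1) 0)) (at (vec z0))"
        by (rule has_derivative_transform_within_open[OF _ T(1,2)]) (simp only: k)
      have comp: "cdiff (\<Phi>c \<circ> \<kappa>) (vec z0)"
        "jacobian (\<Phi>c \<circ> \<kappa>) (at (vec z0)) = J\<Phi> ** jacobian \<kappa> (at (vec z0))"
        using cdiff_compose[OF \<kappa>, of \<Phi>c] \<Phi>c[OF V(2)] unfolding \<kappa>u0 J\<Phi>_def by auto
      show ?thesis
        using jacobianI[OF comp(1) dd, of 1] comp(2) by (simp add: \<kappa>'_def matrix_vector_mul_assoc)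
    qed
    define b where "b = y $ None - (JT *v \<xi> c) $ None"
    have "J\<Phi> *v (\<xi> c + b *s \<kappa>') = fpair ((JT *v \<xi> c) $ None) (ftail y) + b *s fpair 1 0"
      by (simp add: matrix_vector_right_distrib vector_scalar_commute \<kappa>\<Phi>) (simp add: J\<Phi> \<xi>X)
    also have "\<dots> = y" unfolding fpair_add by (simp add: b_def)
    finally show ?thesis
      using tangentJ[OF \<xi>(1)] \<kappa>'J by (intro exI[of _ "\<xi> c + b *s \<kappa>'"]) simp
  qed
  let ?P = "restr_matrix J :: complex^('k option + 'm)^('k option + 'm)"
  have PJ: "?P *v h = h" if "\<And>j. j \<in> J \<Longrightarrow> h $ j = 0" for h
    using that by (auto simp: vec_eq_iff restr_matrix_mult)
  have "surj (\<lambda>h. (J\<Phi> ** ?P) *v h)"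
  proof (unfold surj_def, rule allI)
    fix y show "\<exists>h. y = (J\<Phi> ** ?P) *v h"
    proof -
      obtain h where h: "\<forall>j\<in>J. h $ j = 0" "J\<Phi> *v h = y" using surj[of y] by blast
      have "?P *v h = h" by (rule PJ) (use h(1) in blast)
      then have "(J\<Phi> ** ?P) *v h = y" using h(2) by (simp only: matrix_vector_mul_assoc[symmetric])
      then show ?thesis by blast
    qed
  qed
  \<comment> \<open>A right inverse suffices, so the dimension of the slice need not be computed.
    The projection in front makes \<open>RR\<close> take values in the slice.\<close>
  then obtain R where R: "J\<Phi> ** ?P ** R = mat 1" using matrix_right_invertible_surjective by blast
  define RR where "RR = ?P ** R"
  have JR: "J\<Phi> *v (RR *v h) = h" for h
    using R by (simp add: RR_def matrix_vector_mul_assoc matrix_mul_assoc)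
  have RRJ: "(RR *v h) $ j = 0" if "j \<in> J" for h j
    using that by (simp add: RR_def matrix_vector_mul_assoc[symmetric] restr_matrix_mult)
  define a where "a = (\<lambda>h. u0 + RR *v (h - y0))"
  have a: "cdiff a h" "jacobian a (at h) = RR" for h unfolding a_def by (rule cdiff_affine)+
  have a0: "a y0 = u0" by (simp add: a_def)
  have aJ: "a h $ j = 0" if "j \<in> J" for h j using that by (simp add: a_def u0J RRJ)
  define S0 where "S0 = a -` V"
  have S0: "open S0" "y0 \<in> S0"
  proof -
    have "continuous_on UNIV a" using a(1) cdiff_continuous by (auto intro!: continuous_at_imp_continuous_on)
    then show "open S0" unfolding S0_def by (rule open_vimage[OF V(1)])
    show "y0 \<in> S0" using V(2) by (simp add: S0_def a0)
  qed
  \<comment> \<open>\<open>a\<close> embeds the parameter space affinely into the slice, so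
    \<open>G\<close> maps an open set of parameters into the parameter space, with the identity as
    derivative at \<open>y0\<close>. Uniqueness of points of \<open>F\<close> makes \<open>g\<close>
    a left inverse of \<open>G\<close>; the derivative of \<open>g\<close> at \<open>y0\<close>
    follows from this.\<close>
  define G where "G = \<Phi>c \<circ> a"
  define g where "g = (\<lambda>y. y0 + J\<Phi> *v (snd c (S y) - u0))"
  have SG: "snd c (S (G h)) = a h" if "h \<in> S0" for h
    using slice_point[of "a h"] that aJ by (simp add: S0_def G_def \<Phi>c_def)
  have gG: "g (G h) = h" if "h \<in> S0" for h
    using SG[OF that] by (simp add: g_def a_def JR)
  have Gd: "cdiff G h" if "h \<in> S0" for h
    unfolding G_def by (rule cdiff_compose(1)[OF a(1)]) (use that \<Phi>c in \<open>simp add: S0_def\<close>)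
  have Gc: "continuous_on S0 G" using Gd cdiff_continuous by (auto intro!: continuous_at_imp_continuous_on)
  have G0: "G y0 = y0" by (simp add: G_def a0 \<Phi>cu0)
  have "jacobian G (at y0) = J\<Phi> ** RR"
    using cdiff_compose(2)[OF a(1), of \<Phi>c y0] \<Phi>c[OF V(2)] by (simp add: G_def a0 a(2) J\<Phi>_def)
  then have "(G has_derivative (\<lambda>h. h)) (at y0)"
    using cdiff_has_derivative[OF Gd[OF S0(2)]] JR by (simp add: matrix_vector_mul_assoc[symmetric])
  from has_derivative_inverse_strong[OF S0 Gc gG this, of "\<lambda>h. h"]
  have gd: "(g has_derivative (\<lambda>h. h)) (at y0)" by (simp add: comp_def id_def G0)
  moreover have "(\<lambda>h. h) = (\<lambda>h. (mat 1 :: complex^('m option)^('m option)) *v h)" by (rule ext) simp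
  ultimately have gcd: "cdiff g y0" unfolding cdiff_def by metis
  have g0: "g y0 = y0" using gG[OF S0(2)] G0 by simp
  have inj: "inj_on G S0" using gG by (rule inj_on_inverseI)
  \<comment> \<open>Openness of the image turns the identity for \<open>S\<close> on parameters of
    the form \<open>G h\<close> into an identity on a neighbourhood of \<open>y0\<close>, where
    \<open>graph_fun\<close> is the composite of \<open>g\<close>, \<open>a\<close> and the fibre
    coordinates.\<close>
  have GS0: "open (G ` S0)" "y0 \<in> G ` S0"
    using invariance_of_domain[OF Gc S0(1) inj] S0(2) G0 by (auto intro: image_eqI[of _ _ y0])
  have Sy: "a (g y) = snd c (S y)" "S y \<in> fst c" if "y \<in> G ` S0" for y
  proof -
    from that obtain h where h: "h \<in> S0" "y = G h" by blast
    show "a (g y) = snd c (S y)" using SG[OF h(1)] gG[OF h(1)] h(2) by simp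
    have "S (G h) = chart_inv c (a h)"
      using slice_point[of "a h"] h(1) aJ by (simp add: S0_def G_def \<Phi>c_def)
    then show "S y \<in> fst c" using V(4)[of "a h"] h by (simp add: S0_def)
  qed
  let ?wc = "\<lambda>u. ftail (((fibre_map l \<pi> w \<circ> fst) \<circ> chart_inv c) u)"
  have wc: "cdiff ?wc u0" by (rule cdiff_ftail(1)[OF J1(1)[OF V(2)]])
  have "cdiff (?wc \<circ> (a \<circ> g)) y0"
    using wc by (intro cdiff_compose(1)[OF cdiff_compose(1)[OF gcd a(1)]]) (simp add: g0 a0)
  then show gf: "cdiff (graph_fun d) y0"
  proof (rule cdiff_transform(1)[OF _ GS0])
    fix y assume y: "y \<in> G ` S0"
    have "chart_inv c (a (g y)) = S y" using Sy[OF y] charts_props(4)[OF c'(1)] by simp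
    then show "(?wc \<circ> (a \<circ> g)) y = graph_fun d y"
      by (simp add: fibre_map_fpair S_def graph_fun_def)
  qed
  have main: "ftail (JT *v \<xi> c) = jacobian (graph_fun d) (at y0) *v fpair ((JT *v \<xi> c) $ None) (JX *v \<xi> c)"
    if \<xi>: "\<xi> \<in> sub_tangent_space N F ?q0" for \<xi>
  proof -
    \<comment> \<open>The fibre coordinates equal \<open>graph_fun\<close> composed with
      \<open>\<Phi>\<close> on the slice only. Composition with the projection \<open>r\<close>
      gives an identity on an open set, which can be differentiated; vectors tangent to
      \<open>F\<close> are fixed by the projection, so nothing is lost for them.\<close>
    define r where "r = (\<lambda>h. u0 + ?P *v (h - 0))"
    have r: "cdiff r 0" "jacobian r (at 0) = ?P" unfolding r_def by (rule cdiff_affine)+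
    have r0: "r 0 = u0" by (simp add: r_def)
    have "isCont r h" for h unfolding r_def using cdiff_continuous[OF cdiff_affine(1)] .
    then have "open (r -` V)" by (intro open_vimage[OF V(1)] continuous_at_imp_continuous_on) auto
    moreover have "0 \<in> r -` V" using V(2) by (simp add: r0)
    moreover have "(?wc \<circ> r) h = (graph_fun d \<circ> (\<Phi>c \<circ> r)) h" if "h \<in> r -` V" for h
    proof -
      have "r h $ j = 0" if "j \<in> J" for j using that by (simp add: r_def u0J restr_matrix_mult)
      then have "S (\<Phi>c (r h)) = chart_inv c (r h)" using slice_point[of "r h"] that by (simp add: \<Phi>c_def)
      then have "fst (chart_inv c (r h)) = fst (S (\<Phi>c (r h)))" by simp
      then show ?thesis by (simp add: fibre_map_fpair S_def graph_fun_def)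
    qed
    ultimately have "jacobian (graph_fun d \<circ> (\<Phi>c \<circ> r)) (at 0) = jacobian (?wc \<circ> r) (at 0)"
      using cdiff_transform(2)[OF cdiff_compose(1)[OF r(1)], of ?wc "r -` V" "graph_fun d \<circ> (\<Phi>c \<circ> r)"] wc
      by (simp add: r0)
    moreover have "jacobian (?wc \<circ> r) (at 0) = jacobian ?wc (at u0) ** ?P"
      using cdiff_compose(2)[OF r(1), of ?wc] wc by (simp add: r0 r(2))
    moreover have pr: "cdiff (\<Phi>c \<circ> r) 0" "jacobian (\<Phi>c \<circ> r) (at 0) = J\<Phi> ** ?P"
      using cdiff_compose[OF r(1), of \<Phi>c] \<Phi>c[OF V(2)] by (simp_all add: r0 r(2) J\<Phi>_def)
    moreover have "jacobian (graph_fun d \<circ> (\<Phi>c \<circ> r)) (at 0) = jacobian (graph_fun d) (at y0) ** (J\<Phi> ** ?P)"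
      using cdiff_compose(2)[OF pr(1), of "graph_fun d"] gf pr(2) by (simp add: r0 \<Phi>cu0)
    ultimately have "jacobian ?wc (at u0) ** ?P = jacobian (graph_fun d) (at y0) ** (J\<Phi> ** ?P)" by simp
    then have "(jacobian ?wc (at u0) ** ?P) *v \<xi> c = (jacobian (graph_fun d) (at y0) ** (J\<Phi> ** ?P)) *v \<xi> c" by simp
    then have "jacobian ?wc (at u0) *v (?P *v \<xi> c) = jacobian (graph_fun d) (at y0) *v (J\<Phi> *v (?P *v \<xi> c))"
      by (simp only: matrix_vector_mul_assoc)
    then have "jacobian ?wc (at u0) *v \<xi> c = jacobian (graph_fun d) (at y0) *v (J\<Phi> *v \<xi> c)"
      using PJ[of "\<xi> c"] tangentJ[OF \<xi>] by simp
    then show ?thesis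
      unfolding J\<Phi> using cdiff_ftail(2)[OF J1(1)[OF V(2)], of "\<xi> c"] by (simp add: JT_def)
  qed
  fix c1 \<xi> assume c1: "c1 \<in> charts_at N ?q0" and \<xi>: "\<xi> \<in> sub_tangent_space N F ?q0"
  have \<xi>T: "\<xi> \<in> tangent_space N ?q0" using \<xi> by (simp add: sub_tangent_space_def)
  \<comment> \<open>The relation was derived in a slice chart; the transformation law of
    \<open>\<xi>\<close> carries it to an arbitrary chart \<open>c1\<close>.\<close>
  have ch: "jacobian (f \<circ> chart_inv c1) (at (snd c1 ?q0)) *v \<xi> c1 = jacobian (f \<circ> chart_inv c) (at u0) *v \<xi> c"
    if "cdiff (f \<circ> chart_inv c) u0" for f :: "'z \<times> 'x \<Rightarrow> complex^'a"
    using cdiff_change_chart(2)[OF NM c1 c, of f] that tangent_space_change[OF \<xi>T c1 c]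
    by (simp add: u0_def matrix_vector_mul_assoc)
  show "let \<tau> = jacobian ((fibre_map l \<pi> w \<circ> fst) \<circ> chart_inv c1) (at (snd c1 ?q0)) *v \<xi> c1;
           \<eta> = jacobian ((snd d \<circ> snd) \<circ> chart_inv c1) (at (snd c1 ?q0)) *v \<xi> c1
       in ftail \<tau> = jacobian (graph_fun d) (at y0) *v fpair (\<tau> $ None) \<eta>"
    using main[OF \<xi>] unfolding ch[OF J1(1)[OF V(2)]] ch[OF J1(2)[OF V(2)]] Let_def JT_def JX_def .
qed

end

section \<open>Normal bundles and the Kodaira map\<close>

lemma vec_option_eq_iff:
  fixes u v :: "complex^('k::finite option)"
  shows "u = v \<longleftrightarrow> u $ None = v $ None \<and> (\<forall>\<mu>. u $ Some \<mu> = v $ Some \<mu>)"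
  by (simp add: vec_eq_iff split_option_all)

lemma cdiff_add_scaled:
  fixes f g :: "complex^'a \<Rightarrow> complex^'b"
  assumes "cdiff f a" "cdiff g a"
  shows "cdiff (\<lambda>x. f x + k *s g x) a"
    "jacobian (\<lambda>x. f x + k *s g x) (at a) *v h = jacobian f (at a) *v h + k *s (jacobian g (at a) *v h)"
proof -
  have sc: "k *s v = mat k *v v" for v :: "complex^'b"
    by (simp add: vec_eq_iff matrix_vector_mult_def mat_def if_distrib if_distribR cong: if_cong)
  have g: "cdiff (\<lambda>x. mat k *v g x) a" "jacobian (\<lambda>x. mat k *v g x) (at a) = mat k ** jacobian g (at a)"
    using cdiff_compose[OF assms(2) cdiff_linear(1)[of "mat k"]] cdiff_linear(2)[of "mat k :: complex^'b^'b"]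
    by (simp_all add: comp_def)
  have d: "((\<lambda>x. f x + k *s g x) has_derivative
      (\<lambda>h. (jacobian f (at a) + mat k ** jacobian g (at a)) *v h)) (at a)"
    unfolding sc using has_derivative_add[OF cdiff_has_derivative[OF assms(1)] cdiff_has_derivative[OF g(1)]]
    by (simp add: g(2) matrix_vector_mult_add_rdistrib)
  then show "cdiff (\<lambda>x. f x + k *s g x) a" unfolding cdiff_def by blast
  show "jacobian (\<lambda>x. f x + k *s g x) (at a) *v h = jacobian f (at a) *v h + k *s (jacobian g (at a) *v h)"
    using jacobian_eq[OF d] by (simp add: sc matrix_vector_mult_add_rdistrib matrix_vector_mul_assoc)
qed

text \<open>Projections and inclusions of coordinates are written as matrices, here and in the next
  two definitions, so that the chain rule \<open>cdiff_compose\<close> yields their Jacobians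
  directly.\<close>

definition head_matrix :: "complex^('k::finite option)^1" where
  "head_matrix = (\<chi> i j. if j = None then 1 else 0)"

lemma head_matrix_mult: "head_matrix *v y = vec (y $ None)"
  by (simp add: head_matrix_def matrix_vector_mult_def vec_eq_iff if_distrib if_distribR cong: if_cong)

definition line_matrix :: "complex^1^('k::finite option)" where
  "line_matrix = (\<chi> i j. if i = None then 1 else 0)"

lemma line_matrix_mult: "line_matrix *v t = fpair (t $ 1) 0"
proof -
  have "(line_matrix *v t) $ i = fpair (t $ 1) 0 $ i" for i :: "'a option"
    by (cases i) (simp_all add: line_matrix_def matrix_vector_mult_def UNIV_1)
  then show ?thesis by (simp add: vec_eq_iff)
qed

definition fibre_matrix :: "complex^'k^('k::finite option)" where
  "fibre_matrix = (\<chi> i j. if i = Some j then 1 else 0)"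

lemma fibre_matrix_mult: "fibre_matrix *v u = fpair 0 u"
proof -
  have "(fibre_matrix *v u) $ i = fpair 0 u $ i" for i :: "'a option"
    by (cases i) (simp_all add: fibre_matrix_def matrix_vector_mult_def if_distrib if_distribR cong: if_cong)
  then show ?thesis by (simp add: vec_eq_iff)
qed

lemma cdiff_line: "cdiff (\<lambda>t::complex^1. fpair (t $ 1) c) a"
    "jacobian (\<lambda>t::complex^1. fpair (t $ 1) c) (at a) *v h = fpair (h $ 1) 0"
proof -
  have e: "(\<lambda>t::complex^1. fpair (t $ 1) c) = (\<lambda>t. fpair 0 c + line_matrix *v (t - 0))"
    by (rule ext) (simp add: line_matrix_mult vec_option_eq_iff)
  show "cdiff (\<lambda>t::complex^1. fpair (t $ 1) c) a"
    "jacobian (\<lambda>t::complex^1. fpair (t $ 1) c) (at a) *v h = fpair (h $ 1) 0"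
    unfolding e cdiff_affine(2) by (rule cdiff_affine(1), rule line_matrix_mult)
qed

lemma cdiff_fibre: "cdiff (\<lambda>u::complex^'k. fpair z u) a"
    "jacobian (\<lambda>u::complex^'k::finite. fpair z u) (at a) *v h = fpair 0 h"
proof -
  have e: "(\<lambda>u::complex^'k. fpair z u) = (\<lambda>u. fpair z 0 + fibre_matrix *v (u - 0))"
    by (rule ext) (simp add: fibre_matrix_mult vec_option_eq_iff)
  show "cdiff (\<lambda>u::complex^'k. fpair z u) a"
    "jacobian (\<lambda>u::complex^'k. fpair z u) (at a) *v h = fpair 0 h"
    using cdiff_affine[of "fpair z 0" fibre_matrix 0 a, folded e] by (simp_all only: fibre_matrix_mult)
qed

section \<open>The tangent space of a curve and the Kodaira class in fibre coordinates\<close>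

context curve_patch
begin

definition curve :: "'x \<Rightarrow> complex \<Rightarrow> complex^'k" where
  "curve x z = w (sect x (pt z))"

definition curve' :: "'x \<Rightarrow> complex \<Rightarrow> complex^'k" where
  "curve' x z = jacobian (\<lambda>t::complex^1. curve x (t $ 1)) (at (vec z)) *v 1"

lemma curve_open:
  assumes x: "x \<in> topspace (mtop M)" and D: "openin (mtop Z) D"
  shows "open {t::complex^1. sect x (pt (t $ 1)) \<in> D}"
proof -
  let ?b = "(B, \<lambda>q. vec (l q) :: complex^1)" and ?D = "{p \<in> topspace (mtop P1). sect x p \<in> D}"
  have img: "snd ?b ` (fst ?b \<inter> ?D) = {t::complex^1. sect x (pt (t $ 1)) \<in> D}"
  proof (intro set_eqI iffI)
    fix t :: "complex^1" assume "t \<in> {t. sect x (pt (t $ 1)) \<in> D}"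
    moreover have "t = vec (l (pt (t $ 1)))" by (simp add: pt(2) vec_eq_iff forall_1)
    ultimately show "t \<in> snd ?b ` (fst ?b \<inter> ?D)"
      using pt(1) by (intro image_eqI[of _ _ "pt (t $ 1)"]) (auto simp: topspace_P1)
  qed (auto simp: pt(3))
  have "openin (mtop P1) ?D"
    using sect_props(4)[OF x] D unfolding holomorphic_map_def continuous_map_def by blast
  from charts_props(7)[OF Bch this] show ?thesis unfolding img .
qed

lemma curve_coords:
  assumes x: "x \<in> topspace (mtop M)"
  shows "cdiff (\<lambda>t::complex^1. fpair (t $ 1) (curve x (t $ 1))) (vec z)"
    "cdiff (\<lambda>t::complex^1. curve x (t $ 1)) (vec z)"
    "jacobian (\<lambda>t::complex^1. fpair (t $ 1) (curve x (t $ 1))) (at (vec z)) *v 1 = fpair 1 (curve' x z)"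
    "((\<lambda>z. curve x z $ i) has_field_derivative curve' x z $ i) (at z)"
proof -
  have "cdiff (\<lambda>t::complex^1. snd cW (sect x (pt (t $ 1)))) (vec z)"
    by (rule curve_cdiff(1)[OF x W_chart(1)]) (simp add: sect_in_W[OF x])
  then show 1: "cdiff (\<lambda>t::complex^1. fpair (t $ 1) (curve x (t $ 1))) (vec z)"
    by (simp add: fibre_map_sect[OF x] curve_def)
  show 2: "cdiff (\<lambda>t::complex^1. curve x (t $ 1)) (vec z)"
    using cdiff_ftail(1)[OF 1] by simp
  show "jacobian (\<lambda>t::complex^1. fpair (t $ 1) (curve x (t $ 1))) (at (vec z)) *v 1 = fpair 1 (curve' x z)"
    using cdiff_fpair(2)[OF cdiff_line(1)[of 0 "vec z"] 2, of 1]
    by (simp add: cdiff_line(2) curve'_def)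
  have "(jacobian (\<lambda>t::complex^1. curve x (t $ 1)) (at (vec z))) $ i $ 1 = curve' x z $ i"
    by (simp add: curve'_def matrix_vector_mult_def UNIV_1)
  then show "((\<lambda>z. curve x z $ i) has_field_derivative curve' x z $ i) (at z)"
    using cdiff_curveD[OF 2, of i] by simp
qed

lemma curve_holomorphic:
  assumes x: "x \<in> topspace (mtop M)"
  shows "(\<lambda>z. curve x z $ i) holomorphic_on UNIV" "(\<lambda>z. curve' x z $ i) holomorphic_on UNIV"
proof -
  show 1: "(\<lambda>z. curve x z $ i) holomorphic_on UNIV"
    using curve_coords(4)[OF x] by (auto simp: holomorphic_on_def field_differentiable_def)
  have "(\<lambda>z. curve' x z $ i) = deriv (\<lambda>z. curve x z $ i)"
    using DERIV_imp_deriv[OF curve_coords(4)[OF x]] by auto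
  then show "(\<lambda>z. curve' x z $ i) holomorphic_on UNIV" using holomorphic_deriv[OF 1] by simp
qed

lemma W_coords:
  assumes "p \<in> W"
  shows "cdiff (fibre_map l \<pi> w \<circ> chart_inv cW) (fibre_map l \<pi> w p)"
    "jacobian (fibre_map l \<pi> w \<circ> chart_inv cW) (at (fibre_map l \<pi> w p)) = mat 1"
    "cdiff (w \<circ> chart_inv cW) (fibre_map l \<pi> w p)"
    "jacobian (w \<circ> chart_inv cW) (at (fibre_map l \<pi> w p)) *v h = ftail h"
proof -
  let ?u = "fibre_map l \<pi> w p"
  have u: "?u \<in> snd cW ` fst cW" using assms by simp
  have id: "cdiff (\<lambda>x. x) ?u" "jacobian (\<lambda>x. x) (at ?u) = mat 1"
    using cdiff_linear[of "mat 1 :: complex^'k option^'k option" ?u] by simp_all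
  note tr = cdiff_transform[OF id(1) charts_props(3)[OF W_chart(1)] u, of "fibre_map l \<pi> w \<circ> chart_inv cW"]
  have e: "v = (fibre_map l \<pi> w \<circ> chart_inv cW) v" if "v \<in> snd cW ` fst cW" for v
    using charts_props(5)[OF W_chart(1) that] by simp
  show 1: "cdiff (fibre_map l \<pi> w \<circ> chart_inv cW) ?u" by (rule tr(1)[OF e])
  show 2: "jacobian (fibre_map l \<pi> w \<circ> chart_inv cW) (at ?u) = mat 1" using tr(2)[OF e] id(2) by simp
  have we: "w \<circ> chart_inv cW = (\<lambda>u. ftail ((fibre_map l \<pi> w \<circ> chart_inv cW) u))"
    by (simp add: fibre_map_fpair comp_def)
  show "cdiff (w \<circ> chart_inv cW) ?u" "jacobian (w \<circ> chart_inv cW) (at ?u) *v h = ftail h"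
    unfolding we using cdiff_ftail[OF 1] 2 by simp_all
qed

abbreviation vtan :: "'z \<Rightarrow> complex^('k option) \<Rightarrow> ('z, 'k option) tangent" where
  "vtan p \<equiv> tangent_of Z p cW"

lemma vtan:
  assumes "p \<in> W"
  shows "vtan p \<eta> \<in> tangent_space Z p" "vtan p \<eta> cW = \<eta>"
    "v \<in> tangent_space Z p \<Longrightarrow> v cW = \<eta> \<Longrightarrow> v = vtan p \<eta>"
  using tangent_of[OF Z W_chart(2)[OF assms]] tangent_eqI[OF _ _ W_chart(2)[OF assms]] by auto

lemma curve_tangent:
  fixes z :: complex
  assumes x: "x \<in> topspace (mtop M)"
  defines "p \<equiv> sect x (pt z)"
  shows "v \<in> sub_tangent_space Z (submfd_at F x) p \<longleftrightarrow>
    v \<in> tangent_space Z p \<and> v cW = v cW $ None *s fpair 1 (curve' x z)"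
proof
  let ?X = "submfd_at F x"
  have pW: "p \<in> W" using sect_in_W[OF x] by (simp add: p_def)
  have cWp: "fibre_map l \<pi> w p = fpair z (curve x z)" unfolding p_def fibre_map_sect[OF x] curve_def ..
  {
    assume v: "v \<in> tangent_space Z p \<and> v cW = v cW $ None *s fpair 1 (curve' x z)"
    show "v \<in> sub_tangent_space Z ?X p"
      unfolding sub_tangent_space_def mem_Collect_eq
    proof (intro conjI allI impI ballI)
      fix e J j assume e: "slice_chart Z ?X p e J" and j: "j \<in> J"
      have ec: "e \<in> charts_at Z p" and sl: "snd e ` (fst e \<inter> ?X) = {u \<in> snd e ` fst e. \<forall>j\<in>J. u $ j = 0}"
        using e by (auto simp: slice_chart_def)
      have e': "e \<in> charts Z" "sect x (pt z) \<in> fst e" using ec by (auto simp: charts_at_def p_def)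
      let ?g = "\<lambda>t::complex^1. snd e (sect x (pt (t $ 1)))"
      let ?T = "{t::complex^1. sect x (pt (t $ 1)) \<in> fst e}"
      have g: "cdiff ?g (vec z)" by (rule curve_cdiff(1)[OF x e'])
      have T: "open ?T" "vec z \<in> ?T" using curve_cdiff(2)[OF x e'] e'(2) by auto
      have "?g t $ j = 0" if "t \<in> ?T" for t
        using that sl sect_props(1)[OF x] j by blast
      then have "((\<lambda>t. ?g t $ j) has_derivative (\<lambda>h. 0)) (at (vec z))"
        by (intro has_derivative_transform_within_open[OF has_derivative_const T]) simp
      then have z0: "(jacobian ?g (at (vec z)) *v h) $ j = 0" for h
        using has_derivative_unique[OF derivative_component[OF g]] by metis
      let ?c = "\<lambda>t::complex^1. fpair (t $ 1) (curve x (t $ 1))"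
      have cc: "cdiff (snd e \<circ> chart_inv cW) (?c (vec z))"
        using charts_compatible[OF Z W_chart(2)[OF pW] ec] cWp by simp
      note comp = cdiff_compose[OF curve_coords(1)[OF x, of z] cc]
      have "((snd e \<circ> chart_inv cW) \<circ> ?c) t = ?g t" for t :: "complex^1"
        using charts_props(4)[OF W_chart(1), of "sect x (pt (t $ 1))"] sect_in_W[OF x, of "t $ 1"]
          fibre_map_sect[OF x, of "t $ 1"] by (simp add: curve_def)
      then have eq: "(snd e \<circ> chart_inv cW) \<circ> ?c = ?g" by blast
      have cz: "?c (vec z) = fibre_map l \<pi> w p" by (simp add: cWp)
      have J: "jacobian ?g (at (vec z)) =
          jacobian (snd e \<circ> chart_inv cW) (at (fibre_map l \<pi> w p)) ** jacobian ?c (at (vec z))"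
        using comp(2) unfolding eq cz .
      have "v e = jacobian (snd e \<circ> chart_inv cW) (at (fibre_map l \<pi> w p)) *v v cW"
        using tangent_space_change[of v Z p cW e] v W_chart(2)[OF pW] ec by simp
      also have "v cW = v cW $ None *s (jacobian ?c (at (vec z)) *v 1)"
        using v curve_coords(3)[OF x] by simp
      also have "jacobian (snd e \<circ> chart_inv cW) (at (fibre_map l \<pi> w p)) *v \<dots>
          = v cW $ None *s (jacobian ?g (at (vec z)) *v 1)"
        by (simp only: J vector_scalar_commute matrix_vector_mul_assoc)
      finally show "v e $ j = 0" using z0 by simp
    qed (use v in simp)
  }
  {
    assume v: "v \<in> sub_tangent_space Z ?X p"
    then have vT: "v \<in> tangent_space Z p" by (simp add: sub_tangent_space_def)
    \<comment> \<open>A shear of the whole coordinate space, available because the curve is defined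
      for all values of \<lambda>. \<open>\<sigma> (-1)\<close> straightens the curve and
      \<open>\<sigma> 1\<close> undoes it.\<close>
    define \<sigma> where "\<sigma> = (\<lambda>k u. fpair (u $ None) (ftail u + k *s curve x (u $ None)))"
    have head: "cdiff (\<lambda>u. curve x (u $ None)) u"
      "jacobian (\<lambda>u. curve x (u $ None)) (at u) *v h = h $ None *s curve' x (u $ None)" for u h :: "complex^('k option)"
    proof -
      have hm: "cdiff (\<lambda>u. head_matrix *v u) u" "jacobian (\<lambda>u. head_matrix *v u) (at u) = head_matrix"
        by (rule cdiff_linear)+
      have "cdiff (\<lambda>t::complex^1. curve x (t $ 1)) (head_matrix *v u)"
        unfolding head_matrix_mult by (rule curve_coords(2)[OF x])
      note c = cdiff_compose[OF hm(1) this]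
      have e: "(\<lambda>t::complex^1. curve x (t $ 1)) \<circ> (\<lambda>u. head_matrix *v u) = (\<lambda>u. curve x (u $ None))"
        by (auto simp: head_matrix_mult)
      show "cdiff (\<lambda>u. curve x (u $ None)) u" using c(1) unfolding e .
      have "vec (h $ None) = h $ None *s (1 :: complex^1)" by (simp add: vec_eq_iff)
      then show "jacobian (\<lambda>u. curve x (u $ None)) (at u) *v h = h $ None *s curve' x (u $ None)"
        using c(2) unfolding e hm(2)
        by (simp add: matrix_vector_mul_assoc[symmetric] head_matrix_mult vector_scalar_commute curve'_def)
    qed
    have idc: "cdiff (\<lambda>x. x) u" "jacobian (\<lambda>x. x) (at u) = mat 1" for u :: "complex^('k option)"
      using cdiff_linear[of "mat 1 :: complex^'k option^'k option" u] by simp_all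
    have tl: "cdiff ftail u" "jacobian ftail (at u) *v h = ftail h" for u h :: "complex^('k option)"
      using cdiff_ftail(1)[OF idc(1)[of u]] cdiff_ftail(2)[OF idc(1)[of u], of h] by (simp_all add: idc(2))
    have \<sigma>c: "cdiff (\<sigma> k) u" for k u
      unfolding \<sigma>_def by (intro cdiff_fpair(1)[OF idc(1)] cdiff_add_scaled(1) tl head)
    have \<sigma>j: "jacobian (\<sigma> k) (at u) *v h = fpair (h $ None) (ftail h + k *s (h $ None *s curve' x (u $ None)))" for k u h
      unfolding \<sigma>_def
      by (simp add: cdiff_fpair(2)[OF idc(1) cdiff_add_scaled(1)[OF tl(1) head(1)]]
          cdiff_add_scaled(2)[OF tl(1) head(1)] tl head idc(2))
    have \<sigma>inv: "\<sigma> k (\<sigma> (- k) u) = u" for k u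
      by (simp add: \<sigma>_def vec_option_eq_iff)
    let ?c = "(W, \<sigma> (-1) \<circ> fibre_map l \<pi> w)"
    have cC: "?c \<in> charts Z"
      using charts_compose[OF Z W_chart(1), of "\<sigma> (-1)" "\<sigma> 1"] \<sigma>c \<sigma>inv[of 1] \<sigma>inv[of "-1"] by simp
    have sl: "slice_chart Z ?X p ?c (range Some)"
      unfolding slice_chart_def
    proof (intro conjI set_eqI iffI)
      show "?c \<in> charts_at Z p" using cC pW by (simp add: charts_at_def)
      fix u assume "u \<in> snd ?c ` (fst ?c \<inter> ?X)"
      then obtain q where q: "q \<in> W" "q \<in> ?X" "u = \<sigma> (-1) (fibre_map l \<pi> w q)" by auto
      have "q = sect x (pt (l (\<pi> q)))" using sect_props(3)[OF x q(2)] pt(3) W_chart(3)[OF q(1)] by simp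
      then have "w q = curve x (l (\<pi> q))" by (simp add: curve_def)
      then have "\<forall>j\<in>range Some. u $ j = 0" unfolding q(3) by (simp add: \<sigma>_def fibre_map_fpair)
      moreover have "u \<in> snd ?c ` fst ?c" using q(1,3) by (intro image_eqI[of _ _ q]) simp_all
      ultimately show "u \<in> {u \<in> snd ?c ` fst ?c. \<forall>j\<in>range Some. u $ j = 0}" by simp
    next
      fix u assume "u \<in> {u \<in> snd ?c ` fst ?c. \<forall>j\<in>range Some. u $ j = 0}"
      then obtain q where q: "q \<in> W" "u = \<sigma> (-1) (fibre_map l \<pi> w q)" "\<And>\<mu>. u $ Some \<mu> = 0" by auto
      define q' where "q' = sect x (pt (l (\<pi> q)))"
      have "w q = curve x (l (\<pi> q))"
        using q(3) unfolding q(2) by (simp add: \<sigma>_def fibre_map_fpair vec_eq_iff)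
      then have "fibre_map l \<pi> w q = fibre_map l \<pi> w q'"
        unfolding q'_def fibre_map_sect[OF x] by (simp add: fibre_map_fpair curve_def)
      moreover have "q' \<in> W" "q' \<in> ?X" unfolding q'_def by (rule sect_in_W[OF x], rule sect_props(1)[OF x])
      ultimately show "u \<in> snd ?c ` (fst ?c \<inter> ?X)" using q(2) by (intro image_eqI[of _ _ q']) auto
    qed
    have "v ?c = jacobian (snd ?c \<circ> chart_inv cW) (at (fibre_map l \<pi> w p)) *v v cW"
      using tangent_space_change[OF vT W_chart(2)[OF pW], of ?c] sl by (simp add: slice_chart_def)
    also have "jacobian (snd ?c \<circ> chart_inv cW) (at (fibre_map l \<pi> w p)) = jacobian (\<sigma> (-1)) (at (fibre_map l \<pi> w p))"
    proof -
      have e: "(fibre_map l \<pi> w \<circ> chart_inv cW) (fibre_map l \<pi> w p) = fibre_map l \<pi> w p"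
        using charts_props(4)[OF W_chart(1), of p] pW by simp
      show ?thesis
        using cdiff_compose(2)[OF W_coords(1)[OF pW], of "\<sigma> (-1)"] \<sigma>c W_coords(2)[OF pW] unfolding e
        by (simp add: comp_assoc)
    qed
    also have "jacobian (\<sigma> (-1)) (at (fibre_map l \<pi> w p)) *v v cW =
        fpair (v cW $ None) (ftail (v cW) - v cW $ None *s curve' x z)"
      unfolding \<sigma>j cWp by (simp add: vec_option_eq_iff)
    finally have vc: "v ?c = fpair (v cW $ None) (ftail (v cW) - v cW $ None *s curve' x z)" .
    have "v ?c $ Some \<mu> = 0" for \<mu>
      using v sl unfolding sub_tangent_space_def by blast
    then have "v cW = v cW $ None *s fpair 1 (curve' x z)" unfolding vc by (simp add: vec_option_eq_iff)
    then show "v \<in> tangent_space Z p \<and> v cW = v cW $ None *s fpair 1 (curve' x z)" using vT by blast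
  }
qed

text \<open>In fibre coordinates \<pi> is the projection onto the component \<open>None\<close>,
  followed by a change of charts of \<open>P1\<close>; in the chart of the patch itself this change
  is the identity.\<close>

lemma vertical_components:
  assumes p: "p \<in> W" and t: "t \<in> tangent_space Z p"
  shows "differential Z P1 \<pi> p t = (\<lambda>_. 0) \<longleftrightarrow> t cW $ None = 0" "mderiv Z w p t = ftail (t cW)"
proof -
  show "mderiv Z w p t = ftail (t cW)"
    using mderiv_chart[OF Z t W_chart(2)[OF p], of w] W_coords(3,4)[OF p] by simp
  let ?b = "(B, \<lambda>q. vec (l q) :: complex^1)" and ?u = "fibre_map l \<pi> w p"
  have bp: "?b \<in> charts_at P1 (\<pi> p)" using Bch W_chart(3)[OF p] by (simp add: charts_at_def)
  have md: "mderiv Z (snd e \<circ> \<pi>) p t = jacobian (snd e \<circ> chart_inv ?b) (at (vec (l (\<pi> p)))) *v vec (t cW $ None)"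
    if e: "e \<in> charts_at P1 (\<pi> p)" for e
  proof -
    have e': "e \<in> charts P1" "\<pi> p \<in> fst e" using e by (auto simp: charts_at_def)
    have hu: "head_matrix *v ?u = vec (l (\<pi> p))" by (simp add: head_matrix_mult fibre_map_fpair)
    have "cdiff (snd e \<circ> chart_inv ?b) (head_matrix *v ?u)"
      using chart_atlas_cdiff(2)[OF e'(1) Bat e'(2)] W_chart(3)[OF p] by (simp add: hu)
    note c = cdiff_compose[OF cdiff_linear(1) this]
    have u: "?u \<in> snd cW ` fst cW" using p by simp
    have eq: "((snd e \<circ> chart_inv ?b) \<circ> (\<lambda>u. head_matrix *v u)) v = ((snd e \<circ> \<pi>) \<circ> chart_inv cW) v"
      if "v \<in> snd cW ` fst cW" for v
    proof -
      from that obtain q where q: "q \<in> W" "v = fibre_map l \<pi> w q" by auto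
      then have "chart_inv cW v = q" using charts_props(4)[OF W_chart(1), of q] by simp
      then show ?thesis using q pt(3)[OF W_chart(3)[OF q(1)]]
        by (simp add: head_matrix_mult fibre_map_fpair Binv)
    qed
    note tr = cdiff_transform[where g = "(snd e \<circ> \<pi>) \<circ> chart_inv cW", OF c(1) charts_props(3)[OF W_chart(1)] u eq]
    have "mderiv Z (snd e \<circ> \<pi>) p t = jacobian ((snd e \<circ> \<pi>) \<circ> chart_inv cW) (at ?u) *v t cW"
      using mderiv_chart[OF Z t W_chart(2)[OF p], of "snd e \<circ> \<pi>"] tr(1) by (simp only: snd_conv)
    also have "\<dots> = (jacobian (snd e \<circ> chart_inv ?b) (at (head_matrix *v ?u)) ** head_matrix) *v t cW"
      by (simp only: tr(2) c(2) cdiff_linear(2))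
    finally show ?thesis unfolding hu by (simp only: matrix_vector_mul_assoc[symmetric] head_matrix_mult)
  qed
  have b1: "jacobian (snd ?b \<circ> chart_inv ?b) (at (vec (l (\<pi> p)))) = mat 1"
  proof -
    have "snd ?b \<circ> chart_inv ?b = (\<lambda>u. mat 1 *v u)"
      by (rule ext) (simp add: Binv pt(2) vec_eq_iff forall_1)
    then show ?thesis using cdiff_linear(2)[of "mat 1 :: complex^1^1"] by simp
  qed
  show "differential Z P1 \<pi> p t = (\<lambda>_. 0) \<longleftrightarrow> t cW $ None = 0"
  proof
    assume "differential Z P1 \<pi> p t = (\<lambda>_. 0)"
    then have "mderiv Z (snd ?b \<circ> \<pi>) p t = 0" using bp unfolding differential_def by metis
    then show "t cW $ None = 0" unfolding md[OF bp] b1 by (simp add: vec_eq_iff)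
  next
    assume "t cW $ None = 0"
    then have "mderiv Z (snd e \<circ> \<pi>) p t = 0" if "e \<in> charts_at P1 (\<pi> p)" for e
      unfolding md[OF that] by (simp add: vec_eq_iff matrix_vector_mult_def)
    then show "differential Z P1 \<pi> p t = (\<lambda>_. 0)" unfolding differential_def by auto
  qed
qed

text \<open>A vertical vector is determined by its fibre components, so the union in
  \<open>normal_of_components\<close> runs over a single vector.\<close>

lemma normal_of_components_eq:
  assumes p: "p \<in> W"
  shows "normal_of_components Z \<pi> S w p s = normal_coset Z S p (vtan p (fpair 0 s))"
proof -
  have "{t \<in> tangent_space Z p. differential Z P1 \<pi> p t = (\<lambda>_. 0) \<and> mderiv Z w p t = s} = {vtan p (fpair 0 s)}"
  proof (intro set_eqI iffI)
    fix t assume "t \<in> {t \<in> tangent_space Z p. differential Z P1 \<pi> p t = (\<lambda>_. 0) \<and> mderiv Z w p t = s}"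
    then have t: "t \<in> tangent_space Z p" "t cW = fpair 0 s"
      using vertical_components[OF p, of t] by (auto simp: fpair_eq_iff)
    then show "t \<in> {vtan p (fpair 0 s)}" using vtan(3)[OF p] by simp
  next
    fix t assume "t \<in> {vtan p (fpair 0 s)}"
    then show "t \<in> {t \<in> tangent_space Z p. differential Z P1 \<pi> p t = (\<lambda>_. 0) \<and> mderiv Z w p t = s}"
      using vertical_components[OF p vtan(1)[OF p]] vtan(1,2)[OF p] by simp
  qed
  then show ?thesis unfolding normal_of_components_def by simp
qed

text \<open>Freezing \<lambda> or freezing \<open>x\<close> in \<open>graph_fun\<close> gives its
  two partial derivatives. One Jacobian thus describes both \<open>dw\<close> and the direction of
  the curve.\<close>

lemma d_restr_eq:
  assumes x: "x \<in> topspace (mtop M)" and d: "d \<in> charts_at M x" and \<theta>: "\<theta> \<in> tangent_space M x"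
  shows "cdiff (restr \<pi> F w (pt z) \<circ> chart_inv d) (snd d x)"
    "d_restr M \<pi> F w (pt z) x \<theta> = jacobian (graph_fun d) (at (fpair z (snd d x))) *v fpair 0 (\<theta> d)"
    "curve' x z = jacobian (graph_fun d) (at (fpair z (snd d x))) *v fpair 1 0"
proof -
  let ?y = "fpair z (snd d x)"
  note gf = graph_derivative(1)[OF x d, of z]
  have e: "graph_fun d \<circ> (\<lambda>u. fpair z u) = restr \<pi> F w (pt z) \<circ> chart_inv d"
    by (auto simp: graph_fun_def restr_sect)
  note c = cdiff_compose[OF cdiff_fibre(1)[of z "snd d x"] gf, unfolded e]
  show 1: "cdiff (restr \<pi> F w (pt z) \<circ> chart_inv d) (snd d x)" by (rule c(1))
  show "d_restr M \<pi> F w (pt z) x \<theta> = jacobian (graph_fun d) (at ?y) *v fpair 0 (\<theta> d)"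
    unfolding d_restr_def mderiv_chart[OF M \<theta> d 1] c(2)
    by (simp add: matrix_vector_mul_assoc[symmetric] cdiff_fibre(2))
  have d': "d \<in> charts M" "x \<in> fst d" using d by (auto simp: charts_at_def)
  have e2: "graph_fun d \<circ> (\<lambda>t::complex^1. fpair (t $ 1) (snd d x)) = (\<lambda>t. curve x (t $ 1))"
    using charts_props(4)[OF d'] by (auto simp: graph_fun_def curve_def)
  have gf': "cdiff (graph_fun d) (fpair (vec z $ 1) (snd d x))" using gf by simp
  from cdiff_compose(2)[OF cdiff_line(1) gf'] 
  show "curve' x z = jacobian (graph_fun d) (at ?y) *v fpair 1 0"
    unfolding curve'_def e2 by (simp add: matrix_vector_mul_assoc[symmetric] cdiff_line(2))
qed

lemma d_restr_lincomb:
  assumes x: "x \<in> topspace (mtop M)" and \<theta>: "\<theta> \<in> tangent_space M x" "\<eta> \<in> tangent_space M x"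
  shows "d_restr M \<pi> F w (pt z) x (lincomb a \<theta> b \<eta>) =
    a *s d_restr M \<pi> F w (pt z) x \<theta> + b *s d_restr M \<pi> F w (pt z) x \<eta>"
proof -
  obtain d where d: "d \<in> charts_at M x" by (rule atlas_manifold_cover[OF M x])
  have "fpair 0 (lincomb a \<theta> b \<eta> d) = a *s fpair 0 (\<theta> d) + b *s fpair 0 (\<eta> d)"
    by (simp add: lincomb_def vec_option_eq_iff)
  then show ?thesis
    using d_restr_eq(2)[OF x d] \<theta> tangent_space_lincomb[OF \<theta>]
    by (simp add: matrix_vector_right_distrib vector_scalar_commute)
qed

text \<open>Let \<open>t\<close> be the projection to \<open>Z\<close> of a lift of \<theta>. By
  \<open>graph_derivative\<close> its fibre part is \<open>dw\<close> plus its \<lambda>-component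
  times \<open>curve'\<close>, so it differs from the vertical vector by a multiple of
  \<open>fpair 1 (curve' x z)\<close>, which is tangent to the curve. All lifts give the same coset,
  and the submersion onto \<open>M\<close> provides one.\<close>

lemma kodaira_eq:
  fixes z :: complex
  assumes x: "x \<in> topspace (mtop M)" and \<theta>: "\<theta> \<in> tangent_space M x"
  defines "p \<equiv> sect x (pt z)"
  shows "kodaira Z M F x \<theta> p =
    normal_coset Z (submfd_at F x) p (vtan p (fpair 0 (d_restr M \<pi> F w (pt z) x \<theta>)))"
proof -
  let ?X = "submfd_at F x" and ?s = "d_restr M \<pi> F w (pt z) x \<theta>"
  have NM: "atlas_manifold N" by (rule prod_atlas_manifold[OF Z M])
  obtain d where d: "d \<in> charts_at M x" by (rule atlas_manifold_cover[OF M x])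
  have pX: "p \<in> ?X" and pW: "p \<in> W" using sect_props(1)[OF x] sect_in_W[OF x] by (auto simp: p_def)
  have qF: "(p, x) \<in> F" using pX by (simp add: submfd_at_def)
  then have "(p, x) \<in> topspace (mtop N)"
    using fam by (auto simp: holomorphic_family_def complex_submanifold_def)
  then obtain c where c: "c \<in> charts_at N (p, x)" by (rule atlas_manifold_cover[OF NM])
  have coset: "normal_coset Z ?X p (differential N Z fst (p, x) \<xi>) = normal_coset Z ?X p (vtan p (fpair 0 ?s))"
    if \<xi>: "\<xi> \<in> sub_tangent_space N F (p, x)" "differential N M snd (p, x) \<xi> = \<theta>" for \<xi>
  proof -
    have \<xi>T: "\<xi> \<in> tangent_space N (p, x)" using \<xi>(1) by (simp add: sub_tangent_space_def)
    define t where "t = differential N Z fst (p, x) \<xi>"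
    have te: "t e = jacobian ((snd e \<circ> fst) \<circ> chart_inv c) (at (snd c (p, x))) *v \<xi> c" if "e \<in> charts_at Z p" for e
      using that mderiv_chart[OF NM \<xi>T c prod_cdiff(1)[OF Z M c that charts_compatible[OF Z that that]]]
      by (simp add: t_def differential_def)
    have tT: "t \<in> tangent_space Z p"
      unfolding tangent_space_def mem_Collect_eq
    proof (intro conjI ballI allI impI)
      fix e e' assume e: "e \<in> charts_at Z p" "e' \<in> charts_at Z p"
      show "t e' = jacobian (snd e' \<circ> chart_inv e) (at (snd e p)) *v t e"
        unfolding te[OF e(1)] te[OF e(2)] prod_chain[OF Z M c e(1) charts_compatible[OF Z e]]
        by (simp add: matrix_vector_mul_assoc)
    qed (simp add: t_def differential_def)
    have \<theta>d: "\<theta> d = jacobian ((snd d \<circ> snd) \<circ> chart_inv c) (at (snd c (p, x))) *v \<xi> c"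
      using mderiv_chart[OF NM \<xi>T c prod_cdiff(2)[OF Z M c d charts_compatible[OF M d d]]] d
      by (simp add: \<xi>(2)[symmetric] differential_def)
    have tW: "t cW = jacobian ((fibre_map l \<pi> w \<circ> fst) \<circ> chart_inv c) (at (snd c (p, x))) *v \<xi> c"
      using te[OF W_chart(2)[OF pW]] by simp
    have "ftail (t cW) = jacobian (graph_fun d) (at (fpair z (snd d x))) *v fpair (t cW $ None) (\<theta> d)"
      using graph_derivative(2)[OF x d, of c z \<xi>] c \<xi>(1) unfolding p_def[symmetric] Let_def tW \<theta>d by simp
    also have "fpair (t cW $ None) (\<theta> d) = fpair 0 (\<theta> d) + t cW $ None *s fpair 1 0"
      using fpair_add[of 0 "\<theta> d" "t cW $ None" 1 0] by simp
    also have "jacobian (graph_fun d) (at (fpair z (snd d x))) *v \<dots> = ?s + t cW $ None *s curve' x z"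
      by (simp add: matrix_vector_right_distrib vector_scalar_commute d_restr_eq[OF x d \<theta>])
    finally have tt: "ftail (t cW) = ?s + t cW $ None *s curve' x z" .
    let ?v = "lincomb 1 t (-1) (vtan p (fpair 0 ?s))"
    have "?v \<in> tangent_space Z p" by (rule tangent_space_lincomb[OF tT vtan(1)[OF pW]])
    moreover have "?v cW = ?v cW $ None *s fpair 1 (curve' x z)"
    proof -
      have "?v cW = t cW + (-1) *s fpair 0 ?s" using vtan(2)[OF pW] by (simp add: lincomb_def)
      moreover have "t cW $ Some \<mu> = ?s $ \<mu> + t cW $ None * curve' x z $ \<mu>" for \<mu>
        using arg_cong[OF tt, of "\<lambda>v. v $ \<mu>"] by simp
      ultimately show ?thesis by (simp add: vec_option_eq_iff)
    qed
    ultimately have "?v \<in> tangent_space Z p \<and> ?v cW = ?v cW $ None *s fpair 1 (curve' x z)" by blast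
    then have "?v \<in> sub_tangent_space Z ?X p" using curve_tangent[OF x, of ?v z] by (simp add: p_def)
    then show ?thesis unfolding t_def[symmetric] by (rule normal_coset_eqI[OF tT vtan(1)[OF pW]])
  qed
  have "\<theta> \<in> differential N M snd (p, x) ` sub_tangent_space N F (p, x)"
    using family_submersion[OF qF] \<theta> by simp
  then obtain \<xi> where "\<xi> \<in> sub_tangent_space N F (p, x)" "differential N M snd (p, x) \<xi> = \<theta>"
    by (elim imageE) simp
  then show ?thesis unfolding kodaira_def using pX coset by auto
qed

text \<open>A local field \<open>V\<close> that represents the Kodaira class need not be vertical.
  Its difference from the vertical representative is tangent to the curve, so \<open>dw\<close> is
  the fibre part of \<open>V\<close> minus its \<lambda>-component times \<open>curve'\<close>, and
  all of these are holomorphic along the curve.\<close>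

lemma d_restr_holomorphic:
  assumes comp: "complete_family Z M F" and x: "x \<in> topspace (mtop M)" and \<theta>: "\<theta> \<in> tangent_space M x"
  shows "(\<lambda>z. d_restr M \<pi> F w (pt z) x \<theta> $ i) holomorphic_on UNIV"
proof -
  let ?X = "submfd_at F x" and ?s = "\<lambda>z. d_restr M \<pi> F w (pt z) x \<theta>"
  have "(\<lambda>z. ?s z $ i) field_differentiable at z0" for z0
  proof -
    let ?p = "\<lambda>t::complex^1. sect x (pt (t $ 1))"
    have H: "kodaira Z M F x \<theta> \<in> H0_normal Z ?X"
      using comp x \<theta> unfolding complete_family_def bij_betw_def by blast
    then obtain D V where DV: "openin (mtop Z) D" "sect x (pt z0) \<in> D" "holomorphic_field Z D V"
      "\<And>q. q \<in> D \<inter> ?X \<Longrightarrow> V q \<in> kodaira Z M F x \<theta> q"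
      using sect_props(1)[OF x] unfolding H0_normal_def by blast
    define T where "T = (\<lambda>z. vec z :: complex^1) -` {t. ?p t \<in> D}"
    have T: "open T" "z0 \<in> T"
    proof -
      have "continuous_on UNIV (\<lambda>z. vec z :: complex^1)"
        unfolding vec_def by (intro continuous_on_vec_lambda continuous_on_id)
      then show "open T" unfolding T_def by (rule open_vimage[OF curve_open[OF x DV(1)]])
      show "z0 \<in> T" using DV(2) by (simp add: T_def)
    qed
    have Vc: "?s z $ i = V (sect x (pt z)) cW $ Some i - V (sect x (pt z)) cW $ None * curve' x z $ i" if "z \<in> T" for z
    proof -
      let ?q = "sect x (pt z)"
      have qD: "?q \<in> D" using that by (simp add: T_def)
      have qW: "?q \<in> W" by (rule sect_in_W[OF x])
      have "V ?q \<in> kodaira Z M F x \<theta> ?q" using DV(4) qD sect_props(1)[OF x] by blast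
      then have "lincomb 1 (V ?q) (-1) (vtan ?q (fpair 0 (?s z))) \<in> sub_tangent_space Z ?X ?q"
        unfolding kodaira_eq[OF x \<theta>] normal_coset_def by blast
      then have "lincomb 1 (V ?q) (-1) (vtan ?q (fpair 0 (?s z))) cW =
          lincomb 1 (V ?q) (-1) (vtan ?q (fpair 0 (?s z))) cW $ None *s fpair 1 (curve' x z)"
        unfolding curve_tangent[OF x] by blast
      then have "V ?q cW - fpair 0 (?s z) = V ?q cW $ None *s fpair 1 (curve' x z)"
        using vtan(2)[OF qW] by (simp add: lincomb_def)
      then have "(V ?q cW - fpair 0 (?s z)) $ Some i = (V ?q cW $ None *s fpair 1 (curve' x z)) $ Some i" by simp
      then show ?thesis by (simp add: algebra_simps)
    qed
    have Vd: "cdiff (\<lambda>t::complex^1. V (?p t) cW) (vec z0)"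
    proof -
      have qW: "sect x (pt z0) \<in> W" by (rule sect_in_W[OF x])
      have "holomorphic_fun Z (D \<inter> fst cW) (\<lambda>q. V q cW)"
        using DV(3) W_chart(1) unfolding holomorphic_field_def by blast
      then have "holo_on ((\<lambda>q. V q cW) \<circ> chart_inv cW) (snd cW ` (fst cW \<inter> (D \<inter> fst cW)))"
        using W_chart(1) unfolding holomorphic_fun_def by blast
      then have "cdiff ((\<lambda>q. V q cW) \<circ> chart_inv cW) (fibre_map l \<pi> w (sect x (pt z0)))"
        unfolding holo_on_cdiff using DV(2) qW by simp
      then have "cdiff ((\<lambda>q. V q cW) \<circ> chart_inv cW) (fpair (vec z0 $ 1) (curve x (vec z0 $ 1)))"
        by (simp add: fibre_map_sect[OF x] curve_def)
      from cdiff_compose(1)[OF curve_coords(1)[OF x] this]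
      have "cdiff (((\<lambda>q. V q cW) \<circ> chart_inv cW) \<circ> (\<lambda>t::complex^1. fpair (t $ 1) (curve x (t $ 1)))) (vec z0)" .
      moreover have "((\<lambda>q. V q cW) \<circ> chart_inv cW) \<circ> (\<lambda>t::complex^1. fpair (t $ 1) (curve x (t $ 1))) = (\<lambda>t. V (?p t) cW)"
      proof
        fix t :: "complex^1"
        show "(((\<lambda>q. V q cW) \<circ> chart_inv cW) \<circ> (\<lambda>t::complex^1. fpair (t $ 1) (curve x (t $ 1)))) t = V (?p t) cW"
          using charts_props(4)[OF W_chart(1), of "?p t"] sect_in_W[OF x, of "t $ 1"]
            fibre_map_sect[OF x, of "t $ 1"] by (simp add: curve_def)
      qed
      ultimately show ?thesis by simp
    qed
    have fd: "(\<lambda>z. V (sect x (pt z)) cW $ j) field_differentiable at z0" for j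
      using cdiff_curveD[OF Vd, of j] by (auto simp: field_differentiable_def)
    have c': "(\<lambda>z. curve' x z $ i) field_differentiable at z0"
      using holomorphic_on_imp_differentiable_at[OF curve_holomorphic(2)[OF x] open_UNIV] by simp
    have "(\<lambda>z. V (sect x (pt z)) cW $ Some i - V (sect x (pt z)) cW $ None * curve' x z $ i) field_differentiable at z0"
      by (intro field_differentiable_diff field_differentiable_mult fd c')
    then obtain D' where "((\<lambda>z. V (sect x (pt z)) cW $ Some i - V (sect x (pt z)) cW $ None * curve' x z $ i)
        has_field_derivative D') (at z0)" unfolding field_differentiable_def by blast
    then have "((\<lambda>z. ?s z $ i) has_field_derivative D') (at z0)"
      by (rule has_field_derivative_transform_within_open[OF _ T]) (simp add: Vc)
    then show ?thesis unfolding field_differentiable_def by blast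
  qed
  then show ?thesis by (simp add: holomorphic_on_def field_differentiable_at_within)
qed

end

section \<open>The normal patching and the frame\<close>

lemma choice3:
  assumes "\<And>x. x \<in> A \<Longrightarrow> \<exists>a b c. Q x a b c"
  shows "\<exists>a b c. \<forall>x\<in>A. Q x (a x) (b x) (c x)"
proof -
  have "\<forall>x\<in>A. \<exists>t. Q x (fst t) (fst (snd t)) (snd (snd t))" using assms by simp
  from bchoice[OF this] obtain t where "\<forall>x\<in>A. Q x (fst (t x)) (fst (snd (t x))) (snd (snd (t x)))" ..
  then show ?thesis
    by (intro exI[of _ "\<lambda>x. fst (t x)"] exI[of _ "\<lambda>x. fst (snd (t x))"] exI[of _ "\<lambda>x. snd (snd (t x))"])
qed

lemma cdiff_curve:
  fixes f :: "complex \<Rightarrow> complex^'m"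
  assumes "\<And>i. (\<lambda>z. f z $ i) field_differentiable at a"
  shows "cdiff (\<lambda>u::complex^1. f (u $ 1)) (vec a)"
proof -
  have "\<forall>i. \<exists>D. ((\<lambda>z. f z $ i) has_field_derivative D) (at a)"
    using assms unfolding field_differentiable_def by blast
  from choice[OF this] obtain D where "\<forall>i. ((\<lambda>z. f z $ i) has_field_derivative D i) (at a)" ..
  then have "((\<lambda>u::complex^1. \<chi> i. f (u $ 1) $ i) has_derivative (\<lambda>h. (\<chi> i j. D i) *v h)) (at (vec a))"
    by (intro cdiff_curveI) simp
  then show ?thesis unfolding cdiff_def by (auto simp: vec_lambda_eta)
qed

context curve_patch
begin

lemma kodaira_lincomb:
  fixes z :: complex
  assumes x: "x \<in> topspace (mtop M)" and \<theta>: "\<theta> \<in> tangent_space M x" "\<eta> \<in> tangent_space M x"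
  defines "p \<equiv> sect x (pt z)"
  assumes u: "u \<in> kodaira Z M F x \<theta> p" "u' \<in> kodaira Z M F x \<eta> p"
  shows "lincomb a u b u' \<in> kodaira Z M F x (lincomb a \<theta> b \<eta>) p"
proof -
  have pW: "p \<in> W" using sect_in_W[OF x] by (simp add: p_def)
  let ?s = "\<lambda>\<theta>. d_restr M \<pi> F w (pt z) x \<theta>"
  let ?V = "\<lambda>\<theta>. vtan p (fpair 0 (?s \<theta>))"
  have k: "kodaira Z M F x \<theta> p = normal_coset Z (submfd_at F x) p (?V \<theta>)" if "\<theta> \<in> tangent_space M x" for \<theta>
    using kodaira_eq[OF x that, of z] by (simp add: p_def)
  have uu: "u \<in> tangent_space Z p" "lincomb 1 u (-1) (?V \<theta>) \<in> sub_tangent_space Z (submfd_at F x) p"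
    "u' \<in> tangent_space Z p" "lincomb 1 u' (-1) (?V \<eta>) \<in> sub_tangent_space Z (submfd_at F x) p"
    using u unfolding k[OF \<theta>(1)] k[OF \<theta>(2)] by (auto simp: normal_coset_def)
  have "lincomb a (?V \<theta>) b (?V \<eta>) = ?V (lincomb a \<theta> b \<eta>)"
  proof (rule vtan(3)[OF pW])
    show "lincomb a (?V \<theta>) b (?V \<eta>) \<in> tangent_space Z p"
      by (intro tangent_space_lincomb vtan(1)[OF pW])
    show "lincomb a (?V \<theta>) b (?V \<eta>) cW = fpair 0 (?s (lincomb a \<theta> b \<eta>))"
      using vtan(2)[OF pW] d_restr_lincomb[OF x \<theta>] by (simp add: lincomb_def vec_option_eq_iff)
  qed
  then have V: "?V (lincomb a \<theta> b \<eta>) = lincomb a (?V \<theta>) b (?V \<eta>)" ..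
  have "lincomb 1 (lincomb a u b u') (-1) (?V (lincomb a \<theta> b \<eta>)) =
      lincomb a (lincomb 1 u (-1) (?V \<theta>)) b (lincomb 1 u' (-1) (?V \<eta>))"
    unfolding V by (auto simp: lincomb_def vec_eq_iff algebra_simps)
  then show ?thesis
    unfolding k[OF tangent_space_lincomb[OF \<theta>]] normal_coset_def
    using tangent_space_lincomb[OF uu(1,3)] sub_tangent_space_lincomb[OF uu(2,4)] by simp
qed

lemma kodaira_normal_of_components:
  assumes x: "x \<in> topspace (mtop M)" and \<theta>: "\<theta> \<in> tangent_space M x"
  shows "kodaira Z M F x \<theta> (sect x (pt z)) =
    normal_of_components Z \<pi> (submfd_at F x) w (sect x (pt z)) (d_restr M \<pi> F w (pt z) x \<theta>)"
  unfolding kodaira_eq[OF x \<theta>] normal_of_components_eq[OF sect_in_W[OF x]] ..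

end

section \<open>Both patches together: the normal patching and its cocycle\<close>

lemma hatpt_inverse: "z \<noteq> 0 \<Longrightarrow> hatpt (inverse z) = Some z"
  by (simp add: hatpt_def)

locale section_family =
  fixes Z :: "('z, 'k::finite option) cmfd"
    and M :: "('x, 'm::finite) cmfd"
    and \<pi> :: "'z \<Rightarrow> complex option"
    and F :: "('z \<times> 'x) set"
    and W What :: "'z set"
    and w what :: "'z \<Rightarrow> complex^'k"
  assumes Zm: "complex_manifold Z" and Mm: "complex_manifold M"
    and fam: "holomorphic_family Z M F" and comp: "complete_family Z M F"
    and sec: "\<And>x. x \<in> topspace (mtop M) \<Longrightarrow> is_section Z \<pi> (submfd_at F x)"
    and fW: "fibre_coordinates Z \<pi> patchU lam W w"
    and fWhat: "fibre_coordinates Z \<pi> patchUhat lamhat What what"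
    and sW: "\<And>x. x \<in> topspace (mtop M) \<Longrightarrow> submfd_at F x \<inter> \<pi> -` patchU \<subseteq> W"
    and sWhat: "\<And>x. x \<in> topspace (mtop M) \<Longrightarrow> submfd_at F x \<inter> \<pi> -` patchUhat \<subseteq> What"
begin

sublocale U: curve_patch Z M \<pi> F patchU lam Some W w
proof
  show "atlas_manifold Z" "atlas_manifold M" using Zm Mm complex_manifold_atlas by auto
  show "(patchU, \<lambda>q. vec (lam q)) \<in> matlas P1" by (simp add: P1_def)
  show "(patchU, \<lambda>q. vec (lam q)) \<in> charts P1" by (rule patchU_in_charts)
qed (rule fam sec fW sW patchU_chart(2) patchU_props | assumption)+

sublocale V: curve_patch Z M \<pi> F patchUhat lamhat hatpt What what
proof
  show "atlas_manifold Z" "atlas_manifold M" using Zm Mm complex_manifold_atlas by auto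
  show "(patchUhat, \<lambda>q. vec (lamhat q)) \<in> matlas P1" by (simp add: P1_def)
  show "(patchUhat, \<lambda>q. vec (lamhat q)) \<in> charts P1" by (rule patchUhat_in_charts)
qed (rule fam sec fWhat sWhat patchUhat_chart(2) patchUhat_props | assumption)+

abbreviation "P \<equiv> normal_patching \<pi> F W w what"

text \<open>\<open>patching\<close> with \<lambda> and \<open>w\<close> packed into one vector, so
  that it can be differentiated in both jointly.\<close>

definition transition :: "complex^('k option) \<Rightarrow> complex^'k" where
  "transition = what \<circ> chart_inv U.cW"

definition overlap :: "(complex^('k option)) set" where
  "overlap = fibre_map lam \<pi> w ` (W \<inter> What)"

lemma overlap_open: "open overlap"
  using charts_props(7)[OF U.W_chart(1), of What] charts_props(1)[OF V.W_chart(1)]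
  by (simp add: overlap_def)

lemma transition_cdiff:
  assumes "u \<in> overlap"
  shows "cdiff transition u"
proof -
  from assms obtain p where p: "u = fibre_map lam \<pi> w p" "p \<in> W \<inter> What" unfolding overlap_def by (rule imageE)
  have "cdiff (snd V.cW \<circ> chart_inv U.cW) (snd U.cW p)"
    by (rule charts_compatible[OF U.Z U.W_chart(2) V.W_chart(2)]) (use p(2) in simp_all)
  then have "cdiff (\<lambda>x. ftail ((snd V.cW \<circ> chart_inv U.cW) x)) (snd U.cW p)" by (rule cdiff_ftail(1))
  then show ?thesis by (simp add: transition_def fibre_map_fpair comp_def p(1))
qed

context
  fixes x assumes x: "x \<in> topspace (mtop M)"
begin

lemma sect_overlap:
  assumes "z \<noteq> 0"
  shows "U.sect x (Some z) \<in> W" "U.sect x (Some z) \<in> What" "fpair z (U.curve x z) \<in> overlap"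
proof -
  show 1: "U.sect x (Some z) \<in> W" by (rule U.sect_in_W[OF x])
  show 2: "U.sect x (Some z) \<in> What" using V.sect_in_W[OF x, of "inverse z"] assms by (simp add: hatpt_inverse)
  show "fpair z (U.curve x z) \<in> overlap"
    unfolding overlap_def using 1 2 U.fibre_map_sect[OF x, of z]
    by (intro image_eqI[of _ _ "U.sect x (Some z)"]) (simp_all add: U.curve_def)
qed

lemma normal_patching_mult:
  assumes "z \<noteq> 0"
  shows "P x z *v h = jacobian transition (at (fpair z (U.curve x z))) *v fpair 0 h"
proof -
  have e: "(\<lambda>u. patching \<pi> W w what u z) = transition \<circ> (\<lambda>u. fpair z u)"
    by (simp add: patching_def transition_def fpair_def comp_def)
  have "P x z = jacobian (transition \<circ> (\<lambda>u. fpair z u)) (at (U.curve x z))"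
    unfolding normal_patching_def e U.restr_sect U.curve_def ..
  also have "\<dots> = jacobian transition (at (fpair z (U.curve x z))) ** jacobian (\<lambda>u. fpair z u) (at (U.curve x z))"
    by (rule cdiff_compose(2)[OF cdiff_fibre(1) transition_cdiff[OF sect_overlap(3)[OF assms]]])
  finally show ?thesis by (simp only: matrix_vector_mul_assoc[symmetric] cdiff_fibre(2))
qed

text \<open>Verticality refers to \<pi> and not to the fibre coordinates, so a vertical vector is
  vertical in both charts. Its fibre components change by the Jacobian of the patching at fixed
  \<lambda>.\<close>

lemma vertical_change:
  fixes h :: "complex^'k"
  assumes "z \<noteq> 0"
  defines "p \<equiv> U.sect x (Some z)"
  shows "U.vtan p (fpair 0 h) V.cW = fpair 0 (P x z *v h)"
proof -
  let ?v = "U.vtan p (fpair 0 h)"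
  have p: "p \<in> W" "p \<in> What" using sect_overlap[OF assms(1)] by (auto simp: p_def)
  have v: "?v \<in> tangent_space Z p" "?v U.cW = fpair 0 h" using U.vtan(1,2)[OF p(1)] by auto
  have "?v V.cW $ None = 0"
    using U.vertical_components(1)[OF p(1) v(1)] V.vertical_components(1)[OF p(2) v(1)] v(2) by simp
  moreover have "ftail (?v V.cW) = P x z *v h"
  proof -
    have pc: "fibre_map lam \<pi> w p = fpair z (U.curve x z)"
      using U.fibre_map_sect[OF x, of z] by (simp add: p_def U.curve_def)
    have "cdiff transition (fibre_map lam \<pi> w p)" unfolding pc by (rule transition_cdiff[OF sect_overlap(3)[OF assms(1)]])
    then have "mderiv Z what p ?v = jacobian transition (at (fibre_map lam \<pi> w p)) *v ?v U.cW"
      using mderiv_chart[OF U.Z v(1) U.W_chart(2)[OF p(1)], of what] unfolding transition_def by simp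
    then show ?thesis
      unfolding normal_patching_mult[OF assms(1)] V.vertical_components(2)[OF p(2) v(1)] pc v(2) .
  qed
  ultimately show ?thesis unfolding fpair_eq_iff by blast
qed

text \<open>A kernel vector of \<open>P x z\<close> gives a vertical tangent vector all of whose
  components in the second chart vanish, and such a vector is 0.\<close>

lemma normal_patching_invertible:
  assumes "z \<noteq> 0"
  shows "invertible (P x z)"
proof -
  let ?p = "U.sect x (Some z)"
  have p: "?p \<in> W" "?p \<in> What" by (rule sect_overlap[OF assms])+
  have "h = 0" if "P x z *v h = 0" for h
  proof -
    let ?v = "U.vtan ?p (fpair 0 h)"
    have f0: "fpair 0 0 = (0 :: complex^('k option))" by (simp add: vec_option_eq_iff)
    have vT: "?v \<in> tangent_space Z ?p" by (rule U.vtan(1)[OF p(1)])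
    have zT: "(\<lambda>_. 0) \<in> tangent_space Z ?p" by (simp add: tangent_space_def)
    have "?v V.cW = 0" unfolding vertical_change[OF assms] that by (rule f0)
    then have "?v = (\<lambda>_. 0)" by (intro tangent_eqI[OF vT zT V.W_chart(2)[OF p(2)]])
    then have "?v U.cW = 0" by (rule fun_cong)
    then have "fpair 0 h = fpair 0 0" unfolding U.vtan(2)[OF p(1)] f0 .
    then show "h = 0" using fpair_simps(3) by metis
  qed
  then show ?thesis by (simp add: invertible_left_inverse matrix_left_invertible_ker)
qed

text \<open>The entry in column \<open>j\<close> is the derivative at \<open>t = 0\<close> of a
  component of the patching at the point of the curve displaced by \<open>t\<close> in the direction
  \<open>j\<close>. This function is holomorphic in \<open>t\<close> and in \<open>z\<close>
  separately and jointly continuous, so \<open>partial_derivative_holomorphic\<close>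
  applies.\<close>

lemma normal_patching_holomorphic: "holo_matrix_on (P x) (- {0})"
  unfolding holo_matrix_on_def
proof (intro allI)
  fix i j :: 'k
  define e :: "complex^'k" where "e = axis j 1"
  define g where "g = (\<lambda>t z. fpair z (U.curve x z + t *s e))"
  define h where "h = (\<lambda>t z. transition (g t z) $ i)"
  define S where "S = (\<lambda>(t, z). g t z) -` overlap"
  have cont_curve: "continuous_on UNIV (\<lambda>z. U.curve x z $ \<mu>)" for \<mu>
    by (rule holomorphic_on_imp_continuous_on[OF U.curve_holomorphic(1)[OF x]])
  have cont_g: "continuous_on UNIV (\<lambda>(t, z). g t z)"
  proof -
    have "continuous_on UNIV (\<lambda>q. \<chi> \<mu>. g (fst q) (snd q) $ \<mu>)"
    proof (rule continuous_on_vec_lambda)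
      fix \<mu> :: "'k option"
      show "continuous_on UNIV (\<lambda>q. g (fst q) (snd q) $ \<mu>)"
      proof (cases \<mu>)
        case None
        then show ?thesis by (simp add: g_def continuous_on_snd[OF continuous_on_id])
      next
        case (Some a)
        have "continuous_on UNIV (\<lambda>q::complex \<times> complex. U.curve x (snd q) $ a)"
          by (rule continuous_on_compose2[OF cont_curve continuous_on_snd[OF continuous_on_id]]) simp
        then have "continuous_on UNIV (\<lambda>q. U.curve x (snd q) $ a + fst q * e $ a)"
          by (intro continuous_on_add continuous_on_mult continuous_on_fst continuous_on_id continuous_on_const)
        then show ?thesis by (simp add: g_def Some)
      qed
    qed
    then show ?thesis by (simp add: vec_lambda_eta case_prod_beta)
  qed
  have S: "open S" unfolding S_def by (rule open_vimage[OF overlap_open cont_g])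
  have S': "g t z \<in> overlap" if "(t, z) \<in> S" for t z using that by (simp add: S_def)
  have tr: "(\<lambda>s. transition (\<gamma> s) $ i) field_differentiable at a"
    if "\<And>\<mu>. (\<lambda>s. \<gamma> s $ \<mu>) field_differentiable at a" "\<gamma> a \<in> overlap" for \<gamma> :: "complex \<Rightarrow> complex^('k option)" and a
  proof -
    have "cdiff (transition \<circ> (\<lambda>u::complex^1. \<gamma> (u $ 1))) (vec a)"
      by (rule cdiff_compose(1)[OF cdiff_curve[OF that(1)]]) (simp add: transition_cdiff[OF that(2)])
    from cdiff_curveD[OF this, of i] show ?thesis by (auto simp: field_differentiable_def)
  qed
  have curve_fd: "(\<lambda>z. U.curve x z $ \<mu>) field_differentiable at z" for \<mu> z
    using holomorphic_on_imp_differentiable_at[OF U.curve_holomorphic(1)[OF x] open_UNIV] by simp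
  have deriv_h: "deriv (\<lambda>t. h t z) 0 = P x z $ i $ j" if z: "z \<noteq> 0" for z
  proof -
    let ?\<gamma> = "\<lambda>u::complex^1. g (u $ 1) z"
    define E :: "complex^1^'k" where "E = (\<chi> i j. e $ i)"
    have E: "E *v u = (u $ 1) *s e" for u by (simp add: E_def vec_eq_iff matrix_vector_mult_def UNIV_1)
    have g: "?\<gamma> = (\<lambda>u. fpair z u) \<circ> (\<lambda>u. U.curve x z + E *v (u - 0))"
      by (simp add: g_def E comp_def)
    have gd: "cdiff ?\<gamma> (vec 0)" "jacobian ?\<gamma> (at (vec 0)) *v u = fpair 0 ((u $ 1) *s e)" for u
    proof -
      note cc = cdiff_compose[OF cdiff_affine(1)[of "U.curve x z" E 0 "vec 0"] cdiff_fibre(1)[of z]]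
      show "cdiff ?\<gamma> (vec 0)" unfolding g by (rule cc(1))
      show "jacobian ?\<gamma> (at (vec 0)) *v u = fpair 0 ((u $ 1) *s e)"
        unfolding g cc(2) cdiff_affine(2) by (simp only: matrix_vector_mul_assoc[symmetric] cdiff_fibre(2) E)
    qed
    have g0: "?\<gamma> (vec 0) = fpair z (U.curve x z)" by (simp add: g_def)
    have trc: "cdiff transition (?\<gamma> (vec 0))" unfolding g0 by (rule transition_cdiff[OF sect_overlap(3)[OF z]])
    note c = cdiff_compose[OF gd(1) trc]
    have "((\<lambda>t. h t z) has_field_derivative jacobian (transition \<circ> ?\<gamma>) (at (vec 0)) $ i $ 1) (at 0)"
      using cdiff_curveD[OF c(1), of i] by (simp add: h_def)
    then have "deriv (\<lambda>t. h t z) 0 = jacobian (transition \<circ> ?\<gamma>) (at (vec 0)) $ i $ 1" by (rule DERIV_imp_deriv)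
    also have "\<dots> = (jacobian (transition \<circ> ?\<gamma>) (at (vec 0)) *v 1) $ i"
      by (simp add: matrix_vector_mult_def UNIV_1)
    also have "jacobian (transition \<circ> ?\<gamma>) (at (vec 0)) *v 1 = P x z *v e"
      unfolding c(2) g0 matrix_vector_mul_assoc[symmetric] gd(2) normal_patching_mult[OF z] by simp
    also have "(P x z *v e) $ i = P x z $ i $ j"
      by (simp add: e_def matrix_vector_mult_def axis_def if_distrib cong: if_cong)
    finally show ?thesis .
  qed
  have "(\<lambda>z. P x z $ i $ j) field_differentiable at z0" if z0: "z0 \<noteq> 0" for z0
  proof -
    have "(\<lambda>z. deriv (\<lambda>t. h t z) 0) field_differentiable at z0"
    proof (rule partial_derivative_holomorphic[OF S])
      have tc: "continuous_on overlap transition"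
        using transition_cdiff cdiff_continuous by (auto intro!: continuous_at_imp_continuous_on)
      have "continuous_on S (\<lambda>q. transition ((\<lambda>(t, z). g t z) q))"
        by (rule continuous_on_compose2[OF tc continuous_on_subset[OF cont_g]]) (auto simp: S_def)
      then have "continuous_on S (\<lambda>q. transition ((\<lambda>(t, z). g t z) q) $ i)" by (intro continuous_intros)
      then show "continuous_on S (\<lambda>(t, z). h t z)" by (simp add: h_def case_prod_beta)
    next
      fix t z assume tz: "(t, z) \<in> S"
      show "(\<lambda>t. h t z) field_differentiable at t"
        unfolding h_def
      proof (rule tr)
        fix \<mu> show "(\<lambda>s. g s z $ \<mu>) field_differentiable at t"
          by (cases \<mu>) (auto simp: g_def intro!: derivative_intros)
      qed (rule S'[OF tz])
      show "h t field_differentiable at z"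
        unfolding h_def
      proof (rule tr)
        fix \<mu> show "(\<lambda>s. g t s $ \<mu>) field_differentiable at z"
          by (cases \<mu>) (auto simp: g_def intro!: derivative_intros curve_fd)
      qed (rule S'[OF tz])
    next
      show "(0, z0) \<in> S" using sect_overlap(3)[OF z0] by (simp add: S_def g_def)
    qed
    then obtain D where "((\<lambda>z. deriv (\<lambda>t. h t z) 0) has_field_derivative D) (at z0)"
      unfolding field_differentiable_def by blast
    then have "((\<lambda>z. P x z $ i $ j) has_field_derivative D) (at z0)"
      by (rule has_field_derivative_transform_within_open[of _ _ _ "- {0}"]) (auto simp: z0 deriv_h)
    then show ?thesis unfolding field_differentiable_def by blast
  qed
  then show "(\<lambda>z. P x z $ i $ j) holomorphic_on - {0}"
    by (simp add: holomorphic_on_def field_differentiable_at_within)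
qed

text \<open>The vertical vectors formed from \<open>dw\<close> and from \<open>dwhat\<close>
  represent the same Kodaira class, so their difference is tangent to the curve. A tangent vector of
  the curve without \<lambda>-component is 0.\<close>

lemma d_restr_patching:
  assumes \<theta>: "\<theta> \<in> tangent_space M x" and z: "z \<noteq> 0"
  shows "d_restr M \<pi> F what (hatpt (inverse z)) x \<theta> = P x z *v d_restr M \<pi> F w (Some z) x \<theta>"
proof -
  let ?X = "submfd_at F x" and ?p = "U.sect x (Some z)"
  let ?s = "d_restr M \<pi> F w (Some z) x \<theta>" and ?t = "d_restr M \<pi> F what (hatpt (inverse z)) x \<theta>"
  have p: "?p \<in> W" "?p \<in> What" by (rule sect_overlap[OF z])+
  let ?u = "U.vtan ?p (fpair 0 ?s)" and ?v = "V.vtan ?p (fpair 0 ?t)"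
  have uT: "?u \<in> tangent_space Z ?p" by (rule U.vtan(1)[OF p(1)])
  have "lincomb 1 ?u (-1) ?u \<in> sub_tangent_space Z ?X ?p"
    unfolding U.curve_tangent[OF x] by (simp add: lincomb_def tangent_space_def)
  then have "?u \<in> kodaira Z M F x \<theta> ?p"
    unfolding U.kodaira_eq[OF x \<theta>] normal_coset_def using uT by simp
  also have "kodaira Z M F x \<theta> ?p = normal_coset Z ?X ?p ?v"
    using V.kodaira_eq[OF x \<theta>, of "inverse z"] by (simp only: hatpt_inverse[OF z])
  finally have "lincomb 1 ?u (-1) ?v \<in> sub_tangent_space Z ?X (U.sect x (hatpt (inverse z)))"
    by (simp add: normal_coset_def hatpt_inverse[OF z])
  then have "lincomb 1 ?u (-1) ?v V.cW =
      lincomb 1 ?u (-1) ?v V.cW $ None *s fpair 1 (V.curve' x (inverse z))"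
    unfolding V.curve_tangent[OF x] by blast
  moreover have "lincomb 1 ?u (-1) ?v V.cW = fpair 0 (P x z *v ?s) + (-1) *s fpair 0 ?t"
    unfolding lincomb_def vertical_change[OF z] V.vtan(2)[OF p(2)] by simp
  ultimately have "fpair 0 (P x z *v ?s) + (-1) *s fpair 0 ?t = (0 :: complex^('k option))"
    by (simp add: vec_option_eq_iff)
  then show ?thesis by (simp add: vec_option_eq_iff vec_eq_iff)
qed

lemma kodaira_form: "kodaira Z M F x \<in> H0_normal_form Z (submfd_at F x) M x"
  unfolding H0_normal_form_def mem_Collect_eq
proof (intro conjI ballI allI)
  show "kodaira Z M F x \<theta> \<in> H0_normal Z (submfd_at F x)" if "\<theta> \<in> tangent_space M x" for \<theta>
    using comp x that unfolding complete_family_def bij_betw_def by blast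
next
  fix \<theta> \<eta> a b p u u'
  assume \<theta>: "\<theta> \<in> tangent_space M x" "\<eta> \<in> tangent_space M x" and p: "p \<in> submfd_at F x"
    and u: "u \<in> kodaira Z M F x \<theta> p" "u' \<in> kodaira Z M F x \<eta> p"
  have ps: "p = U.sect x (\<pi> p)" by (rule U.sect_props(3)[OF x p, symmetric])
  show "lincomb a u b u' \<in> kodaira Z M F x (lincomb a \<theta> b \<eta>) p"
  proof (cases "\<pi> p")
    case None
    then have "p = V.sect x (hatpt 0)" using ps by (simp add: hatpt_def)
    then show ?thesis using V.kodaira_lincomb[OF x \<theta>] u by blast
  next
    case (Some z)
    then have "p = U.sect x (Some z)" using ps by simp
    then show ?thesis using U.kodaira_lincomb[OF x \<theta>] u by blast
  qed
qed

end

end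

section \<open>The coefficients of the frame section, their linearity, and the freedom in the
  frame\<close>

lemma frame_form_coeff:
  assumes "\<And>z. poly p z = frame_sec M \<pi> F w H x \<theta> z $ i"
  shows "frame_form M \<pi> F w H i r x \<theta> = coeff p r"
proof -
  have "(THE p. \<forall>z. poly p z = frame_sec M \<pi> F w H x \<theta> z $ i) = p"
  proof (rule the_equality)
    fix q assume "\<forall>z. poly q z = frame_sec M \<pi> F w H x \<theta> z $ i"
    then have "poly q = poly p" using assms by (intro ext) simp
    then show "q = p" by (simp only: poly_eq_poly_eq_iff)
  qed (use assms in blast)
  then show ?thesis by (simp add: frame_form_def)
qed

context section_family
begin

text \<open>The splittings of different curves are chosen independently of each other;
  \<open>splitting\<close> imposes no condition that links them.\<close>

lemma splitting_exists: "\<exists>n H Hhat. splitting M \<pi> F W w what n H Hhat"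
  unfolding splitting_def
proof (rule choice3)
  fix x assume x: "x \<in> topspace (mtop M)"
  obtain n H Hhat where "birkhoff (P x) n H Hhat"
    by (rule birkhoff_grothendieck[OF normal_patching_holomorphic[OF x] normal_patching_invertible[OF x]])
  then show "\<exists>n H Hhat. birkhoff (P x) n H Hhat" by blast
qed

context
  fixes n H Hhat x
  assumes x: "x \<in> topspace (mtop M)" and spl: "splitting M \<pi> F W w what n H Hhat"
begin

lemma birkhoff_at: "birkhoff (P x) (n x) (H x) (Hhat x)"
  using spl x by (simp add: splitting_def)

lemma frame_cocycle:
  assumes \<theta>: "\<theta> \<in> tangent_space M x"
  shows "(frame_sec M \<pi> F w H x \<theta>, frame_sec_hat M \<pi> F what Hhat x \<theta>) \<in> cech_H0 (split_patching (n x))"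
proof -
  have f: "frame_sec M \<pi> F w H x \<theta> = (\<lambda>z. matrix_inv (H x z) *v d_restr M \<pi> F w (Some z) x \<theta>)"
    "frame_sec_hat M \<pi> F what Hhat x \<theta> = (\<lambda>z. matrix_inv (Hhat x z) *v d_restr M \<pi> F what (hatpt z) x \<theta>)"
    by (auto simp: frame_sec_def frame_sec_hat_def)
  show ?thesis
    unfolding f
    by (rule birkhoff_cocycle[OF birkhoff_at U.d_restr_holomorphic[OF comp x \<theta>]
        V.d_restr_holomorphic[OF comp x \<theta>] d_restr_patching[OF x \<theta>]])
qed

text \<open>Component \<open>i\<close> of the frame section is a global section of the line bundle
  of degree \<open>n x i\<close>, so finitely many coefficients determine it.\<close>

lemma frame_polynomial:
  assumes \<theta>: "\<theta> \<in> tangent_space M x"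
  obtains p where "\<And>z. poly p z = frame_sec M \<pi> F w H x \<theta> z $ i" "\<And>r. r \<ge> nat (n x i + 1) \<Longrightarrow> coeff p r = 0"
proof -
  let ?s = "frame_sec M \<pi> F w H x \<theta>" and ?t = "frame_sec_hat M \<pi> F what Hhat x \<theta>"
  have c: "(\<lambda>z. ?s z $ i) holomorphic_on UNIV" "(\<lambda>z. ?t z $ i) holomorphic_on UNIV"
    "\<And>z. z \<noteq> 0 \<Longrightarrow> ?t (inverse z) = split_patching (n x) z *v ?s z"
    using frame_cocycle[OF \<theta>] by (simp_all add: cech_H0_def)
  have "?t (inverse z) $ i = z powi (- n x i) * ?s z $ i" if "z \<noteq> 0" for z
    unfolding c(3)[OF that] by (rule split_patching_vector_nth)
  from line_bundle_section_polynomial[OF c(1,2) this] that show ?thesis by blast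
qed

text \<open>The coefficients are defined through \<open>THE\<close> polynomial, so linearity rests
  on uniqueness: the combination of the representing polynomials represents the frame section of the
  combined vector.\<close>

lemma frame_form_lincomb:
  assumes \<theta>: "\<theta> \<in> tangent_space M x" "\<eta> \<in> tangent_space M x"
  shows "frame_form M \<pi> F w H i r x (lincomb a \<theta> b \<eta>) =
    a * frame_form M \<pi> F w H i r x \<theta> + b * frame_form M \<pi> F w H i r x \<eta>"
proof -
  obtain p where p: "\<And>z. poly p z = frame_sec M \<pi> F w H x \<theta> z $ i" "\<And>r. r \<ge> nat (n x i + 1) \<Longrightarrow> coeff p r = 0"
    by (rule frame_polynomial[OF \<theta>(1)]) blast
  obtain q where q: "\<And>z. poly q z = frame_sec M \<pi> F w H x \<eta> z $ i" "\<And>r. r \<ge> nat (n x i + 1) \<Longrightarrow> coeff q r = 0"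
    by (rule frame_polynomial[OF \<theta>(2)]) blast
  have "poly (smult a p + smult b q) z = frame_sec M \<pi> F w H x (lincomb a \<theta> b \<eta>) z $ i" for z
    using U.d_restr_lincomb[OF x \<theta>, of z a b]
    by (simp add: p(1) q(1) frame_sec_def matrix_vector_right_distrib vector_scalar_commute)
  then show ?thesis
    using frame_form_coeff[OF p(1), of r] frame_form_coeff[OF q(1), of r]
      frame_form_coeff[of "smult a p + smult b q" M \<pi> F w H x "lincomb a \<theta> b \<eta>" i r] by simp
qed

text \<open>\<open>H\<close> applied to the frame section gives back \<open>dw\<close>, so the frame
  section is the Kodaira class written in the trivialisation by \<open>H\<close>.\<close>

lemma kodaira_frame:
  assumes \<theta>: "\<theta> \<in> tangent_space M x" and p: "p \<in> submfd_at F x"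
  shows "\<pi> p \<in> patchU \<Longrightarrow> kodaira Z M F x \<theta> p = normal_of_components Z \<pi> (submfd_at F x) w p
      (H x (lam (\<pi> p)) *v frame_sec M \<pi> F w H x \<theta> (lam (\<pi> p)))"
    "\<pi> p \<in> patchUhat \<Longrightarrow> kodaira Z M F x \<theta> p = normal_of_components Z \<pi> (submfd_at F x) what p
      (Hhat x (lamhat (\<pi> p)) *v frame_sec_hat M \<pi> F what Hhat x \<theta> (lamhat (\<pi> p)))"
proof -
  have inv: "invertible (H x z)" "invertible (Hhat x z)" for z
    using birkhoff_at by (simp_all add: birkhoff_def)
  have f: "H x z *v frame_sec M \<pi> F w H x \<theta> z = d_restr M \<pi> F w (Some z) x \<theta>"
    "Hhat x z *v frame_sec_hat M \<pi> F what Hhat x \<theta> z = d_restr M \<pi> F what (hatpt z) x \<theta>" for z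
    by (simp_all add: frame_sec_def frame_sec_hat_def matrix_vector_mul_assoc matrix_inv_mult(1)[OF inv(1)]
        matrix_inv_mult(1)[OF inv(2)])
  show "kodaira Z M F x \<theta> p = normal_of_components Z \<pi> (submfd_at F x) w p
      (H x (lam (\<pi> p)) *v frame_sec M \<pi> F w H x \<theta> (lam (\<pi> p)))" if "\<pi> p \<in> patchU"
    using U.kodaira_normal_of_components[OF x \<theta>, of "lam (\<pi> p)"]
    unfolding f U.pt(3)[OF that] U.sect_props(3)[OF x p] .
  show "kodaira Z M F x \<theta> p = normal_of_components Z \<pi> (submfd_at F x) what p
      (Hhat x (lamhat (\<pi> p)) *v frame_sec_hat M \<pi> F what Hhat x \<theta> (lamhat (\<pi> p)))" if "\<pi> p \<in> patchUhat"
    using V.kodaira_normal_of_components[OF x \<theta>, of "lamhat (\<pi> p)"]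
    unfolding f V.pt(3)[OF that] V.sect_props(3)[OF x p] .
qed

lemma frame_form_sum:
  assumes \<theta>: "\<theta> \<in> tangent_space M x"
  shows "frame_sec M \<pi> F w H x \<theta> z $ i = (\<Sum>r<nat (n x i + 1). frame_form M \<pi> F w H i r x \<theta> * z ^ r)"
proof -
  obtain p where p: "\<And>z. poly p z = frame_sec M \<pi> F w H x \<theta> z $ i" "\<And>r. r \<ge> nat (n x i + 1) \<Longrightarrow> coeff p r = 0"
    by (rule frame_polynomial[OF \<theta>]) blast
  show ?thesis
    unfolding frame_form_coeff[OF p(1)] p(1)[symmetric] by (rule poly_eq_truncated_sum[OF p(2)])
qed

lemma frame_unique:
  assumes spl': "splitting M \<pi> F W w what n' H' Hhat'"
  shows "\<exists>\<rho> g ghat. bij \<rho> \<and> n' x = n x \<circ> \<rho> \<and> (g, ghat) \<in> cech_H0_End_inv (split_patching (n x)) \<and>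
    (\<forall>\<theta>\<in>tangent_space M x. \<forall>z i.
      frame_sec M \<pi> F w H' x \<theta> z $ i = (g z *v frame_sec M \<pi> F w H x \<theta> z) $ \<rho> i \<and>
      frame_sec_hat M \<pi> F what Hhat' x \<theta> z $ i = (ghat z *v frame_sec_hat M \<pi> F what Hhat x \<theta> z) $ \<rho> i)"
proof -
  have b': "birkhoff (P x) (n' x) (H' x) (Hhat' x)" using spl' x by (simp add: splitting_def)
  obtain \<rho> g ghat where "bij \<rho>" "n' x = n x \<circ> \<rho>" "(g, ghat) \<in> cech_H0_End_inv (split_patching (n x))"
    and r: "\<And>z i y. (matrix_inv (H' x z) *v y) $ i = (g z *v (matrix_inv (H x z) *v y)) $ \<rho> i"
    "\<And>z i y. (matrix_inv (Hhat' x z) *v y) $ i = (ghat z *v (matrix_inv (Hhat x z) *v y)) $ \<rho> i"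
    by (rule birkhoff_unique[OF birkhoff_at b']) blast
  then show ?thesis
    by (intro exI[of _ \<rho>] exI[of _ g] exI[of _ ghat] conjI ballI allI)
      (simp_all only: frame_sec_def frame_sec_hat_def r)
qed

end

text \<open>The converse of \<open>frame_unique\<close>. Since \<open>splitting\<close> treats the
  curves separately, \<open>g\<close> may vary arbitrarily with \<open>x\<close>.\<close>

lemma frame_gauge:
  assumes spl: "splitting M \<pi> F W w what n H Hhat"
    and g: "\<And>x. x \<in> topspace (mtop M) \<Longrightarrow> (g x, ghat x) \<in> cech_H0_End_inv (split_patching (n x))"
  shows "\<exists>H' Hhat'. splitting M \<pi> F W w what n H' Hhat' \<and>
    (\<forall>x\<in>topspace (mtop M). \<forall>\<theta>\<in>tangent_space M x. \<forall>z.
      frame_sec M \<pi> F w H' x \<theta> z = g x z *v frame_sec M \<pi> F w H x \<theta> z \<and>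
      frame_sec_hat M \<pi> F what Hhat' x \<theta> z = ghat x z *v frame_sec_hat M \<pi> F what Hhat x \<theta> z)"
proof (intro exI conjI ballI allI)
  let ?H' = "\<lambda>x z. H x z ** matrix_inv (g x z)" and ?Hhat' = "\<lambda>x z. Hhat x z ** matrix_inv (ghat x z)"
  note G = birkhoff_gauge[OF birkhoff_at[OF _ spl] g]
  show "splitting M \<pi> F W w what n ?H' ?Hhat'" unfolding splitting_def using G(1) by blast
  fix x \<theta> z assume x: "x \<in> topspace (mtop M)"
  show "frame_sec M \<pi> F w ?H' x \<theta> z = g x z *v frame_sec M \<pi> F w H x \<theta> z"
    unfolding frame_sec_def by (rule G(2)[OF x x])
  show "frame_sec_hat M \<pi> F what ?Hhat' x \<theta> z = ghat x z *v frame_sec_hat M \<pi> F what Hhat x \<theta> z"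
    unfolding frame_sec_hat_def by (rule G(3)[OF x x])
qed

end

text \<open>The section of the normal bundle that the frame section represents is the Kodaira map
  itself. Endomorphisms are written in the trivialisations by \<open>H\<close> and
  \<open>Hhat\<close>, as the frame section is, so their cocycles refer to
  \<open>split_patching (n x)\<close> instead of the normal patching. Any two frame sections differ
  by such a cocycle, up to the order of the summands, and every invertible cocycle occurs.\<close>

theorem theorem1p3:
  fixes Z :: "('z, 'k::finite option) cmfd"
    and M :: "('x, 'm::finite) cmfd"
    and \<pi> :: "'z \<Rightarrow> complex option"
    and F :: "('z \<times> 'x) set"
    and W What :: "'z set"
    and w what :: "'z \<Rightarrow> complex^'k"
  assumes "complex_manifold Z" and "complex_manifold M"
    and "holomorphic_map Z P1 \<pi>"
    and "holomorphic_family Z M F" and "complete_family Z M F"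
    and "\<And>x. x \<in> topspace (mtop M) \<Longrightarrow> is_section Z \<pi> (submfd_at F x)"
    and "fibre_coordinates Z \<pi> patchU lam W w"
    and "fibre_coordinates Z \<pi> patchUhat lamhat What what"
    and "\<And>x. x \<in> topspace (mtop M) \<Longrightarrow> submfd_at F x \<inter> \<pi> -` patchU \<subseteq> W"
    and "\<And>x. x \<in> topspace (mtop M) \<Longrightarrow> submfd_at F x \<inter> \<pi> -` patchUhat \<subseteq> What"
  shows
    "(\<exists>n H Hhat. splitting M \<pi> F W w what n H Hhat) \<and>
     (\<forall>n H Hhat. splitting M \<pi> F W w what n H Hhat \<longrightarrow>
        (\<forall>x\<in>topspace (mtop M).
           (\<exists>\<Sigma>\<in>H0_normal_form Z (submfd_at F x) M x.
              \<forall>\<theta>\<in>tangent_space M x. \<forall>p\<in>submfd_at F x.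
                (\<pi> p \<in> patchU \<longrightarrow> \<Sigma> \<theta> p = normal_of_components Z \<pi> (submfd_at F x) w p
                   (H x (lam (\<pi> p)) *v frame_sec M \<pi> F w H x \<theta> (lam (\<pi> p)))) \<and>
                (\<pi> p \<in> patchUhat \<longrightarrow> \<Sigma> \<theta> p = normal_of_components Z \<pi> (submfd_at F x) what p
                   (Hhat x (lamhat (\<pi> p)) *v frame_sec_hat M \<pi> F what Hhat x \<theta> (lamhat (\<pi> p))))) \<and>
           (\<forall>\<theta>\<in>tangent_space M x.
              (frame_sec M \<pi> F w H x \<theta>, frame_sec_hat M \<pi> F what Hhat x \<theta>)
                \<in> cech_H0 (split_patching (n x)) \<and>
              (\<forall>i z. frame_sec M \<pi> F w H x \<theta> z $ i =
                 (\<Sum>r<nat (n x i + 1). frame_form M \<pi> F w H i r x \<theta> * z ^ r)))) \<and>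
        (\<forall>i r. one_form M (frame_form M \<pi> F w H i r))) \<and>
     (\<forall>n H Hhat n' H' Hhat'.
        splitting M \<pi> F W w what n H Hhat \<and> splitting M \<pi> F W w what n' H' Hhat' \<longrightarrow>
        (\<forall>x\<in>topspace (mtop M). \<exists>\<rho> g ghat.
           bij \<rho> \<and> n' x = n x \<circ> \<rho> \<and> (g, ghat) \<in> cech_H0_End_inv (split_patching (n x)) \<and>
           (\<forall>\<theta>\<in>tangent_space M x. \<forall>z i.
              frame_sec M \<pi> F w H' x \<theta> z $ i = (g z *v frame_sec M \<pi> F w H x \<theta> z) $ \<rho> i \<and>
              frame_sec_hat M \<pi> F what Hhat' x \<theta> z $ i =
                (ghat z *v frame_sec_hat M \<pi> F what Hhat x \<theta> z) $ \<rho> i))) \<and>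
     (\<forall>n H Hhat g ghat.
        splitting M \<pi> F W w what n H Hhat \<and>
        (\<forall>x\<in>topspace (mtop M). (g x, ghat x) \<in> cech_H0_End_inv (split_patching (n x))) \<longrightarrow>
        (\<exists>H' Hhat'. splitting M \<pi> F W w what n H' Hhat' \<and>
           (\<forall>x\<in>topspace (mtop M). \<forall>\<theta>\<in>tangent_space M x. \<forall>z.
              frame_sec M \<pi> F w H' x \<theta> z = g x z *v frame_sec M \<pi> F w H x \<theta> z \<and>
              frame_sec_hat M \<pi> F what Hhat' x \<theta> z =
                ghat x z *v frame_sec_hat M \<pi> F what Hhat x \<theta> z)))"
proof (intro conjI allI impI ballI)
  interpret section_family Z M \<pi> F W What w what
    by unfold_locales (fact assms)+
  show "\<exists>n H Hhat. splitting M \<pi> F W w what n H Hhat" by (rule splitting_exists)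
  fix n H Hhat assume spl: "splitting M \<pi> F W w what n H Hhat"
  show "one_form M (frame_form M \<pi> F w H i r)" for i r
    unfolding one_form_def using frame_form_lincomb[OF _ spl] by blast
  fix x assume x: "x \<in> topspace (mtop M)"
  show "\<exists>\<Sigma>\<in>H0_normal_form Z (submfd_at F x) M x.
      \<forall>\<theta>\<in>tangent_space M x. \<forall>p\<in>submfd_at F x.
        (\<pi> p \<in> patchU \<longrightarrow> \<Sigma> \<theta> p = normal_of_components Z \<pi> (submfd_at F x) w p
           (H x (lam (\<pi> p)) *v frame_sec M \<pi> F w H x \<theta> (lam (\<pi> p)))) \<and>
        (\<pi> p \<in> patchUhat \<longrightarrow> \<Sigma> \<theta> p = normal_of_components Z \<pi> (submfd_at F x) what p
           (Hhat x (lamhat (\<pi> p)) *v frame_sec_hat M \<pi> F what Hhat x \<theta> (lamhat (\<pi> p))))"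
    by (rule bexI[OF _ kodaira_form[OF x]])
      (intro ballI conjI impI, erule (2) kodaira_frame(1)[OF x spl], erule (2) kodaira_frame(2)[OF x spl])
  fix \<theta> assume \<theta>: "\<theta> \<in> tangent_space M x"
  show "(frame_sec M \<pi> F w H x \<theta>, frame_sec_hat M \<pi> F what Hhat x \<theta>) \<in> cech_H0 (split_patching (n x))"
    by (rule frame_cocycle[OF x spl \<theta>])
  show "frame_sec M \<pi> F w H x \<theta> z $ i = (\<Sum>r<nat (n x i + 1). frame_form M \<pi> F w H i r x \<theta> * z ^ r)" for i z
    by (rule frame_form_sum[OF x spl \<theta>])
next
  interpret section_family Z M \<pi> F W What w what
    by unfold_locales (fact assms)+
  fix n H Hhat n' H' Hhat' x
  assume "splitting M \<pi> F W w what n H Hhat \<and> splitting M \<pi> F W w what n' H' Hhat'"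
    and x: "x \<in> topspace (mtop M)"
  then show "\<exists>\<rho> g ghat. bij \<rho> \<and> n' x = n x \<circ> \<rho> \<and> (g, ghat) \<in> cech_H0_End_inv (split_patching (n x)) \<and>
      (\<forall>\<theta>\<in>tangent_space M x. \<forall>z i.
        frame_sec M \<pi> F w H' x \<theta> z $ i = (g z *v frame_sec M \<pi> F w H x \<theta> z) $ \<rho> i \<and>
        frame_sec_hat M \<pi> F what Hhat' x \<theta> z $ i = (ghat z *v frame_sec_hat M \<pi> F what Hhat x \<theta> z) $ \<rho> i)"
    by (intro frame_unique[OF x]) simp_all
next
  interpret section_family Z M \<pi> F W What w what
    by unfold_locales (fact assms)+
  fix n H Hhat g ghat
  assume "splitting M \<pi> F W w what n H Hhat \<and>
    (\<forall>x\<in>topspace (mtop M). (g x, ghat x) \<in> cech_H0_End_inv (split_patching (n x)))"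
  then show "\<exists>H' Hhat'. splitting M \<pi> F W w what n H' Hhat' \<and>
      (\<forall>x\<in>topspace (mtop M). \<forall>\<theta>\<in>tangent_space M x. \<forall>z.
        frame_sec M \<pi> F w H' x \<theta> z = g x z *v frame_sec M \<pi> F w H x \<theta> z \<and>
        frame_sec_hat M \<pi> F what Hhat' x \<theta> z = ghat x z *v frame_sec_hat M \<pi> F what Hhat x \<theta> z)"
    by (intro frame_gauge) simp_all
qed

end
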